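(* Let $k$ be an algebraically closed field of characteristic zero. Let $J=(f_1,f_2,f_3)\subseteq R=k[x_1,\ldots,x_n]$, $n\ge3$, be a $d$-equigenerated ideal (minimally generated by three homogeneous forms of degree $d$) with $\mathrm{ht}(J)=2$. If $e=\mathrm{indeg}(\mathrm{Syz}(J))$ (in the standard grading), then $$\mathrm{Bour}(J)\le e^2.$$ Consequently, $$d(d-e)\le\deg(R/J)\le d^2-de+e^2.$$
   Context: Here $\mathrm{Syz}(J)=\{(a_1,a_2,a_3)\in R^3: a_1f_1+a_2f_2+a_3f_3=0\}$ is graded as a submodule of $R^3$ (standard grading), so a syzygy of degree $e$ has all nonzero coordinates of degree $e$; $\mathrm{indeg}(\mathrm{Syz}(J))$ is the least degree of a nonzero homogeneous syzygy. $\deg(R/J)$ is the multiplicity of $R/J$. Bourbaki degree: let $\nu$ be a minimal generator of $\mathrm{Syz}(J)$ of degree $e=\mathrm{indeg}(\mathrm{Syz}(J))$. If $J$ is perfect of height two (i.e. $R/J$ is Cohen--Macaulay), put $\mathrm{Bour}(J)=0$. Otherwise $\mathrm{Syz}(J)/R\nu$ is isomorphic, up to shift, to an unmixed homogeneous ideal $I_\nu\subseteq R$ of height $2$, and $\mathrm{Bour}(J)=\deg(R/I_\nu)$. This is independent of $\nu$, and in all cases $\mathrm{Bour}(J)=d^2-ed+e^2-\deg(R/J)$. *)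

theory Defs
  imports
    "HOL-Library.Poly_Mapping"
    "HOL-Library.Product_Plus"
    "HOL-Library.Extended_Nat"
    "HOL-Library.Cardinality"
    "HOL-Computational_Algebra.Polynomial"
    "Jordan_Normal_Form.Matrix"
begin

section \<open>The polynomial ring and its grading\<close>

text \<open>
  The variables are indexed by a finite type \<open>'n\<close>, so that \<open>n = CARD('n)\<close>; a monomial is
  its exponent vector.
\<close>

type_synonym ('n, 'k) mpol = "('n \<Rightarrow>\<^sub>0 nat) \<Rightarrow>\<^sub>0 'k"

definition mon_deg :: "('n::finite \<Rightarrow>\<^sub>0 nat) \<Rightarrow> nat" where
  "mon_deg t = (\<Sum>i\<in>UNIV. Poly_Mapping.lookup t i)"

text \<open>
  Degrees are integers, so that shifts of the grading need no side conditions: the zero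
  polynomial is homogeneous of every degree, and the only one homogeneous of a negative degree.
\<close>

definition homog :: "int \<Rightarrow> ('n::finite, 'k::zero) mpol \<Rightarrow> bool" where
  "homog m p \<longleftrightarrow> (\<forall>t\<in>Poly_Mapping.keys p. int (mon_deg t) = m)"

definition cscale :: "'k::field \<Rightarrow> ('n, 'k) mpol \<Rightarrow> ('n, 'k) mpol" where
  "cscale c p = Poly_Mapping.single 0 c * p"

lemma vector_space_cscale: "Vector_Spaces.vector_space (cscale :: 'k::field \<Rightarrow> ('n, 'k) mpol \<Rightarrow> _)"
  by unfold_locales
    (simp_all add: cscale_def distrib_left distrib_right single_add mult_single mult.assoc [symmetric])

section \<open>Ideals, primes, height, unmixedness\<close>

abbreviation is_ideal :: "'r::comm_ring_1 set \<Rightarrow> bool" where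
  "is_ideal \<equiv> Modules.module.subspace (*)"

abbreviation ideal_gen :: "'r::comm_ring_1 set \<Rightarrow> 'r set" where
  "ideal_gen \<equiv> Modules.module.span (*)"

lemma module_mult: "Modules.module ((*) :: 'r::comm_ring_1 \<Rightarrow> 'r \<Rightarrow> 'r)"
  by unfold_locales (simp_all add: algebra_simps)

definition minimally_generates ::
    "('r::comm_ring_1 \<Rightarrow> 'm::ab_group_add \<Rightarrow> 'm) \<Rightarrow> 'm set \<Rightarrow> 'm set \<Rightarrow> bool" where
  "minimally_generates scl G M \<longleftrightarrow>
     Modules.module.span scl G = M \<and> (\<forall>H. H \<subset> G \<longrightarrow> Modules.module.span scl H \<noteq> M)"

definition homog_ideal :: "('n::finite, 'k::field) mpol set \<Rightarrow> bool" where
  "homog_ideal I \<longleftrightarrow> (\<exists>S. (\<forall>g\<in>S. \<exists>m. homog m g) \<and> I = ideal_gen S)"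

definition is_prime_ideal :: "'r::comm_ring_1 set \<Rightarrow> bool" where
  "is_prime_ideal P \<longleftrightarrow> is_ideal P \<and> P \<noteq> UNIV \<and> (\<forall>a b. a * b \<in> P \<longrightarrow> a \<in> P \<or> b \<in> P)"

definition height_prime :: "'r::comm_ring_1 set \<Rightarrow> enat" where
  "height_prime P = Sup {enat m | m. \<exists>C :: nat \<Rightarrow> 'r set.
     (\<forall>i\<le>m. is_prime_ideal (C i)) \<and> (\<forall>i<m. C i \<subset> C (Suc i)) \<and> C m = P}"

definition height :: "'r::comm_ring_1 set \<Rightarrow> enat" where
  "height I = Inf {height_prime P | P. is_prime_ideal P \<and> I \<subseteq> P}"

text \<open>The associated primes of \<open>R/I\<close> are the prime ideals of the form \<open>(I : g)\<close>.\<close>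

definition assoc_primes :: "'r::comm_ring_1 set \<Rightarrow> 'r set set" where
  "assoc_primes I = {P. is_prime_ideal P \<and> (\<exists>g. P = {a. a * g \<in> I})}"

definition unmixed :: "'r::comm_ring_1 set \<Rightarrow> bool" where
  "unmixed I \<longleftrightarrow> (\<forall>P\<in>assoc_primes I. height_prime P = height I)"

section \<open>Hilbert function and multiplicity\<close>

text \<open>
  For a homogeneous ideal \<open>I\<close>, \<open>hilb_fun I m\<close> is the dimension over \<open>k\<close> of the degree \<open>m\<close>
  component \<open>R\<^sub>m / (I \<inter> R\<^sub>m)\<close> of \<open>R/I\<close>; the subtraction is never truncated.
\<close>

definition hilb_fun :: "('n::finite, 'k::field) mpol set \<Rightarrow> nat \<Rightarrow> nat" where
  "hilb_fun I m = Vector_Spaces.vector_space.dim cscale {p :: ('n, 'k) mpol. homog (int m) p}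
                  - Vector_Spaces.vector_space.dim cscale {p \<in> I. homog (int m) p}"

definition hilb_poly :: "('n::finite, 'k::field) mpol set \<Rightarrow> rat poly" where
  "hilb_poly I = (THE P. \<forall>\<^sub>F m in sequentially. of_nat (hilb_fun I m) = poly P (of_nat m))"

text \<open>
  The multiplicity of \<open>R/I\<close>: if the Hilbert polynomial is nonzero, its degree is
  \<open>dim (R/I) - 1\<close> and the multiplicity is its leading coefficient normalised by a factorial;
  otherwise \<open>R/I\<close> has finite length and the multiplicity is that length.
\<close>

definition mult_quot :: "('n::finite, 'k::field) mpol set \<Rightarrow> rat" where
  "mult_quot I =
     (if hilb_poly I = 0 then of_nat (\<Sum>m | hilb_fun I m \<noteq> 0. hilb_fun I m)
      else fact (degree (hilb_poly I)) * lead_coeff (hilb_poly I))"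

section \<open>Graded free resolutions and perfect ideals\<close>

text \<open>
  The list \<open>s\<close> stands for the graded free module \<open>\<Oplus>\<^sub>i R(- s ! i)\<close>. A graded map of degree 0
  from the module of \<open>t\<close> to that of \<open>s\<close> is a matrix whose entry \<open>(i, j)\<close> is homogeneous of
  degree \<open>t ! j - s ! i\<close>.
\<close>

definition graded_map ::
    "int list \<Rightarrow> int list \<Rightarrow> ('n::finite, 'k::field) mpol mat \<Rightarrow> bool" where
  "graded_map s t A \<longleftrightarrow> A \<in> carrier_mat (length s) (length t) \<and>
     (\<forall>i<length s. \<forall>j<length t. homog (t ! j - s ! i) (A $$ (i, j)))"

definition mat_ker :: "'r::comm_ring_1 mat \<Rightarrow> 'r vec set" where
  "mat_ker A = {v \<in> carrier_vec (dim_col A). A *\<^sub>v v = 0\<^sub>v (dim_row A)}"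

definition mat_image :: "'r::comm_ring_1 mat \<Rightarrow> 'r vec set" where
  "mat_image A = (\<lambda>v. A *\<^sub>v v) ` carrier_vec (dim_col A)"

text \<open>
  A graded free resolution \<open>0 \<rightarrow> F\<^sub>p \<rightarrow> \<dots> \<rightarrow> F\<^sub>1 \<rightarrow> F\<^sub>0 = R\<close> of \<open>R/I\<close>, where \<open>\<phi> i\<close> is the map
  \<open>F\<^sub>i\<^sub>+\<^sub>1 \<rightarrow> F\<^sub>i\<close>. The modules \<open>F\<^sub>i\<close> with \<open>i > p\<close> are zero, which makes the exactness condition
  at \<open>F\<^sub>p\<close> say that the leftmost map is injective.
\<close>

definition graded_free_res ::
    "('n::finite, 'k::field) mpol set \<Rightarrow> nat \<Rightarrow> (nat \<Rightarrow> int list) \<Rightarrow>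
     (nat \<Rightarrow> ('n, 'k) mpol mat) \<Rightarrow> bool" where
  "graded_free_res I p s \<phi> \<longleftrightarrow>
     s 0 = [0] \<and> (\<forall>i>p. s i = []) \<and>
     (\<forall>i. graded_map (s i) (s (Suc i)) (\<phi> i)) \<and>
     (\<lambda>v. v $ 0) ` mat_image (\<phi> 0) = I \<and>
     (\<forall>i. mat_ker (\<phi> i) = mat_image (\<phi> (Suc i)))"

text \<open>The (graded) projective dimension of \<open>R/I\<close>.\<close>

definition proj_dim_quot :: "('n::finite, 'k::field) mpol set \<Rightarrow> enat" where
  "proj_dim_quot I = Inf {enat p | p. \<exists>s \<phi>. graded_free_res I p s \<phi>}"

text \<open>Since the polynomial ring is Cohen--Macaulay, the grade of \<open>I\<close> is its height.\<close>

definition perfect_ideal :: "('n::finite, 'k::field) mpol set \<Rightarrow> bool" where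
  "perfect_ideal I \<longleftrightarrow> proj_dim_quot I = height I"

section \<open>Syzygies and the Bourbaki degree\<close>

definition scale3 :: "'r::comm_ring_1 \<Rightarrow> 'r \<times> 'r \<times> 'r \<Rightarrow> 'r \<times> 'r \<times> 'r" where
  "scale3 r = (\<lambda>(a1, a2, a3). (r * a1, r * a2, r * a3))"

lemma module_scale3: "Modules.module (scale3 :: 'r::comm_ring_1 \<Rightarrow> _)"
  by unfold_locales (auto simp: scale3_def algebra_simps)

definition homog3 ::
    "int \<Rightarrow> ('n::finite, 'k::zero) mpol \<times> ('n, 'k) mpol \<times> ('n, 'k) mpol \<Rightarrow> bool" where
  "homog3 m = (\<lambda>(a1, a2, a3). homog m a1 \<and> homog m a2 \<and> homog m a3)"

definition Syz :: "'r::comm_ring_1 \<Rightarrow> 'r \<Rightarrow> 'r \<Rightarrow> ('r \<times> 'r \<times> 'r) set" where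
  "Syz f1 f2 f3 = {(a1, a2, a3). a1 * f1 + a2 * f2 + a3 * f3 = 0}"

definition indeg ::
    "(('n::finite, 'k::zero) mpol \<times> ('n, 'k) mpol \<times> ('n, 'k) mpol) set \<Rightarrow> nat" where
  "indeg M = (LEAST e. \<exists>a\<in>M. a \<noteq> 0 \<and> homog3 (int e) a)"

definition minimal_generator ::
    "(('n::finite, 'k::field) mpol \<times> ('n, 'k) mpol \<times> ('n, 'k) mpol) set \<Rightarrow>
     ('n, 'k) mpol \<times> ('n, 'k) mpol \<times> ('n, 'k) mpol \<Rightarrow> bool" where
  "minimal_generator M v \<longleftrightarrow>
     (\<exists>G. v \<in> G \<and> (\<forall>g\<in>G. \<exists>m. homog3 m g) \<and> minimally_generates scale3 G M)"

text \<open>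
  \<open>M/Rv\<close> is isomorphic to the ideal \<open>I\<close> up to a shift \<open>s\<close> of the grading. The isomorphism is
  given by the induced map on \<open>M\<close>, which is linear with image \<open>I\<close> and kernel \<open>Rv\<close>.
\<close>

definition quot_iso_shift ::
    "(('n::finite, 'k::field) mpol \<times> ('n, 'k) mpol \<times> ('n, 'k) mpol) set \<Rightarrow>
     ('n, 'k) mpol \<times> ('n, 'k) mpol \<times> ('n, 'k) mpol \<Rightarrow> ('n, 'k) mpol set \<Rightarrow> bool" where
  "quot_iso_shift M v I \<longleftrightarrow> (\<exists>h s.
     (\<forall>a\<in>M. \<forall>b\<in>M. h (a + b) = h a + h b) \<and>
     (\<forall>r. \<forall>a\<in>M. h (scale3 r a) = r * h a) \<and>
     (\<forall>m. \<forall>a\<in>M. homog3 m a \<longrightarrow> homog (m + s) (h a)) \<and>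
     h ` M = I \<and>
     {a \<in> M. h a = 0} = Modules.module.span scale3 {v})"

definition bourbaki_ideal ::
    "('n::finite, 'k::field) mpol \<Rightarrow> ('n, 'k) mpol \<Rightarrow> ('n, 'k) mpol \<Rightarrow>
     ('n, 'k) mpol \<times> ('n, 'k) mpol \<times> ('n, 'k) mpol \<Rightarrow> ('n, 'k) mpol set \<Rightarrow> bool" where
  "bourbaki_ideal f1 f2 f3 v I \<longleftrightarrow>
     homog_ideal I \<and> unmixed I \<and> height I = 2 \<and> quot_iso_shift (Syz f1 f2 f3) v I"

text \<open>
  The degree does not depend on the choice of the minimal generator \<open>v\<close> of initial degree nor
  on that of the ideal; the description by \<open>THE\<close> rests on this fact and on the existence of
  such an ideal.
\<close>

definition Bour ::
    "('n::finite, 'k::field) mpol \<Rightarrow> ('n, 'k) mpol \<Rightarrow> ('n, 'k) mpol \<Rightarrow> rat" where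
  "Bour f1 f2 f3 =
     (let J = ideal_gen {f1, f2, f3}; M = Syz f1 f2 f3 in
      if perfect_ideal J \<and> height J = 2 then 0
      else (THE b. \<exists>v I. minimal_generator M v \<and> homog3 (int (indeg M)) v \<and>
              bourbaki_ideal f1 f2 f3 v I \<and> b = mult_quot I))"

end

(*
  Let nu = (a1, a2, a3) be a syzygy of the forms f = (f1, f2, f3) of minimal degree e. By
  minimality its entries have no common factor, and the a_i are coprime as are the f_i, so w in
  Syz(J) is mapped by the cross product to nu x w = h(w) f. This identifies Syz(J)/R nu with the
  ideal I = {g. g f in nu x R^3}. The vector identity nu x (f x u) = (nu . u) f - (nu . f) u shows
  that I contains a1, a2, a3, hence a regular sequence of two forms of degree e, and therefore
  deg(R/I) <= e^2. Counting dimensions along R(-e) -> Syz(J) -> I and Syz(J) -> R^3 -> J relates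
  the Hilbert polynomials of R/I and R/J and gives deg(R/J) = d^2 - d e + e^2 - deg(R/I).

  An associated prime P = (I : g) has height at most 2: otherwise pick a maximal set S of variables
  independent modulo P; three further variables yield three elements of P that form a regular
  sequence up to a multiplier in k[S], and a Koszul argument puts a multiple of g by a nonzero
  element of k[S] in I. Heights are computed from the growth of Hilbert functions.
*)

theory Submission
  imports Defs
begin

text \<open>\<open>height\<close> is defined by chains of arbitrary primes, so dimension cannot be
  read off graded pieces alone; it is measured by the filtration by total degree
  (\<open>aHF\<close>). With a degree-compatible monomial order, graded and filtered dimensions both
  become counts of monomials, eventually polynomial by Dickson's lemma.

  With n variables let c be (n - 3)! times the coefficient of degree n - 3 of the Hilbert polynomial
  of R/I. Both bounds on deg(R/J) are 0 \<le> c \<le> e^2 read through the degree formula.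
  Minimality of e serves two ends: the entries of \<nu> become coprime, and \<nu> belongs to a
  minimal generating set.

  The ideal I may be the whole ring. Then a second syzygy completes \<nu> to a basis of Syz(J), J is
  perfect and \<open>Bour\<close> is 0 by definition. Otherwise \<open>Bour\<close> is a definite
  description and must not depend on choices: a height-two ideal isomorphic to Syz(J)/R\<nu> is I
  times a fraction, which coprimality and height reduce to a unit; and c is fixed by d, e and
  deg(R/J), whatever \<nu> is.\<close>

hide_const (open) module.smult

section \<open>Growth of the number of monomials outside a monomial ideal\<close>

section \<open>Eventually polynomial functions\<close>

text \<open>Taylor expansion to second order: \<open>r\<close> collects the terms of order three and
  higher, so its degree is at most the degree of P minus 3; the condition on \<open>j\<close> says
  this without truncated subtraction. Order two suffices because degrees in codimension two only see
  second differences.\<close>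

lemma taylor_shift:
  fixes P :: "rat poly"
  shows "\<exists>r. pcompose P [:h, 1:] =
      P + smult h (pderiv P) + smult (h^2 / 2) (pderiv (pderiv P)) + r \<and>
    (\<forall>j. degree P < j + 3 \<longrightarrow> coeff r j = 0)"
proof (induction P)
  case 0
  show ?case by (rule exI[of _ 0]) simp
next
  case (pCons a Q)
  then obtain r where r: "pcompose Q [:h, 1:] =
      Q + smult h (pderiv Q) + smult (h^2 / 2) (pderiv (pderiv Q)) + r"
    and r0: "\<And>j. degree Q < j + 3 \<Longrightarrow> coeff r j = 0" by blast
  let ?r = "smult (h^3 / 2) (pderiv (pderiv Q)) + [:h, 1:] * r"
  have c: "[:h, 1:] * p = smult h p + pCons 0 p" for p :: "rat poly" by simp
  have "coeff ?r j = 0" if j: "degree (pCons a Q) < j + 3" for j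
  proof -
    have d: "degree Q < j + 2" using j by (auto split: if_splits)
    have "coeff Q (Suc (Suc j)) = 0" by (rule coeff_eq_0) (use d in simp)
    moreover have "coeff r j = 0" by (rule r0) (use d in simp)
    moreover have "coeff (pCons 0 r) j = 0"
      using r0[of "j - 1"] d by (cases j) (auto simp: coeff_pCons)
    ultimately show ?thesis by (simp add: c coeff_pderiv)
  qed
  moreover have "pcompose (pCons a Q) [:h, 1:] = pCons a Q + smult h (pderiv (pCons a Q)) +
      smult (h^2 / 2) (pderiv (pderiv (pCons a Q))) + ?r"
  proof -
    have "pcompose (pCons a Q) [:h, 1:] = [:a:] +
        (smult h (pcompose Q [:h, 1:]) + pCons 0 (pcompose Q [:h, 1:]))"
      by (simp add: pcompose_pCons)
    moreover have "q * 2 = smult 2 q" for q :: "rat poly" by (simp add: numeral_poly)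
    ultimately show ?thesis unfolding r
      by (intro poly_eqI)
         (auto simp: c pderiv_pCons pderiv_add coeff_pCons algebra_simps power2_eq_square
            power3_eq_cube add_divide_distrib split: nat.splits)
  qed
  ultimately show ?case by blast
qed

text \<open>Induction on a bound for the degree: the difference of x^(k+1)/(k+1) is x^k plus lower
  terms, so subtracting a multiple of it removes the top coefficient.\<close>

lemma poly_antidifference: "\<exists>Q::rat poly. \<forall>x. poly Q (x + 1) - poly Q x = poly P x"
proof -
  have "\<exists>Q::rat poly. pcompose Q [:1, 1:] - Q = P" if "\<forall>j\<ge>k. coeff P j = 0" for k P
    using that
  proof (induction k arbitrary: P)
    case 0
    then have "P = 0" by (intro poly_eqI) auto
    then show ?case by (intro exI[of _ 0]) simp
  next
    case (Suc k)
    let ?T = "monom (1 / of_nat (Suc k)) (Suc k) :: rat poly"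
    obtain r where r: "pcompose ?T [:1, 1:] = ?T + smult 1 (pderiv ?T) +
        smult (1^2/2) (pderiv (pderiv ?T)) + r"
      and r0: "\<And>j. degree ?T < j + 3 \<Longrightarrow> coeff r j = 0"
      using taylor_shift[of ?T 1] by blast
    have T: "degree ?T = Suc k" by (simp add: degree_monom_eq)
    define D where "D = pcompose ?T [:1, 1:] - ?T"
    have Dj: "coeff D j = (if j = k then 1 else 0)" if "j \<ge> k" for j
      using that T r0[of j] unfolding D_def r by (simp add: coeff_pderiv)
    let ?P = "P - smult (coeff P k) D"
    have "coeff ?P j = 0" if "j \<ge> k" for j
      using Dj[OF that] Suc.prems[rule_format, of j] that by (cases "j = k") auto
    then have "\<forall>j\<ge>k. coeff ?P j = 0" by blast
    from Suc.IH[OF this] obtain Q where Q: "pcompose Q [:1, 1:] - Q = ?P" by blast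
    have "pcompose (Q + smult (coeff P k) ?T) [:1, 1:] - (Q + smult (coeff P k) ?T) = P"
      using Q unfolding D_def by (simp add: pcompose_add pcompose_smult smult_diff_right algebra_simps)
    then show ?case by blast
  qed
  from this[of "Suc (degree P)" P] obtain Q where "pcompose Q [:1, 1:] - Q = P"
    by (auto simp: coeff_eq_0)
  moreover have "poly Q (x + 1) - poly Q x = poly (pcompose Q [:1, 1:] - Q) x" for x
    by (simp add: poly_pcompose add.commute)
  ultimately have "poly Q (x + 1) - poly Q x = poly P x" for x by simp
  then show ?thesis by blast
qed

definition ev_poly :: "(nat \<Rightarrow> nat) \<Rightarrow> bool" where
  "ev_poly g \<longleftrightarrow> (\<exists>P::rat poly. \<forall>\<^sub>F m in sequentially. of_nat (g m) = poly P (of_nat m))"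

lemma ev_poly_eventually_eq:
  assumes "ev_poly g" "\<forall>\<^sub>F m in sequentially. f m = g m" shows "ev_poly f"
proof -
  obtain P :: "rat poly" where "\<forall>\<^sub>F m in sequentially. of_nat (g m) = poly P (of_nat m)"
    using assms(1) ev_poly_def by auto
  with assms(2) have "\<forall>\<^sub>F m in sequentially. of_nat (f m) = poly P (of_nat m)"
    by eventually_elim simp
  then show ?thesis by (auto simp: ev_poly_def)
qed

lemma ev_poly_0: "ev_poly (\<lambda>_. 0)"
  unfolding ev_poly_def by (intro exI[of _ 0]) simp

lemma ev_poly_add: assumes "ev_poly f" "ev_poly g" shows "ev_poly (\<lambda>m. f m + g m)"
proof -
  obtain P Q :: "rat poly" where "\<forall>\<^sub>F m in sequentially. of_nat (f m) = poly P (of_nat m)"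
      "\<forall>\<^sub>F m in sequentially. of_nat (g m) = poly Q (of_nat m)"
    using assms ev_poly_def by auto
  then have "\<forall>\<^sub>F m in sequentially. of_nat (f m + g m) = poly (P + Q) (of_nat m)"
    by eventually_elim simp
  then show ?thesis unfolding ev_poly_def by blast
qed

lemma ev_poly_sum:
  "finite A \<Longrightarrow> (\<And>a. a \<in> A \<Longrightarrow> ev_poly (f a)) \<Longrightarrow> ev_poly (\<lambda>m. \<Sum>a\<in>A. f a m)"
  by (induction A rule: finite_induct) (auto intro: ev_poly_add ev_poly_0)

lemma ev_poly_shift: assumes "ev_poly g" shows "ev_poly (\<lambda>m. g (m - j))"
proof -
  obtain P :: "rat poly" where "\<forall>\<^sub>F m in sequentially. of_nat (g m) = poly P (of_nat m)"
    using assms ev_poly_def by auto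
  then obtain N where N: "\<And>m. m \<ge> N \<Longrightarrow> of_nat (g m) = poly P (of_nat m)"
    by (auto simp: eventually_sequentially)
  have "of_nat (g (m - j)) = poly (pcompose P [:- of_nat j, 1:]) (of_nat m)" if "m \<ge> N + j" for m
    using N[of "m - j"] that by (simp add: poly_pcompose of_nat_diff)
  then show ?thesis unfolding ev_poly_def eventually_sequentially by blast
qed

lemma ev_poly_partial_sums: assumes "ev_poly g" shows "ev_poly (\<lambda>m. \<Sum>i\<le>m. g i)"
proof -
  obtain P :: "rat poly" where "\<forall>\<^sub>F m in sequentially. of_nat (g m) = poly P (of_nat m)"
    using assms ev_poly_def by auto
  then obtain N where N: "\<And>m. m \<ge> N \<Longrightarrow> of_nat (g m) = poly P (of_nat m)"
    by (auto simp: eventually_sequentially)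
  \<comment> \<open>The partial sum up to m + 1 exceeds the one up to m by P(m + 1), hence the
    antidifference of the shifted polynomial; the constant is then adjusted at m = N.\<close>
  obtain Q where Q: "\<And>x. poly Q (x + 1) - poly Q x = poly (pcompose P [:1, 1:]) x"
    using poly_antidifference by blast
  let ?S = "\<lambda>m. of_nat (\<Sum>i\<le>m. g i) :: rat"
  let ?Q = "Q + [:?S N - poly Q (of_nat N):]"
  have "?S m = poly ?Q (of_nat m)" if "m \<ge> N" for m
    using that
  proof (induction m rule: dec_induct)
    case base then show ?case by simp
  next
    case (step m)
    then show ?case using N[of "Suc m"] Q[of "of_nat m"]
      by (simp add: poly_pcompose algebra_simps)
  qed
  then show ?thesis unfolding ev_poly_def eventually_sequentially by blast
qed

section \<open>Counting monomials\<close>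

abbreviation lookup where "lookup \<equiv> Poly_Mapping.lookup"
abbreviation keys where "keys \<equiv> Poly_Mapping.keys"
abbreviation single where "single \<equiv> Poly_Mapping.single"

lemma mon_deg_add: "mon_deg (s + t) = mon_deg s + mon_deg t"
  by (simp add: mon_deg_def lookup_add sum.distrib)

lemma mon_deg_0 [simp]: "mon_deg 0 = 0" by (simp add: mon_deg_def)

lemma mon_deg_single [simp]: "mon_deg (single i j) = j"
  by (simp add: mon_deg_def lookup_single when_def)

lemma mon_deg_eq_0_iff: "mon_deg t = 0 \<longleftrightarrow> t = 0"
proof
  assume "mon_deg t = 0"
  then have "\<forall>i. lookup t i = 0" by (simp add: mon_deg_def)
  then show "t = 0" by (intro poly_mapping_eqI) simp
qed simp

lemma lookup_le_mon_deg: "lookup t i \<le> mon_deg t"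
  unfolding mon_deg_def by (intro member_le_sum) auto

lemma finite_mon_deg_le: "finite {t :: 'n::finite \<Rightarrow>\<^sub>0 nat. mon_deg t \<le> m}"
proof (rule finite_imageD)
  show "inj_on lookup {t :: 'n \<Rightarrow>\<^sub>0 nat. mon_deg t \<le> m}"
    by (intro inj_onI poly_mapping_eqI) simp
  have "lookup ` {t :: 'n \<Rightarrow>\<^sub>0 nat. mon_deg t \<le> m} \<subseteq> {f. f ` UNIV \<subseteq> {..m}}"
    using lookup_le_mon_deg order_trans by fastforce
  moreover have "finite {f :: 'n \<Rightarrow> nat. f ` UNIV \<subseteq> {..m}}"
    using finite_set_of_finite_funs[of "UNIV :: 'n set" "{..m}" 0] by (simp add: image_subset_iff)
  ultimately show "finite (lookup ` {t :: 'n \<Rightarrow>\<^sub>0 nat. mon_deg t \<le> m})"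
    by (rule finite_subset)
qed

lemma finite_mon_deg_eq: "finite {t :: 'n::finite \<Rightarrow>\<^sub>0 nat. mon_deg t = m}"
  by (rule finite_subset[OF _ finite_mon_deg_le[of m]]) auto

text \<open>For an upward closed \<open>U\<close> this is the Hilbert function of the quotient of
  k[S] by the monomial ideal with exponent set \<open>U\<close>.\<close>

definition mon_count :: "('n::finite \<Rightarrow>\<^sub>0 nat) set \<Rightarrow> 'n set \<Rightarrow> nat \<Rightarrow> nat" where
  "mon_count U S m = card {t. keys t \<subseteq> S \<and> t \<notin> U \<and> mon_deg t = m}"

text \<open>Monomials are sorted by their exponent j of the new variable. Dividing by that power
  leaves a monomial in S of degree m - j, and U is replaced by its colon by the power.\<close>

lemma mon_count_insert:
  assumes x: "x \<notin> S"
  shows "mon_count U (insert x S) m = (\<Sum>j\<le>m. mon_count {t. t + single x j \<in> U} S (m - j))"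
proof -
  let ?A = "\<lambda>j. {t. keys t \<subseteq> S \<and> t + single x j \<notin> U \<and> mon_deg t = m - j}"
  let ?f = "\<lambda>j t. t + single x j"
  have x0: "lookup t x = 0" if "keys t \<subseteq> S" for t :: "'a \<Rightarrow>\<^sub>0 nat"
    using x that by (auto simp: in_keys_iff)
  have eq: "{t. keys t \<subseteq> insert x S \<and> t \<notin> U \<and> mon_deg t = m} = (\<Union>j\<le>m. ?f j ` ?A j)"
  proof (intro equalityI subsetI)
    fix t assume t: "t \<in> {t. keys t \<subseteq> insert x S \<and> t \<notin> U \<and> mon_deg t = m}"
    let ?t = "t - single x (lookup t x)"
    have e: "t = ?t + single x (lookup t x)"
      by (rule poly_mapping_eqI) (auto simp: lookup_add lookup_minus lookup_single when_def)
    have k: "keys ?t \<subseteq> S"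
    proof
      fix y assume "y \<in> keys ?t"
      then have "lookup ?t y \<noteq> 0" by (simp add: in_keys_iff)
      then have "y \<noteq> x" "lookup t y \<noteq> 0"
        by (auto simp: lookup_minus lookup_single when_def split: if_splits)
      then have "y \<in> keys t" "y \<noteq> x" by (auto simp: in_keys_iff)
      then show "y \<in> S" using t by blast
    qed
    have d: "mon_deg t = mon_deg ?t + lookup t x" by (subst e) (simp only: mon_deg_add mon_deg_single)
    have "mon_deg ?t = m - lookup t x" using t d by auto
    then have "?t \<in> ?A (lookup t x)" using t k e[symmetric] by simp
    then show "t \<in> (\<Union>j\<le>m. ?f j ` ?A j)"
      using e lookup_le_mon_deg[of t x] t by blast
  next
    fix t assume "t \<in> (\<Union>j\<le>m. ?f j ` ?A j)"
    then obtain j s where j: "j \<le> m" "s \<in> ?A j" "t = s + single x j" by auto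
    have "keys t \<subseteq> insert x S"
      using j keys_add[of s "single x j"] by (auto split: if_splits)
    then show "t \<in> {t. keys t \<subseteq> insert x S \<and> t \<notin> U \<and> mon_deg t = m}"
      using j by (auto simp: mon_deg_add)
  qed
  have "card (\<Union>j\<le>m. ?f j ` ?A j) = (\<Sum>j\<le>m. card (?f j ` ?A j))"
  proof (rule card_UN_disjoint)
    show "\<forall>i\<in>{..m}. finite (?f i ` ?A i)"
      by (auto intro!: finite_imageI finite_subset[OF _ finite_mon_deg_eq])
    have l: "lookup t x = j" if "t \<in> ?f j ` ?A j" for t j
      using that x0 by (auto simp: lookup_add)
    show "\<forall>i\<in>{..m}. \<forall>j\<in>{..m}. i \<noteq> j \<longrightarrow> ?f i ` ?A i \<inter> ?f j ` ?A j = {}"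
    proof (intro ballI impI equals0I)
      fix i j t assume "i \<noteq> j" "t \<in> ?f i ` ?A i \<inter> ?f j ` ?A j"
      then show False using l[of t i] l[of t j] by simp
    qed
  qed auto
  also have "\<dots> = (\<Sum>j\<le>m. card (?A j))"
    by (intro sum.cong refl card_image) (auto simp: inj_on_def)
  finally show ?thesis unfolding mon_count_def eq by simp
qed

lemma sum_choose_pred: "(\<Sum>i\<le>m. (i + s - 1) choose i) = (m + s) choose m"
proof (cases s)
  case 0
  \<comment> \<open>Truncated subtraction turns the term i = 0 into \<open>0 choose 0\<close>, which
    is 1; all other terms vanish.\<close>
  have "(\<Sum>i\<le>m. (i - 1) choose i) = (\<Sum>i\<le>m. if i = 0 then 1 else 0)"
    by (intro sum.cong) (auto simp: binomial_eq_0)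
  then show ?thesis using 0 by simp
next
  case (Suc r)
  then show ?thesis using sum_choose_lower[of r m] by (simp add: add.commute)
qed

lemma mon_count_all: "finite S \<Longrightarrow> mon_count {} S m = (m + card S - 1) choose m"
proof (induction S arbitrary: m rule: finite_induct)
  case empty
  have "{t :: 'a \<Rightarrow>\<^sub>0 nat. keys t \<subseteq> {} \<and> t \<notin> {} \<and> mon_deg t = m} = (if m = 0 then {0} else {})"
    by auto
  then show ?case by (simp add: mon_count_def)
next
  case (insert x S)
  have "mon_count {} (insert x S) m = (\<Sum>j\<le>m. ((m - j) + card S - 1) choose (m - j))"
    using mon_count_insert[OF insert(2), of "{}" m] insert.IH by simp
  also have "\<dots> = (\<Sum>i\<le>m. (i + card S - 1) choose i)"
    by (rule sum.reindex_bij_witness[of _ "\<lambda>i. m - i" "\<lambda>i. m - i"]) auto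
  also have "\<dots> = (m + card S) choose m" by (rule sum_choose_pred)
  finally show ?case using insert by simp
qed

definition upclosed :: "('n \<Rightarrow>\<^sub>0 nat) set \<Rightarrow> bool" where
  "upclosed U \<longleftrightarrow> (\<forall>t\<in>U. \<forall>s. t + s \<in> U)"

text \<open>Indices whose value is minimal among all later values occur arbitrarily late;
  enumerating them gives a nondecreasing subsequence.\<close>

lemma nat_seq_mono_subseq: "\<exists>r :: nat \<Rightarrow> nat. strict_mono r \<and> mono (\<lambda>k. (s :: nat \<Rightarrow> nat) (r k))"
proof -
  let ?P = "\<lambda>m. \<forall>j\<ge>m. s m \<le> s j"
  have ex: "\<exists>m\<ge>n. ?P m" for n
  proof -
    obtain m where m: "m \<ge> n" "\<And>j. j \<ge> n \<Longrightarrow> s m \<le> s j"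
      using ex_has_least_nat[of "\<lambda>j. j \<ge> n" n s] by auto
    then show ?thesis by (auto intro!: exI[of _ m])
  qed
  have inf: "infinite {m. ?P m}"
    unfolding infinite_nat_iff_unbounded_le using ex by auto
  let ?r = "enumerate {m. ?P m}"
  have sm: "strict_mono ?r" using inf by (rule strict_mono_enumerate)
  have "mono (\<lambda>k. s (?r k))"
  proof (rule monoI)
    fix i j :: nat assume "i \<le> j"
    then have "?r i \<le> ?r j" using sm by (simp add: strict_mono_less_eq)
    moreover have "?P (?r i)" using enumerate_in_set[OF inf, of i] by simp
    ultimately show "s (?r i) \<le> s (?r j)" by blast
  qed
  with sm show ?thesis by (intro exI[of _ ?r] conjI)
qed

text \<open>Refining to a nondecreasing subsequence for one variable after another makes all
  exponents nondecreasing at once; the first term of the result then divides the second.\<close>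

lemma dickson:
  fixes t :: "nat \<Rightarrow> ('n::finite \<Rightarrow>\<^sub>0 nat)"
  shows "\<exists>i j s. i < j \<and> t j = t i + s"
proof -
  have "\<exists>r :: nat \<Rightarrow> nat. strict_mono r \<and> (\<forall>x\<in>A. mono (\<lambda>k. lookup (t (r k)) x))" if "finite A" for A
    using that
  proof (induction A rule: finite_induct)
    case empty
    have "strict_mono (id :: nat \<Rightarrow> nat)" by (simp add: strict_mono_def)
    then show ?case by auto
  next
    case (insert x A)
    then obtain r :: "nat \<Rightarrow> nat" where r: "strict_mono r" "\<forall>x\<in>A. mono (\<lambda>k. lookup (t (r k)) x)" by blast
    obtain q :: "nat \<Rightarrow> nat" where q: "strict_mono q" "mono (\<lambda>k. lookup (t (r (q k))) x)"
      using nat_seq_mono_subseq[of "\<lambda>k. lookup (t (r k)) x"] by blast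
    have "strict_mono (r \<circ> q)" using r q by (auto simp: strict_mono_def)
    moreover have "mono (\<lambda>k. lookup (t (r (q k))) y)" if "y \<in> A" for y
      using r(2) q(1) that by (auto simp: mono_def strict_mono_less_eq)
    ultimately show ?case using q(2) by (intro exI[of _ "r \<circ> q"]) (auto simp: comp_def)
  qed
  from this[of UNIV] obtain r :: "nat \<Rightarrow> nat" where r: "strict_mono r" "\<And>x. mono (\<lambda>k. lookup (t (r k)) x)"
    by auto
  have "t (r 1) = t (r 0) + (t (r 1) - t (r 0))"
    using r(2) by (intro poly_mapping_eqI) (auto simp: lookup_add lookup_minus mono_def)
  moreover have "r 0 < r 1" using r(1) by (simp add: strict_mono_def)
  ultimately show ?thesis by blast
qed

text \<open>In a chain that never stabilises every stage is left through a new monomial. By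
  Dickson's lemma one such monomial is a multiple of an earlier one and so was present
  already.\<close>

lemma upclosed_stable:
  fixes U :: "nat \<Rightarrow> ('n::finite \<Rightarrow>\<^sub>0 nat) set"
  assumes up: "\<And>j. upclosed (U j)" and inc: "\<And>i j. i \<le> j \<Longrightarrow> U i \<subseteq> U j"
  shows "\<exists>j0. \<forall>j\<ge>j0. U j = U j0"
proof (rule ccontr)
  assume "\<not> ?thesis"
  then have "\<forall>k. \<exists>j. j \<ge> k \<and> U j \<noteq> U k" by auto
  then obtain n where n: "\<And>k. n k \<ge> k" "\<And>k. U (n k) \<noteq> U k" by metis
  then have "\<forall>k. \<exists>t. t \<in> U (n k) - U k" using inc by blast
  then obtain t where t: "\<And>k. t k \<in> U (n k) - U k" by metis
  \<comment> \<open>The stages visited: stage k is followed by stage n k, where a monomial outside U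
    k has appeared.\<close>
  define p where "p = (\<lambda>k. (n ^^ k) 0)"
  have psuc: "p (Suc k) = n (p k)" for k by (simp add: p_def)
  have pmono: "p i \<le> p j" if "i \<le> j" for i j
    using that
  proof (induction j rule: dec_induct)
    case (step j)
    then show ?case using n(1)[of "p j"] by (simp add: psuc)
  qed simp
  obtain i j s where ij: "i < j" "t (p j) = t (p i) + s"
    using dickson[of "\<lambda>k. t (p k)"] by blast
  have "t (p i) \<in> U (p (Suc i))" using t[of "p i"] by (simp add: psuc)
  then have "t (p i) \<in> U (p j)" using inc[OF pmono[of "Suc i" j]] ij(1) by auto
  then have "t (p j) \<in> U (p j)" using up[of "p j"] ij(2) by (auto simp: upclosed_def)
  then show False using t[of "p j"] by simp
qed

text \<open>Induction on the variables. The slices by the exponent of the new variable form an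
  ascending chain, so they are constant from some j0 on: finitely many slices contribute shifts, the
  constant tail contributes a partial sum.\<close>

lemma ev_poly_mon_count: "finite S \<Longrightarrow> upclosed U \<Longrightarrow> ev_poly (mon_count U S)"
proof (induction S arbitrary: U rule: finite_induct)
  case empty
  have "mon_count U {} m = 0" if "m \<ge> 1" for m
  proof -
    have "{t :: 'a \<Rightarrow>\<^sub>0 nat. keys t \<subseteq> {} \<and> t \<notin> U \<and> mon_deg t = m} = {}" using that by auto
    then show ?thesis unfolding mon_count_def by (metis card.empty)
  qed
  then show ?case
    by (intro ev_poly_eventually_eq[OF ev_poly_0]) (auto simp: eventually_sequentially)
next
  case (insert x S)
  let ?U = "\<lambda>j. {t. t + single x j \<in> U}"
  have up: "upclosed (?U j)" for j
    using insert.prems by (auto simp: upclosed_def algebra_simps)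
  have inc: "?U i \<subseteq> ?U j" if "i \<le> j" for i j
  proof
    fix t assume "t \<in> ?U i"
    then have "(t + single x i) + single x (j - i) \<in> U" using insert.prems by (auto simp: upclosed_def)
    moreover have "(t + single x i) + single x (j - i) = t + single x j"
      using that by (simp add: add.assoc flip: single_add)
    ultimately show "t \<in> ?U j" by simp
  qed
  obtain j0 where j0: "\<And>j. j \<ge> j0 \<Longrightarrow> ?U j = ?U j0"
    using upclosed_stable[of ?U, OF up inc] by blast
  let ?g = "\<lambda>m. (\<Sum>j<j0. mon_count (?U j) S (m - j)) + (\<Sum>i\<le>m - j0. mon_count (?U j0) S i)"
  have "ev_poly (\<lambda>m. mon_count (?U j) S (m - j))" for j
    by (rule ev_poly_shift) (rule insert.IH[OF up])
  then have "ev_poly (\<lambda>m. \<Sum>j<j0. mon_count (?U j) S (m - j))"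
    by (rule ev_poly_sum[rotated]) simp
  moreover have "ev_poly (\<lambda>m. \<Sum>i\<le>m - j0. mon_count (?U j0) S i)"
    by (rule ev_poly_shift[of "\<lambda>m. \<Sum>i\<le>m. mon_count (?U j0) S i"],
        rule ev_poly_partial_sums, rule insert.IH[OF up])
  ultimately have "ev_poly ?g" by (rule ev_poly_add)
  have "mon_count U (insert x S) m = ?g m" if m: "m \<ge> j0" for m
  proof -
    have "{..m} = {..<j0} \<union> {j0..m}" using m by auto
    then have "mon_count U (insert x S) m =
        (\<Sum>j<j0. mon_count (?U j) S (m - j)) + (\<Sum>j=j0..m. mon_count (?U j) S (m - j))"
      by (simp add: mon_count_insert[OF insert(2)]) (subst sum.union_disjoint, auto)
    also have "(\<Sum>j=j0..m. mon_count (?U j) S (m - j)) = (\<Sum>j=j0..m. mon_count (?U j0) S (m - j))"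
    proof (intro sum.cong refl)
      fix j assume "j \<in> {j0..m}"
      then have "?U j = ?U j0" by (intro j0) simp
      then show "mon_count (?U j) S (m - j) = mon_count (?U j0) S (m - j)" by (simp only:)
    qed
    also have "\<dots> = (\<Sum>i\<le>m - j0. mon_count (?U j0) S i)"
      using m by (intro sum.reindex_bij_witness[of _ "\<lambda>i. m - i" "\<lambda>i. m - i"]) auto
    finally show ?thesis .
  qed
  then have "\<forall>\<^sub>F m in sequentially. mon_count U (insert x S) m = ?g m"
    unfolding eventually_sequentially by blast
  with \<open>ev_poly ?g\<close> show ?case by (rule ev_poly_eventually_eq)
qed

section \<open>Linear algebra of polynomials: graded pieces and leading monomials\<close>

section \<open>Dimensions of vector spaces\<close>

lemma (in vector_space) finite_independent_in_span:
  "independent B \<Longrightarrow> B \<subseteq> span F \<Longrightarrow> finite F \<Longrightarrow> finite B"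
  using independent_span_bound by blast

lemma (in vector_space) dim_mono_finite:
  assumes "V \<subseteq> W" "W \<subseteq> span F" "finite F"
  shows "dim V \<le> dim W"
proof -
  obtain B where B: "B \<subseteq> V" "independent B" "V \<subseteq> span B" "card B = dim V"
    using basis_exists[of V] by blast
  obtain C where C: "B \<subseteq> C" "C \<subseteq> W" "independent C" "W \<subseteq> span C"
    using maximal_independent_subset_extend[of B W] B assms(1) by blast
  have "finite C" using finite_independent_in_span C assms by (meson order_trans)
  then have "card B \<le> card C" using C(1) card_mono by blast
  then show ?thesis using B(4) basis_card_eq_dim[OF C(2,4,3)] by simp
qed

text \<open>The ambient spaces will be infinite-dimensional, so finiteness is asked only of V. A
  basis B of the kernel is extended to a basis of V; the added vectors have independent images
  because a kernel vector in their span has two representations with disjoint supports.\<close>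

lemma (in vector_space_pair) rank_nullity:
  assumes lf: "Vector_Spaces.linear s1 s2 f" and V: "vs1.subspace V" and F: "V \<subseteq> vs1.span F" "finite F"
  shows "vs1.dim V = vs1.dim {x \<in> V. f x = 0} + vs2.dim (f ` V)"
proof -
  let ?K = "{x \<in> V. f x = 0}"
  obtain B where B: "B \<subseteq> ?K" "vs1.independent B" "?K \<subseteq> vs1.span B" "card B = vs1.dim ?K"
    using vs1.basis_exists[of ?K] by blast
  obtain C where C: "B \<subseteq> C" "C \<subseteq> V" "vs1.independent C" "V \<subseteq> vs1.span C"
    using vs1.maximal_independent_subset_extend[of B V] B by blast
  have finC: "finite C" using vs1.finite_independent_in_span C F by (meson order_trans)
  let ?D = "C - B"
  have indD: "vs1.independent ?D" using C(3) vs1.independent_mono by blast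
  have inj: "inj_on f (vs1.span ?D)"
  proof -
    have "x = 0" if x: "x \<in> vs1.span ?D" "f x = 0" for x
    proof -
      have "vs1.span ?D \<subseteq> V" using C(2) V by (intro vs1.span_minimal) auto
      then have xB: "x \<in> vs1.span B" using x B(3) by blast
      have "vs1.representation C x = vs1.representation B x"
        using vs1.representation_extend[OF C(3) xB C(1)] .
      moreover have "vs1.representation C x = vs1.representation ?D x"
        using vs1.representation_extend[OF C(3) x(1)] by blast
      ultimately have "vs1.representation C x b = 0" for b
        by (metis DiffE vs1.representation_ne_zero)
      moreover have "x \<in> vs1.span C" using xB C(1) vs1.span_mono by blast
      ultimately show "x = 0"
        using vs1.sum_nonzero_representation_eq[OF C(3), of x] by simp
    qed
    then show ?thesis
      using linear_inj_on_iff_eq_0[OF lf, of "vs1.span ?D"] by simp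
  qed
  have ind: "vs2.independent (f ` ?D)"
    using linear_independent_injective_image[OF lf indD inj] .
  have "f ` V \<subseteq> vs2.span (f ` ?D)"
  proof -
    have "f ` V \<subseteq> vs2.span (f ` C)" using linear_spans_image[OF lf C(4)] .
    also have "\<dots> \<subseteq> vs2.span (f ` ?D)"
    proof (rule vs2.span_minimal)
      show "f ` C \<subseteq> vs2.span (f ` ?D)"
      proof
        fix y assume "y \<in> f ` C"
        then obtain c where c: "c \<in> C" "y = f c" by blast
        show "y \<in> vs2.span (f ` ?D)"
        proof (cases "c \<in> B")
          case True
          then have "f c = 0" using B(1) by blast
          then show ?thesis using c by (simp add: vs2.span_zero)
        qed (use c in \<open>auto intro: vs2.span_base\<close>)
      qed
    qed simp
    finally show ?thesis .
  qed
  moreover have "f ` ?D \<subseteq> f ` V" using C(2) by blast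
  ultimately have "card (f ` ?D) = vs2.dim (f ` V)"
    using ind vs2.basis_card_eq_dim by blast
  moreover have "card (f ` ?D) = card ?D"
    by (rule card_image) (rule inj_on_subset[OF inj vs1.span_superset])
  moreover have "card C = vs1.dim V" using C by (intro vs1.basis_card_eq_dim)
  moreover have "card C = card B + card ?D"
    using finC C(1) by (metis card_Diff_subset card_mono finite_subset le_add_diff_inverse)
  ultimately show ?thesis using B(4) by simp
qed

section \<open>Polynomials as sums of monomials\<close>

type_synonym ('n, 'k) poly3 = "('n, 'k) mpol \<times> ('n, 'k) mpol \<times> ('n, 'k) mpol"

interpretation cs: Vector_Spaces.vector_space "cscale :: 'k::field \<Rightarrow> ('n, 'k) mpol \<Rightarrow> _"
  by (rule vector_space_cscale)

interpretation ring_mod: Modules.module "(*) :: 'r::comm_ring_1 \<Rightarrow> _"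
  by (rule module_mult)

(* the associative law of the module in this orientation would loop with mult.assoc *)
declare ring_mod.scale_scale [simp del]

interpretation mod3: Modules.module "scale3 :: 'r::comm_ring_1 \<Rightarrow> _"
  by (rule module_scale3)

lemma lookup_cscale [simp]: "lookup (cscale c p) t = c * lookup p t"
  unfolding cscale_def mult_map_scale_conv_mult [symmetric]
  by (simp add: Poly_Mapping.map.rep_eq when_def)

lemma mpol_expand: "(\<Sum>t\<in>keys p. single t (lookup p t)) = p"
proof (rule poly_mapping_eqI)
  fix s
  have "(\<Sum>t\<in>keys p. lookup (single t (lookup p t)) s) =
      (\<Sum>t\<in>keys p. if t = s then lookup p t else 0)"
    by (intro sum.cong) (auto simp: lookup_single when_def)
  also have "\<dots> = lookup p s" by (simp add: in_keys_iff)
  finally show "lookup (\<Sum>t\<in>keys p. single t (lookup p t)) s = lookup p s"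
    by (simp add: lookup_sum)
qed

definition mpol_restrict :: "'a set \<Rightarrow> ('a \<Rightarrow>\<^sub>0 'b::comm_monoid_add) \<Rightarrow> ('a \<Rightarrow>\<^sub>0 'b)" where
  "mpol_restrict A p = (\<Sum>t\<in>keys p \<inter> A. single t (lookup p t))"

lemma lookup_restrict: "lookup (mpol_restrict A p) s = (if s \<in> A then lookup p s else 0)"
proof -
  have "(\<Sum>t\<in>keys p \<inter> A. lookup (single t (lookup p t)) s) =
      (\<Sum>t\<in>keys p \<inter> A. if t = s then lookup p t else 0)"
    by (intro sum.cong) (auto simp: lookup_single when_def)
  also have "\<dots> = (if s \<in> A then lookup p s else 0)" by (auto simp: in_keys_iff)
  finally show ?thesis by (simp add: lookup_sum mpol_restrict_def)
qed

lemma keys_restrict: "keys (mpol_restrict A p) = keys p \<inter> A"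
  by (auto simp: in_keys_iff lookup_restrict split: if_splits)

lemma restrict_split: "mpol_restrict A p + mpol_restrict (- A) p = p"
  by (rule poly_mapping_eqI) (simp add: lookup_add lookup_restrict)

lemma restrict_add: "mpol_restrict A (p + q) = mpol_restrict A p + mpol_restrict A q"
  by (rule poly_mapping_eqI) (simp add: lookup_add lookup_restrict)

lemma restrict_id: "keys p \<subseteq> A \<Longrightarrow> mpol_restrict A p = p"
  by (rule poly_mapping_eqI) (auto simp: lookup_restrict in_keys_iff)

lemma restrict_none: "keys p \<inter> A = {} \<Longrightarrow> mpol_restrict A p = 0"
  by (rule poly_mapping_eqI) (auto simp: lookup_restrict in_keys_iff)

section \<open>Homogeneous components\<close>

lemma homog_0 [simp]: "homog m 0" by (simp add: homog_def)

lemma homog_add: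
  fixes p q :: "('n::finite, 'k::comm_monoid_add) mpol"
  shows "homog m p \<Longrightarrow> homog m q \<Longrightarrow> homog m (p + q)"
  unfolding homog_def using keys_add[of p q] by blast

lemma homog_uminus:
  fixes p :: "('n::finite, 'k::ab_group_add) mpol"
  shows "homog m p \<Longrightarrow> homog m (- p)"
  by (simp add: homog_def in_keys_iff)

lemma homog_mult:
  fixes p q :: "('n::finite, 'k::semiring_0) mpol"
  assumes "homog a p" "homog b q" shows "homog (a + b) (p * q)"
  unfolding homog_def
proof
  fix t assume "t \<in> keys (p * q)"
  then obtain u v where "t = u + v" "u \<in> keys p" "v \<in> keys q" using keys_mult[of p q] by blast
  then show "int (mon_deg t) = a + b" using assms by (simp add: homog_def mon_deg_add)
qed

lemma homog_cscale: "homog m p \<Longrightarrow> homog m (cscale c p)"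
  by (auto simp: homog_def in_keys_iff)

lemma homog_neg: "homog m p \<Longrightarrow> m < 0 \<Longrightarrow> p = 0"
  by (metis homog_def keys_eq_empty of_nat_0_le_iff equals0I not_less)

definition hcomp :: "int \<Rightarrow> ('n::finite, 'k::comm_monoid_add) mpol \<Rightarrow> ('n, 'k) mpol" where
  "hcomp m p = mpol_restrict {t. int (mon_deg t) = m} p"

lemma homog_hcomp: "homog m (hcomp m p)"
  by (simp add: homog_def hcomp_def keys_restrict)

lemma hcomp_add: "hcomp m (p + q) = hcomp m p + hcomp m q"
  by (simp add: hcomp_def restrict_add)

lemma hcomp_0 [simp]: "hcomp m 0 = 0" by (simp add: hcomp_def mpol_restrict_def)

lemma hcomp_uminus:
  fixes p :: "('n::finite, 'k::ab_group_add) mpol"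
  shows "hcomp m (- p) = - hcomp m p"
  using hcomp_add[of m p "- p"] by (simp add: eq_neg_iff_add_eq_0 add.commute)

lemma hcomp_diff:
  fixes p q :: "('n::finite, 'k::ab_group_add) mpol"
  shows "hcomp m (p - q) = hcomp m p - hcomp m q"
  using hcomp_add[of m p "- q"] by (simp add: hcomp_uminus)

lemma hcomp_homog: "homog l p \<Longrightarrow> hcomp m p = (if l = m then p else 0)"
  unfolding hcomp_def by (auto simp: homog_def intro!: restrict_id restrict_none)

text \<open>Only the part of p of degree m - d can reach degree m after multiplication by f. Integer
  degrees keep this true for m < d, where both sides are 0.\<close>

lemma hcomp_mult:
  fixes p f :: "('n::finite, 'k::semiring_0) mpol"
  assumes f: "homog d f" shows "hcomp m (p * f) = hcomp (m - d) p * f"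
proof -
  let ?A = "{t. int (mon_deg t) = m - d}"
  let ?q = "mpol_restrict (- ?A) p"
  have "p = hcomp (m - d) p + ?q" using restrict_split[of ?A p] by (simp add: hcomp_def)
  then have "hcomp m (p * f) = hcomp m (hcomp (m - d) p * f) + hcomp m (?q * f)"
    by (metis hcomp_add distrib_right)
  moreover have "homog m (hcomp (m - d) p * f)"
    using homog_mult[OF homog_hcomp[of "m - d" p] f] by simp
  moreover have "hcomp m (?q * f) = 0" unfolding hcomp_def
  proof (rule restrict_none, rule equals0I)
    fix t assume t: "t \<in> keys (?q * f) \<inter> {t. int (mon_deg t) = m}"
    then obtain u v where uv: "t = u + v" "u \<in> keys ?q" "v \<in> keys f"
      using keys_mult[of ?q f] by blast
    then have "int (mon_deg u) \<noteq> m - d" by (auto simp: keys_restrict)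
    moreover have "int (mon_deg v) = d" using uv f by (auto simp: homog_def)
    ultimately show False using t uv by (simp add: mon_deg_add)
  qed
  ultimately show ?thesis by (simp add: hcomp_homog)
qed

lemma hcomp_mult_left:
  fixes p f :: "('n::finite, 'k::comm_semiring_0) mpol"
  shows "homog d f \<Longrightarrow> hcomp m (f * p) = f * hcomp (m - d) p"
  using hcomp_mult[of d f m p] by (simp add: mult.commute)

lemma sum_hcomp:
  assumes "\<And>t. t \<in> keys p \<Longrightarrow> mon_deg t \<le> D"
  shows "(\<Sum>i\<le>D. hcomp (int i) p) = p"
proof (rule poly_mapping_eqI)
  fix s
  have "lookup (\<Sum>i\<le>D. hcomp (int i) p) s = (\<Sum>i\<le>D. if mon_deg s = i then lookup p s else 0)"
    unfolding lookup_sum hcomp_def by (intro sum.cong) (auto simp: lookup_restrict)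
  also have "\<dots> = lookup p s" using assms[of s] by (auto simp: in_keys_iff)
  finally show "lookup (\<Sum>i\<le>D. hcomp (int i) p) s = lookup p s" .
qed

lemma ex_degree_bound:
  fixes A :: "('n::finite, 'k::zero) mpol set"
  assumes "finite A"
  shows "\<exists>D. \<forall>p\<in>A. \<forall>t\<in>keys p. mon_deg t \<le> D"
proof -
  have "finite (\<Union>p\<in>A. mon_deg ` keys p)" using assms by simp
  then obtain D where "\<forall>d\<in>(\<Union>p\<in>A. mon_deg ` keys p). d \<le> D"
    using finite_nat_set_iff_bounded_le by blast
  then show ?thesis by blast
qed

lemma hcomp_eqI:
  fixes p :: "('n::finite, 'k::comm_monoid_add) mpol"
  assumes "\<And>m. hcomp m p = hcomp m q" shows "p = q"
proof (rule poly_mapping_eqI)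
  fix t show "lookup p t = lookup q t"
    using arg_cong[OF assms[of "int (mon_deg t)"], of "\<lambda>p. lookup p t"]
    by (simp add: hcomp_def lookup_restrict)
qed

section \<open>Leading monomials\<close>

text \<open>Comparing total degrees first makes leading monomials compatible both with the grading
  and with the filtration by degree; ties are broken by the linear order on exponent vectors, which
  respects addition.\<close>

definition mless :: "('n::{finite, linorder} \<Rightarrow>\<^sub>0 nat) \<Rightarrow> ('n \<Rightarrow>\<^sub>0 nat) \<Rightarrow> bool" where
  "mless s t \<longleftrightarrow> mon_deg s < mon_deg t \<or> (mon_deg s = mon_deg t \<and> s < t)"

lemma mless_irrefl: "\<not> mless t t" by (simp add: mless_def)
lemma mless_trans: "mless s t \<Longrightarrow> mless t u \<Longrightarrow> mless s u" by (auto simp: mless_def)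
lemma mless_add: "mless s t \<Longrightarrow> mless (s + u) (t + u)"
  by (auto simp: mless_def mon_deg_add intro: add_strict_right_mono)

lemma mless_add_mono: "mless s t \<Longrightarrow> mless u v \<Longrightarrow> mless (s + u) (t + v)"
  using mless_add[of s t u] mless_add[of u v t] mless_trans by (metis add.commute)

definition lm :: "('n::{finite, linorder}, 'k::zero) mpol \<Rightarrow> ('n \<Rightarrow>\<^sub>0 nat)" where
  "lm p = Max {t \<in> keys p. mon_deg t = Max (mon_deg ` keys p)}"

lemma
  assumes "p \<noteq> 0"
  shows lm_in_keys: "lm p \<in> keys p" and lm_max: "t \<in> keys p \<Longrightarrow> t = lm p \<or> mless t (lm p)"
proof -
  let ?A = "{t \<in> keys p. mon_deg t = Max (mon_deg ` keys p)}"
  have "keys p \<noteq> {}" using assms by simp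
  then have "Max (mon_deg ` keys p) \<in> mon_deg ` keys p" by (intro Max_in) auto
  then have "?A \<noteq> {}" by auto
  then have A: "lm p \<in> ?A" unfolding lm_def by (intro Max_in) auto
  then show "lm p \<in> keys p" by simp
  assume t: "t \<in> keys p"
  then have le: "mon_deg t \<le> mon_deg (lm p)" using A by (auto intro!: Max_ge)
  show "t = lm p \<or> mless t (lm p)"
  proof (cases "mon_deg t = mon_deg (lm p)")
    case True
    then have "t \<in> ?A" using A t by auto
    then have "t \<le> lm p" unfolding lm_def by (intro Max_ge) auto
    then show ?thesis using True by (auto simp: mless_def)
  qed (use le in \<open>auto simp: mless_def\<close>)
qed

lemma lm_eqI:
  assumes "t \<in> keys p" "\<And>s. s \<in> keys p \<Longrightarrow> s = t \<or> mless s t"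
  shows "lm p = t"
proof -
  have "p \<noteq> 0" using assms by auto
  then show ?thesis using lm_in_keys[of p] lm_max[of p t] assms mless_irrefl mless_trans by metis
qed

text \<open>After both leading terms are split off, all remaining products consist of strictly
  smaller monomials, since the order is compatible with addition.\<close>

lemma lm_mult_aux:
  fixes p q :: "('n::{finite, linorder}, 'k::idom) mpol"
  assumes "p \<noteq> 0" "q \<noteq> 0"
  shows "lookup (p * q) (lm p + lm q) = lookup p (lm p) * lookup q (lm q)"
    and "t \<in> keys (p * q) \<Longrightarrow> t = lm p + lm q \<or> mless t (lm p + lm q)"
proof -
  let ?u = "lm p" and ?v = "lm q"
  let ?p = "mpol_restrict (- {?u}) p" and ?q = "mpol_restrict (- {?v}) q"
  have p: "p = single ?u (lookup p ?u) + ?p" and q: "q = single ?v (lookup q ?v) + ?q"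
    by (rule poly_mapping_eqI, auto simp: lookup_add lookup_restrict lookup_single when_def)+
  have kp: "mless t ?u" if "t \<in> keys ?p" for t
    using that lm_max[OF assms(1), of t] by (auto simp: keys_restrict)
  have kq: "mless t ?v" if "t \<in> keys ?q" for t
    using that lm_max[OF assms(2), of t] by (auto simp: keys_restrict)
  have "p * q = (single ?u (lookup p ?u) + ?p) * q" using p by simp
  also have "\<dots> = single ?u (lookup p ?u) * q + ?p * q" by (rule distrib_right)
  also have "single ?u (lookup p ?u) * q = single ?u (lookup p ?u) * (single ?v (lookup q ?v) + ?q)"
    using q by simp
  also have "\<dots> = single (?u + ?v) (lookup p ?u * lookup q ?v) + single ?u (lookup p ?u) * ?q"
    by (simp only: distrib_left mult_single)
  finally have e: "p * q = single (?u + ?v) (lookup p ?u * lookup q ?v) +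
      (single ?u (lookup p ?u) * ?q + ?p * q)"
    by (simp only: add.assoc)
  have k1: "mless t (?u + ?v)" if "t \<in> keys (single ?u (lookup p ?u) * ?q)" for t
  proof -
    obtain b where "t = ?u + b" "b \<in> keys ?q"
      using \<open>t \<in> _\<close> keys_mult[of "single ?u (lookup p ?u)" ?q] by (auto split: if_splits)
    then show ?thesis using mless_add[OF kq, of b ?u] by (simp add: add.commute)
  qed
  have k2: "mless t (?u + ?v)" if "t \<in> keys (?p * q)" for t
  proof -
    obtain a b where ab: "t = a + b" "a \<in> keys ?p" "b \<in> keys q"
      using \<open>t \<in> _\<close> keys_mult[of ?p q] by auto
    then have "b = ?v \<or> mless b ?v" using lm_max[OF assms(2)] by blast
    then show ?thesis using ab kp mless_add mless_add_mono by blast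
  qed
  have k3: "mless t (?u + ?v)" if "t \<in> keys (single ?u (lookup p ?u) * ?q + ?p * q)" for t
    using that k1 k2 keys_add[of "single ?u (lookup p ?u) * ?q" "?p * q"] by blast
  have "lookup (single ?u (lookup p ?u) * ?q + ?p * q) (?u + ?v) = 0"
    using k3[of "?u + ?v"] mless_irrefl by (auto simp: in_keys_iff)
  then show "lookup (p * q) (?u + ?v) = lookup p ?u * lookup q ?v"
    by (subst e) (simp only: lookup_add lookup_single_eq add_0_right)
  show "t = ?u + ?v \<or> mless t (?u + ?v)" if "t \<in> keys (p * q)"
    using that k3[of t] keys_add[of "single (?u + ?v) (lookup p ?u * lookup q ?v)"
        "single ?u (lookup p ?u) * ?q + ?p * q"] unfolding e by (auto split: if_splits)
qed

lemma lm_mult: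
  fixes p q :: "('n::{finite, linorder}, 'k::idom) mpol"
  assumes "p \<noteq> 0" "q \<noteq> 0"
  shows "lm (p * q) = lm p + lm q"
proof (rule lm_eqI)
  show "lm p + lm q \<in> keys (p * q)"
    using lm_mult_aux(1)[OF assms] lm_in_keys[OF assms(1)] lm_in_keys[OF assms(2)]
    by (simp add: in_keys_iff)
qed (rule lm_mult_aux(2)[OF assms])

definition tdeg :: "('n::{finite, linorder}, 'k::zero) mpol \<Rightarrow> nat" where
  "tdeg p = mon_deg (lm p)"

lemma tdeg_mult:
  fixes p q :: "('n::{finite, linorder}, 'k::idom) mpol"
  shows "p \<noteq> 0 \<Longrightarrow> q \<noteq> 0 \<Longrightarrow> tdeg (p * q) = tdeg p + tdeg q"
  by (simp add: tdeg_def lm_mult mon_deg_add)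

lemma mon_deg_le_tdeg: "t \<in> keys p \<Longrightarrow> mon_deg t \<le> tdeg p"
  using lm_max[of p t] by (cases "p = 0") (auto simp: tdeg_def mless_def)

lemma tdeg_homog: "homog (int d) p \<Longrightarrow> p \<noteq> 0 \<Longrightarrow> tdeg p = d"
  using lm_in_keys[of p] by (auto simp: tdeg_def homog_def)

lemma tdeg_0_const:
  assumes "tdeg p = 0" shows "p = single 0 (lookup p 0)"
proof (rule poly_mapping_eqI)
  fix t
  show "lookup p t = lookup (single 0 (lookup p 0)) t"
  proof (cases "t = 0")
    case False
    then have "t \<notin> keys p" using mon_deg_le_tdeg[of t p] assms by (auto simp: mon_deg_eq_0_iff)
    then show ?thesis using False by (simp add: in_keys_iff lookup_single when_def)
  qed simp
qed

lemma single_0_dvd_1: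
  fixes c :: "'k::field"
  assumes "c \<noteq> 0" shows "(single 0 c :: ('n, 'k) mpol) dvd 1"
proof -
  have "single 0 c * single 0 (inverse c) = (1 :: ('n, 'k) mpol)"
    using assms by (simp add: mult_single)
  then show ?thesis by (metis dvd_triv_left)
qed

lemma tdeg_one [simp]: "tdeg (1 :: ('n::{finite, linorder}, 'k::zero_neq_one) mpol) = 0"
  using lm_in_keys[of "1 :: ('n, 'k) mpol"] by (simp add: tdeg_def)

lemma mpol_dvd_1_iff:
  fixes p :: "('n::{finite, linorder}, 'k::field) mpol"
  shows "p dvd 1 \<longleftrightarrow> p \<noteq> 0 \<and> tdeg p = 0"
proof
  assume "p dvd 1"
  then obtain q where q: "1 = p * q" by blast
  then have "p \<noteq> 0" "q \<noteq> 0" by auto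
  then show "p \<noteq> 0 \<and> tdeg p = 0" using tdeg_mult[of p q] q by (metis tdeg_one add_is_0)
next
  assume p: "p \<noteq> 0 \<and> tdeg p = 0"
  then have "lookup p 0 \<noteq> 0" using tdeg_0_const[of p] by (metis single_zero)
  then show "p dvd 1" using single_0_dvd_1 tdeg_0_const p by metis
qed

definition lms :: "('n::{finite, linorder}, 'k::zero) mpol set \<Rightarrow> ('n \<Rightarrow>\<^sub>0 nat) set" where
  "lms V = lm ` (V - {0})"

lemma lms_mono: "V \<subseteq> W \<Longrightarrow> lms V \<subseteq> lms W" by (auto simp: lms_def)

lemma lm_diff_less:
  fixes p b :: "('n::{finite, linorder}, 'k::field) mpol"
  assumes "p \<noteq> 0" "b \<noteq> 0" "lm b = lm p"
    and p': "p' = p - cscale (lookup p (lm p) / lookup b (lm p)) b" "p' \<noteq> 0"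
  shows "mless (lm p') (lm p)"
proof -
  have b: "lookup b (lm p) \<noteq> 0" using lm_in_keys[OF assms(2)] assms(3) by (simp add: in_keys_iff)
  have "lookup p' (lm p) = 0" using b by (simp add: p'(1) lookup_minus)
  then have ne: "lm p' \<noteq> lm p" using lm_in_keys[OF p'(2)] by (auto simp: in_keys_iff)
  have "lookup p' (lm p') \<noteq> 0" using lm_in_keys[OF p'(2)] by (simp add: in_keys_iff)
  then have "lm p' \<in> keys p \<or> lm p' \<in> keys b"
    by (auto simp: p'(1) lookup_minus in_keys_iff)
  then show ?thesis using lm_max[OF assms(1)] lm_max[OF assms(2)] assms(3) ne by metis
qed

text \<open>Gaussian elimination: one element of V is chosen for each leading monomial. Distinct
  leading monomials make these elements independent, and subtracting multiples of them lowers the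
  leading monomial of any element of V until nothing is left.\<close>

lemma dim_eq_card_lms:
  fixes V :: "('n::{finite, linorder}, 'k::field) mpol set"
  assumes V: "cs.subspace V" and F: "finite F" "\<And>p. p \<in> V \<Longrightarrow> keys p \<subseteq> F"
  shows "cs.dim V = card (lms V)"
proof -
  have "\<forall>t. \<exists>b. t \<in> lms V \<longrightarrow> b \<in> V \<and> b \<noteq> 0 \<and> lm b = t" by (auto simp: lms_def)
  then obtain b where b: "\<And>t. t \<in> lms V \<Longrightarrow> b t \<in> V \<and> b t \<noteq> 0 \<and> lm (b t) = t" by metis
  have L: "lms V \<subseteq> F" using F(2) lm_in_keys by (fastforce simp: lms_def)
  then have finL: "finite (lms V)" using F(1) finite_subset by blast
  have inj: "inj_on b (lms V)" using b by (metis inj_onI)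
  have ind: "cs.independent (b ` lms V)"
  proof (rule cs.independent_if_scalars_zero)
    fix f x assume s: "(\<Sum>x\<in>b ` lms V. cscale (f x) x) = 0" and x: "x \<in> b ` lms V"
    have s': "(\<Sum>t\<in>lms V. cscale (f (b t)) (b t)) = 0" using s inj by (simp add: sum.reindex)
    show "f x = 0"
    proof (rule ccontr)
      assume fx: "f x \<noteq> 0"
      let ?T = "{t \<in> lms V. f (b t) \<noteq> 0}"
      \<comment> \<open>An auxiliary polynomial with support \<open>?T\<close>, so that
        \<open>lm\<close> picks the largest leading monomial taking part in the relation.\<close>
      let ?q = "\<Sum>t\<in>?T. single t (1::'k)"
      have kq: "keys ?q = ?T"
      proof -
        have "lookup ?q s = (if s \<in> ?T then 1 else 0)" for s
        proof -
          have "lookup ?q s = (\<Sum>t\<in>?T. if t = s then 1 else 0)"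
            unfolding lookup_sum by (intro sum.cong) (auto simp: lookup_single when_def)
          also have "\<dots> = (if s \<in> ?T then 1 else 0)" using finL by simp
          finally show ?thesis .
        qed
        then show ?thesis by (auto simp: in_keys_iff split: if_splits)
      qed
      have "?q \<noteq> 0"
      proof
        assume "?q = 0"
        then have "?T = {}" using kq by simp
        then show False using fx x by auto
      qed
      then have m: "lm ?q \<in> ?T" "\<And>t. t \<in> ?T \<Longrightarrow> t = lm ?q \<or> mless t (lm ?q)"
        using lm_in_keys[of ?q] lm_max[of ?q] kq by auto
      define u where "u = lm ?q"
      have "lookup (\<Sum>t\<in>lms V. cscale (f (b t)) (b t)) u =
          (\<Sum>t\<in>lms V. if t = u then f (b u) * lookup (b u) u else 0)"
        unfolding lookup_sum
      proof (intro sum.cong refl)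
        fix t assume t: "t \<in> lms V"
        show "lookup (cscale (f (b t)) (b t)) u = (if t = u then f (b u) * lookup (b u) u else 0)"
        proof (cases "t = u \<or> f (b t) = 0")
          case False
          then have "mless t u" using m(2)[of t] t u_def by auto
          then have "u \<notin> keys (b t)"
            using lm_max[of "b t" u] b[OF t] mless_trans mless_irrefl by metis
          then show ?thesis using False by (simp add: in_keys_iff)
        qed auto
      qed
      also have "\<dots> = f (b u) * lookup (b u) u" using finL m(1) u_def by simp
      finally have "f (b u) * lookup (b u) u = 0" using s' by simp
      moreover have "lookup (b u) u \<noteq> 0"
        using b[of u] m(1) lm_in_keys[of "b u"] u_def by (auto simp: in_keys_iff)
      ultimately show False using m(1) u_def by simp
    qed
  qed (use finL in simp)
  have span: "V \<subseteq> cs.span (b ` lms V)"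
  proof
    fix p assume "p \<in> V"
    then show "p \<in> cs.span (b ` lms V)"
    \<comment> \<open>The number of monomials of the finite set F up to \<open>lm p\<close> measures
      the progress of the elimination.\<close>
    proof (induction "card {s \<in> F. s = lm p \<or> mless s (lm p)}" arbitrary: p rule: less_induct)
      case less
      show ?case
      proof (cases "p = 0")
        case False
        have l: "lm p \<in> lms V" using less.prems False by (auto simp: lms_def)
        let ?b = "b (lm p)"
        let ?c = "lookup p (lm p) / lookup ?b (lm p)"
        define p' where "p' = p - cscale ?c ?b"
        have V': "p' \<in> V" unfolding p'_def
          using V less.prems b[OF l] by (intro cs.subspace_diff cs.subspace_scale) auto
        have "p' \<in> cs.span (b ` lms V)"
        proof (cases "p' = 0")
          case p'0: False
          have ml: "mless (lm p') (lm p)"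
            using lm_diff_less[OF False _ _ p'_def p'0] b[OF l] by blast
          have "lm p \<in> F" using L l by blast
          moreover have "\<not> (lm p = lm p' \<or> mless (lm p) (lm p'))"
            using ml mless_trans[of "lm p" "lm p'" "lm p"] mless_irrefl[of "lm p"] by metis
          moreover have "s = lm p' \<or> mless s (lm p') \<Longrightarrow> mless s (lm p)" for s
            using ml mless_trans by metis
          ultimately have "{s \<in> F. s = lm p' \<or> mless s (lm p')} \<subset> {s \<in> F. s = lm p \<or> mless s (lm p)}"
            by blast
          then have "card {s \<in> F. s = lm p' \<or> mless s (lm p')} < card {s \<in> F. s = lm p \<or> mless s (lm p)}"
            using F(1) by (intro psubset_card_mono) auto
          then show ?thesis using less.hyps V' by blast
        qed (simp add: cs.span_zero)
        moreover have "cscale ?c ?b \<in> cs.span (b ` lms V)"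
          using l by (intro cs.span_scale cs.span_base) auto
        ultimately have "p' + cscale ?c ?b \<in> cs.span (b ` lms V)" by (rule cs.span_add)
        then show ?thesis by (simp add: p'_def)
      qed (simp add: cs.span_zero)
    qed
  qed
  have "card (b ` lms V) = cs.dim V"
    using cs.basis_card_eq_dim[OF _ span ind] b by blast
  then show ?thesis using inj by (simp add: card_image)
qed

lemma finite_span_bounded:
  fixes V :: "('n, 'k::field) mpol set"
  assumes F: "finite F" "\<And>p. p \<in> V \<Longrightarrow> keys p \<subseteq> F"
  shows "\<exists>G. finite G \<and> V \<subseteq> cs.span G"
proof -
  let ?G = "(\<lambda>t. single t (1::'k)) ` F"
  have c: "cscale c (single t 1) = single t c" for c :: 'k and t :: "'n \<Rightarrow>\<^sub>0 nat"
    by (rule poly_mapping_eqI) (simp add: lookup_single when_def)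
  have "p \<in> cs.span ?G" if p: "p \<in> V" for p
  proof -
    have "p = (\<Sum>t\<in>keys p. cscale (lookup p t) (single t 1))"
      by (simp only: c mpol_expand)
    also have "\<dots> \<in> cs.span ?G"
      using F(2)[OF p] by (intro cs.span_sum cs.span_scale cs.span_base) auto
    finally show ?thesis .
  qed
  then show ?thesis using F(1) by (intro exI[of _ ?G]) auto
qed

section \<open>Factoriality of the polynomial ring, one variable at a time\<close>

section \<open>Polynomials in one of the variables\<close>

definition pvar :: "'n \<Rightarrow> ('n, 'k::zero_neq_one) mpol" where
  "pvar x = single (single x 1) 1"

text \<open>The coefficients are free of x but stay in the same ring, so evaluation at the variable
  x gives p back (\<open>poly_upoly\<close>).\<close>

definition upoly :: "'n \<Rightarrow> ('n, 'k::comm_monoid_add) mpol \<Rightarrow> ('n, 'k) mpol poly" where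
  "upoly x p = (\<Sum>t\<in>keys p. monom (single (t - single x (lookup t x)) (lookup p t)) (lookup t x))"

lemma mon_split_iff:
  fixes s t :: "'n \<Rightarrow>\<^sub>0 nat"
  shows "lookup t x = j \<and> t - single x j = s \<longleftrightarrow> t = s + single x j \<and> lookup s x = 0"
proof
  assume h: "lookup t x = j \<and> t - single x j = s"
  have "lookup t k = lookup (s + single x j) k" for k
    using h by (auto simp: lookup_add lookup_minus lookup_single when_def)
  then show "t = s + single x j \<and> lookup s x = 0"
    using h by (auto intro: poly_mapping_eqI simp: lookup_minus)
next
  assume "t = s + single x j \<and> lookup s x = 0"
  then show "lookup t x = j \<and> t - single x j = s" by (simp add: lookup_add)
qed

lemma mon_split: "(t - single x (lookup t x)) + single x (lookup t x) = t" "lookup (t - single x (lookup t x)) x = 0"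
  for t :: "'n \<Rightarrow>\<^sub>0 nat"
  using mon_split_iff[of t x "lookup t x" "t - single x (lookup t x)"] by auto

lemma lookup_coeff_upoly:
  "lookup (coeff (upoly x p) j) s = (if lookup s x = 0 then lookup p (s + single x j) else 0)"
proof -
  have "lookup (coeff (upoly x p) j) s =
      (\<Sum>t\<in>keys p. if t = s + single x j \<and> lookup s x = 0 then lookup p t else 0)"
    unfolding upoly_def coeff_sum lookup_sum
  proof (intro sum.cong refl)
    fix t
    show "lookup (coeff (monom (single (t - single x (lookup t x)) (lookup p t)) (lookup t x)) j) s =
        (if t = s + single x j \<and> lookup s x = 0 then lookup p t else 0)"
      using mon_split_iff[of t x j s] by (auto simp: lookup_single when_def)
  qed
  also have "\<dots> = (if lookup s x = 0 then lookup p (s + single x j) else 0)"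
    by (auto simp: in_keys_iff)
  finally show ?thesis .
qed

lemma upoly_add: "upoly x (p + q) = upoly x p + upoly x q"
  by (intro poly_eqI poly_mapping_eqI) (simp add: lookup_coeff_upoly lookup_add)

lemma upoly_0 [simp]: "upoly x 0 = 0" by (simp add: upoly_def)

lemma upoly_diff:
  fixes p q :: "('n, 'k::ab_group_add) mpol"
  shows "upoly x (p - q) = upoly x p - upoly x q"
  by (intro poly_eqI poly_mapping_eqI) (simp add: lookup_coeff_upoly lookup_minus)

lemma upoly_sum: "upoly x (sum f A) = (\<Sum>a\<in>A. upoly x (f a))"
  by (induction A rule: infinite_finite_induct) (auto simp: upoly_add)

lemma upoly_single:
  "upoly x (single t c) = monom (single (t - single x (lookup t x)) c) (lookup t x)"
  by (simp add: upoly_def)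

lemma upoly_mult:
  fixes p q :: "('n, 'k::comm_semiring_1) mpol"
  shows "upoly x (p * q) = upoly x p * upoly x q"
proof -
  have 1: "upoly x (single s a * single t b) = upoly x (single s a) * upoly x (single t b)"
    for s t :: "'n \<Rightarrow>\<^sub>0 nat" and a b :: 'k
  proof -
    have "s + t - single x (lookup (s + t) x) = (s - single x (lookup s x)) + (t - single x (lookup t x))"
      by (rule poly_mapping_eqI) (auto simp: lookup_add lookup_minus lookup_single when_def)
    then show ?thesis by (simp add: mult_single upoly_single mult_monom lookup_add)
  qed
  have "p * q = (\<Sum>s\<in>keys p. \<Sum>t\<in>keys q. single s (lookup p s) * single t (lookup q t))"
    unfolding sum_product[symmetric] mpol_expand ..
  then have "upoly x (p * q) =
      (\<Sum>s\<in>keys p. \<Sum>t\<in>keys q. upoly x (single s (lookup p s)) * upoly x (single t (lookup q t)))"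
    by (simp only: upoly_sum 1)
  also have "\<dots> = upoly x p * upoly x q"
    unfolding sum_product[symmetric] upoly_sum[symmetric] mpol_expand ..
  finally show ?thesis .
qed

lemma pvar_power: "(pvar x :: ('n, 'k::comm_semiring_1) mpol) ^ j = single (single x j) 1"
  by (induction j) (simp_all add: pvar_def mult_single flip: single_add)

lemma poly_upoly:
  fixes p :: "('n, 'k::comm_semiring_1) mpol"
  shows "poly (upoly x p) (pvar x) = p"
proof -
  have "poly (upoly x p) (pvar x) =
      (\<Sum>t\<in>keys p. single (t - single x (lookup t x)) (lookup p t) * pvar x ^ lookup t x)"
    by (simp add: upoly_def poly_sum poly_monom)
  also have "\<dots> = (\<Sum>t\<in>keys p. single t (lookup p t))"
    by (simp add: pvar_power mult_single mon_split(1))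
  finally show ?thesis by (simp only: mpol_expand)
qed

lemma upoly_eq_0_iff [simp]: "upoly x p = 0 \<longleftrightarrow> p = 0" for p :: "('n, 'k::comm_semiring_1) mpol"
  using poly_upoly[of x p] by auto

lemma upoly_pvar_power: "upoly x (pvar x ^ j :: ('n, 'k::comm_semiring_1) mpol) = monom 1 j"
proof -
  have "single x j - single x (lookup (single x j) x) = 0" by (rule poly_mapping_eqI) (simp add: lookup_minus)
  then show ?thesis by (simp add: pvar_power upoly_single)
qed

definition degx :: "'n \<Rightarrow> ('n, 'k::comm_monoid_add) mpol \<Rightarrow> nat" where
  "degx x p = degree (upoly x p)"

definition lcx :: "'n \<Rightarrow> ('n, 'k::comm_monoid_add) mpol \<Rightarrow> ('n, 'k) mpol" where
  "lcx x p = lead_coeff (upoly x p)"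

lemma degx_0 [simp]: "degx x 0 = 0" by (simp add: degx_def)

lemma degx_mult:
  fixes p q :: "('n::linorder, 'k::idom) mpol"
  shows "p \<noteq> 0 \<Longrightarrow> q \<noteq> 0 \<Longrightarrow> degx x (p * q) = degx x p + degx x q"
  by (simp add: degx_def upoly_mult degree_mult_eq)

lemma lcx_neq_0: "p \<noteq> 0 \<Longrightarrow> lcx x p \<noteq> 0" for p :: "('n, 'k::comm_semiring_1) mpol"
  by (simp add: lcx_def)

lemma degx_le_iff: "degx x p \<le> N \<longleftrightarrow> (\<forall>t\<in>keys p. lookup t x \<le> N)"
proof
  assume le: "degx x p \<le> N"
  show "\<forall>t\<in>keys p. lookup t x \<le> N"
  proof
    fix t assume t: "t \<in> keys p"
    have "lookup (coeff (upoly x p) (lookup t x)) (t - single x (lookup t x)) = lookup p t"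
      by (simp add: lookup_coeff_upoly mon_split)
    then have "coeff (upoly x p) (lookup t x) \<noteq> 0" using t by (auto simp: in_keys_iff)
    then show "lookup t x \<le> N" using le le_degree order_trans by (fastforce simp: degx_def)
  qed
next
  assume h: "\<forall>t\<in>keys p. lookup t x \<le> N"
  have "coeff (upoly x p) j = 0" if "j > N" for j
  proof (rule poly_mapping_eqI)
    fix s
    have "s + single x j \<notin> keys p" if "lookup s x = 0"
      using h \<open>j > N\<close> that by (auto simp: lookup_add)
    then show "lookup (coeff (upoly x p) j) s = lookup 0 s"
      by (auto simp: lookup_coeff_upoly in_keys_iff)
  qed
  then show "degx x p \<le> N" unfolding degx_def by (intro degree_le) auto
qed

lemma degx_coeff_le: "degx y (coeff (upoly x p) j) \<le> degx y p"
  unfolding degx_le_iff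
proof
  fix s assume "s \<in> keys (coeff (upoly x p) j)"
  then have "s + single x j \<in> keys p" by (auto simp: in_keys_iff lookup_coeff_upoly split: if_splits)
  then have "lookup (s + single x j) y \<le> degx y p" using degx_le_iff[of y p "degx y p"] by blast
  then show "lookup s y \<le> degx y p" by (simp add: lookup_add)
qed

lemma degx_coeff_same: "degx x (coeff (upoly x p) j) = 0"
proof -
  have "degx x (coeff (upoly x p) j) \<le> 0" unfolding degx_le_iff
    by (auto simp: in_keys_iff lookup_coeff_upoly split: if_splits)
  then show ?thesis by simp
qed

lemma degx_diff_le:
  fixes p q :: "('n, 'k::ab_group_add) mpol"
  shows "degx x p \<le> N \<Longrightarrow> degx x q \<le> N \<Longrightarrow> degx x (p - q) \<le> N"
  unfolding degx_le_iff using keys_diff[of p q] by blast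

lemma degx_mult_le:
  fixes p q :: "('n::linorder, 'k::idom) mpol"
  shows "degx x (p * q) \<le> degx x p + degx x q"
  by (cases "p = 0 \<or> q = 0") (auto simp: degx_mult)

lemma degx_single: "c \<noteq> 0 \<Longrightarrow> degx x (single t c) = lookup t x"
  unfolding degx_def upoly_single by (rule degree_monom_eq) (metis lookup_single_eq lookup_zero)

lemma degx_pvar_power:
  "degx y (pvar x ^ j :: ('n, 'k::comm_semiring_1) mpol) = (if x = y then j else 0)"
  by (simp add: pvar_power degx_single lookup_single when_def)

lemma upoly_const:
  fixes p :: "('n, 'k::comm_semiring_1) mpol"
  assumes "degx x p = 0" shows "upoly x p = [:p:]"
proof -
  obtain c where c: "upoly x p = [:c:]" using assms by (auto simp: degx_def elim: degree_eq_zeroE)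
  then have "p = c" using poly_upoly[of x p] by simp
  then show ?thesis using c by simp
qed

text \<open>The subring k[S].\<close>

definition Rs :: "'n set \<Rightarrow> ('n, 'k::zero) mpol set" where
  "Rs S = {p. \<forall>t\<in>keys p. keys t \<subseteq> S}"

lemma Rs_UNIV [simp]: "Rs UNIV = UNIV" by (simp add: Rs_def)

lemma Rs_mono: "S \<subseteq> T \<Longrightarrow> Rs S \<subseteq> Rs T" by (auto simp: Rs_def)

lemma Rs_iff: "p \<in> Rs S \<longleftrightarrow> (\<forall>x. x \<notin> S \<longrightarrow> degx x p = 0)"
proof -
  have "degx x p = 0 \<longleftrightarrow> (\<forall>t\<in>keys p. x \<notin> keys t)" for x
    using degx_le_iff[of x p 0] by (simp add: in_keys_iff)
  then show ?thesis by (auto simp: Rs_def)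
qed

lemma Rs_0 [simp]: "0 \<in> Rs S" by (simp add: Rs_def)
lemma Rs_1 [simp]: "(1 :: ('n, 'k::zero_neq_one) mpol) \<in> Rs S" by (simp add: Rs_def)

lemma Rs_add: "p \<in> Rs S \<Longrightarrow> q \<in> Rs S \<Longrightarrow> p + q \<in> Rs S"
  unfolding Rs_def using keys_add[of p q] by blast

lemma Rs_diff: "p \<in> Rs S \<Longrightarrow> q \<in> Rs S \<Longrightarrow> p - q \<in> Rs S" for p q :: "('n, 'k::ab_group_add) mpol"
  unfolding Rs_def using keys_diff[of p q] by blast

lemma Rs_mult:
  fixes p q :: "('n::linorder, 'k::idom) mpol"
  shows "p \<in> Rs S \<Longrightarrow> q \<in> Rs S \<Longrightarrow> p * q \<in> Rs S"
  using degx_mult_le[of _ p q] by (simp add: Rs_iff) (metis add_0 le_zero_eq)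

lemma Rs_power: "p \<in> Rs S \<Longrightarrow> p ^ j \<in> Rs S" for p :: "('n::linorder, 'k::idom) mpol"
  by (induction j) (auto simp: Rs_mult)

lemma Rs_pvar_power: "x \<in> S \<Longrightarrow> (pvar x ^ j :: ('n, 'k::comm_semiring_1) mpol) \<in> Rs S"
  by (auto simp: Rs_iff degx_pvar_power)

lemma Rs_coeff: "p \<in> Rs S \<Longrightarrow> coeff (upoly x p) j \<in> Rs (S - {x})"
  unfolding Rs_iff using degx_coeff_le[of _ x p j] degx_coeff_same[of x p j] by (metis DiffI insertE empty_iff le_zero_eq)

lemma Rs_lcx: "p \<in> Rs S \<Longrightarrow> lcx x p \<in> Rs (S - {x})"
  unfolding lcx_def by (rule Rs_coeff)

lemma Rs_factor:
  fixes p q :: "('n::linorder, 'k::idom) mpol"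
  assumes "p * q \<in> Rs S" "p * q \<noteq> 0" shows "p \<in> Rs S" "q \<in> Rs S"
proof -
  have "degx x (p * q) = degx x p + degx x q" for x using assms(2) by (intro degx_mult) auto
  then show "p \<in> Rs S" "q \<in> Rs S" using assms(1) by (auto simp: Rs_iff)
qed

lemma Rs_empty:
  assumes "p \<in> Rs {}" shows "p = single 0 (lookup p 0)"
proof (rule poly_mapping_eqI)
  fix t show "lookup p t = lookup (single 0 (lookup p 0)) t"
    using assms by (cases "t = 0") (auto simp: Rs_def in_keys_iff lookup_single when_def)
qed

text \<open>Multiplying by \<open>lcx x p\<close> before each cancellation of a leading term avoids
  fractions. The closing clauses serve later arguments: in Gauss's lemma everything must stay in
  k[S], and when degrees in two variables are compared the remainder must not grow in a variable
  that p does not involve.\<close>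

lemma pseudo_division:
  fixes p A :: "('n::linorder, 'k::idom) mpol"
  assumes p: "p \<noteq> 0"
  shows "\<exists>N q r. lcx x p ^ N * A = p * q + r \<and> (r = 0 \<or> degx x r < degx x p) \<and>
    (\<forall>S. x \<in> S \<longrightarrow> p \<in> Rs S \<longrightarrow> A \<in> Rs S \<longrightarrow> q \<in> Rs S \<and> r \<in> Rs S) \<and>
    (\<forall>y. y \<noteq> x \<longrightarrow> degx y p = 0 \<longrightarrow> degx y r \<le> degx y A)"
proof (induction "degx x A" arbitrary: A rule: less_induct)
  case less
  show ?case
  proof (cases "A = 0 \<or> degx x A < degx x p")
    case True
    then show ?thesis by (intro exI[of _ 0] exI[of _ 0] exI[of _ A]) auto
  next
    case False
    then have A0: "A \<noteq> 0" and le: "degx x p \<le> degx x A" by auto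
    define k where "k = degx x A - degx x p"
    define M where "M = lcx x A * pvar x ^ k"
    define B where "B = lcx x p * A - M * p"
    have c0: "upoly x (lcx x q) = [:lcx x q:]" for q :: "('n, 'k) mpol"
      by (rule upoly_const) (simp add: lcx_def degx_coeff_same)
    have uB: "upoly x B = smult (lcx x p) (upoly x A) -
        smult (lcx x A) (monom 1 k * upoly x p)"
      by (simp add: B_def M_def upoly_diff upoly_mult c0 upoly_pvar_power)
    have Bx: "B = 0 \<or> degx x B < degx x A"
    proof -
      have "degree (upoly x B) \<le> degx x A"
        unfolding uB
      proof (rule degree_diff_le)
        show "degree (smult (lcx x p) (upoly x A)) \<le> degx x A"
          by (simp add: degx_def)
        have "degree (monom (1 :: ('n, 'k) mpol) k * upoly x p) \<le> k + degx x p"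
          using degree_mult_le[of "monom (1 :: ('n, 'k) mpol) k" "upoly x p"]
          by (simp add: degx_def degree_monom_eq)
        then show "degree (smult (lcx x A) (monom 1 k * upoly x p)) \<le> degx x A"
          using le by (intro order_trans[OF degree_smult_le]) (simp add: k_def)
      qed
      moreover have "coeff (upoly x B) (degx x A) = 0"
      proof -
        have "coeff (monom 1 k * upoly x p) (degx x A) = lcx x p"
          using le by (simp add: coeff_monom_mult k_def lcx_def degx_def)
        then show ?thesis unfolding uB by (simp add: lcx_def degx_def)
      qed
      ultimately show ?thesis using eq_zero_or_degree_less[of "upoly x B" "degx x A"]
        by (auto simp: degx_def)
    qed
    have RB: "M \<in> Rs S \<and> B \<in> Rs S" if "x \<in> S" "p \<in> Rs S" "A \<in> Rs S" for S
      using that Rs_lcx[of p S x] Rs_lcx[of A S x] Rs_mono[of "S - {x}" S]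
      by (auto simp: M_def B_def intro!: Rs_mult Rs_diff Rs_pvar_power)
    have dB: "degx y B \<le> degx y A" if y: "y \<noteq> x" "degx y p = 0" for y
    proof -
      have "degx y (lcx x p) = 0" using degx_coeff_le[of y x p] y by (simp add: lcx_def)
      moreover have "degx y (lcx x A) \<le> degx y A" by (simp add: lcx_def degx_coeff_le)
      moreover have "degx y (pvar x ^ k :: ('n, 'k) mpol) = 0" using y by (simp add: degx_pvar_power)
      ultimately have "degx y M \<le> degx y A" "degx y (lcx x p * A) \<le> degx y A"
        using degx_mult_le[of y "lcx x A" "pvar x ^ k"] degx_mult_le[of y "lcx x p" A] by (auto simp: M_def)
      then show ?thesis unfolding B_def
        using degx_mult_le[of y M p] y by (intro degx_diff_le) auto
    qed
    show ?thesis
    proof (cases "B = 0")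
      case True
      then have "lcx x p ^ 1 * A = p * M + 0" by (simp add: B_def mult.commute)
      then show ?thesis using RB by (intro exI[of _ 1] exI[of _ M] exI[of _ 0]) auto
    next
      case False
      with Bx have lt: "degx x B < degx x A" by simp
      from less(1)[OF lt] obtain N q r where *: "lcx x p ^ N * B = p * q + r"
        "r = 0 \<or> degx x r < degx x p"
        "\<And>S. x \<in> S \<Longrightarrow> p \<in> Rs S \<Longrightarrow> B \<in> Rs S \<Longrightarrow> q \<in> Rs S \<and> r \<in> Rs S"
        "\<And>y. y \<noteq> x \<Longrightarrow> degx y p = 0 \<Longrightarrow> degx y r \<le> degx y B" by blast
      have "lcx x p ^ Suc N * A = lcx x p ^ N * (lcx x p * A)"
        by (simp only: power_Suc2 mult.assoc)
      also have "lcx x p * A = B + M * p" by (simp add: B_def)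
      also have "lcx x p ^ N * (B + M * p) = p * q + r + lcx x p ^ N * (M * p)"
        by (simp only: distrib_left *(1))
      also have "\<dots> = p * (q + lcx x p ^ N * M) + r"
        by (simp only: distrib_left add_ac mult_ac)
      finally have e: "lcx x p ^ Suc N * A = p * (q + lcx x p ^ N * M) + r" .
      have "q + lcx x p ^ N * M \<in> Rs S \<and> r \<in> Rs S" if S: "x \<in> S" "p \<in> Rs S" "A \<in> Rs S" for S
      proof -
        have "lcx x p \<in> Rs S" using Rs_lcx[of p S x] Rs_mono[of "S - {x}" S] S by blast
        then have "lcx x p ^ N * M \<in> Rs S" using RB[OF S] by (intro Rs_mult Rs_power) auto
        then show ?thesis using *(3)[OF S(1,2)] RB[OF S] by (simp add: Rs_add)
      qed
      moreover have "degx y r \<le> degx y A" if "y \<noteq> x" "degx y p = 0" for y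
        using *(4)[OF that] dB[OF that] by simp
      ultimately show ?thesis using e *(2) by blast
    qed
  qed
qed

section \<open>Unique factorization\<close>

text \<open>Take the first coefficients of F and of G outside P: in the coefficient of F G at the
  sum of the two indices every other product lies in P. Primality is asked only of products of
  coefficients, since in Gauss's lemma it is known on a subring only.\<close>

lemma coeff_mult_in_ideal:
  fixes F G :: "'r::comm_ring_1 poly"
  assumes P: "is_ideal P"
    and prime: "\<And>i j. coeff F i * coeff G j \<in> P \<Longrightarrow>
      coeff F i \<in> P \<or> coeff G j \<in> P"
    and all: "\<And>n. coeff (F * G) n \<in> P"
  shows "(\<forall>i. coeff F i \<in> P) \<or> (\<forall>j. coeff G j \<in> P)"
proof (rule ccontr)
  assume "\<not> ?thesis"
  then have ex: "\<exists>i. coeff F i \<notin> P" "\<exists>j. coeff G j \<notin> P" by auto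
  define i where "i = (LEAST i. coeff F i \<notin> P)"
  define j where "j = (LEAST j. coeff G j \<notin> P)"
  have i: "coeff F i \<notin> P" "\<And>k. k < i \<Longrightarrow> coeff F k \<in> P"
    using LeastI_ex[OF ex(1)] not_less_Least unfolding i_def by blast+
  have j: "coeff G j \<notin> P" "\<And>k. k < j \<Longrightarrow> coeff G k \<in> P"
    using LeastI_ex[OF ex(2)] not_less_Least unfolding j_def by blast+
  have "(\<Sum>k\<in>{..i + j} - {i}. coeff F k * coeff G (i + j - k)) \<in> P"
  proof (rule ring_mod.subspace_sum[OF P])
    fix k assume "k \<in> {..i + j} - {i}"
    then have "k < i \<or> i + j - k < j" by auto
    then show "coeff F k * coeff G (i + j - k) \<in> P"
      using i(2)[of k] j(2)[of "i + j - k"] ring_mod.subspace_scale[OF P] by (metis mult.commute)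
  qed
  moreover have "coeff (F * G) (i + j) = coeff F i * coeff G j +
      (\<Sum>k\<in>{..i + j} - {i}. coeff F k * coeff G (i + j - k))"
    unfolding coeff_mult by (subst sum.remove[of _ i]) auto
  ultimately have "coeff F i * coeff G j \<in> P"
    using ring_mod.subspace_diff[OF P all[of "i + j"]] by fastforce
  then show False using prime i(1) j(1) by blast
qed

lemma dvd_upoly_iff:
  fixes p h :: "('n::linorder, 'k::idom) mpol"
  assumes "degx x p = 0"
  shows "p dvd h \<longleftrightarrow> (\<forall>j. p dvd coeff (upoly x h) j)"
proof
  assume "p dvd h"
  then obtain k where "h = p * k" by blast
  then show "\<forall>j. p dvd coeff (upoly x h) j" by (simp add: upoly_mult upoly_const[OF assms])
next
  assume h: "\<forall>j. p dvd coeff (upoly x h) j"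
  have "p dvd poly (upoly x h) (pvar x)"
    unfolding poly_altdef using h by (intro dvd_sum) (auto intro: dvd_mult2)
  then show "p dvd h" by (simp add: poly_upoly)
qed

lemma is_ideal_dvd: "is_ideal {h :: 'r::comm_ring_1. p dvd h}"
  by (rule ring_mod.subspaceI) auto

text \<open>Divisibility by an element free of x is tested coefficient by coefficient, so primality
  passes from k[S] to k[S][x].\<close>

lemma prime_over_extend:
  fixes p :: "('n::linorder, 'k::idom) mpol"
  assumes p: "degx x p = 0" and x: "x \<notin> S"
    and prime: "\<And>f g. f \<in> Rs S \<Longrightarrow> g \<in> Rs S \<Longrightarrow> p dvd f * g \<Longrightarrow> p dvd f \<or> p dvd g"
    and fg: "f \<in> Rs (insert x S)" "g \<in> Rs (insert x S)" "p dvd f * g"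
  shows "p dvd f \<or> p dvd g"
proof -
  have "insert x S - {x} = S" using x by auto
  then have c: "coeff (upoly x h) j \<in> Rs S" if "h \<in> Rs (insert x S)" for h :: "('n, 'k) mpol" and j
    using Rs_coeff[OF that, of x j] by simp
  have "(\<forall>i. coeff (upoly x f) i \<in> {h. p dvd h}) \<or> (\<forall>i. coeff (upoly x g) i \<in> {h. p dvd h})"
  proof (rule coeff_mult_in_ideal[OF is_ideal_dvd])
    show "coeff (upoly x f * upoly x g) n \<in> {h. p dvd h}" for n
      using fg(3) dvd_upoly_iff[OF p, of "f * g"] by (simp add: upoly_mult)
  next
    fix i j
    assume "coeff (upoly x f) i * coeff (upoly x g) j \<in> {h. p dvd h}"
    then show "coeff (upoly x f) i \<in> {h. p dvd h} \<or> coeff (upoly x g) j \<in> {h. p dvd h}"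
      using prime[OF c[OF fg(1)] c[OF fg(2)]] by blast
  qed
  then show ?thesis using dvd_upoly_iff[OF p] by blast
qed

lemma ex_irreducible_factor:
  fixes c :: "('n::{finite, linorder}, 'k::field) mpol"
  assumes "c \<noteq> 0" "\<not> c dvd 1"
  shows "\<exists>p. Factorial_Ring.irreducible p \<and> p dvd c"
  using assms
proof (induction "tdeg c" arbitrary: c rule: less_induct)
  case less
  show ?case
  proof (cases "Factorial_Ring.irreducible c")
    case False
    then obtain a b where ab: "c = a * b" "\<not> a dvd 1" "\<not> b dvd 1"
      using less.prems by (auto simp: Factorial_Ring.irreducible_def)
    then have "a \<noteq> 0" "b \<noteq> 0" using less.prems by auto
    then have "tdeg a < tdeg c" using ab tdeg_mult[of a b] mpol_dvd_1_iff[of b] by auto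
    then obtain p where "Factorial_Ring.irreducible p" "p dvd a"
      using less.hyps[of a] \<open>a \<noteq> 0\<close> ab(2) by blast
    then show ?thesis using ab(1) by (metis dvd_mult2)
  qed auto
qed

lemma irreducible_factors:
  assumes "Factorial_Ring.irreducible p" "p = a * b"
  shows "a dvd 1 \<or> b dvd 1"
  using assms by (auto simp: Factorial_Ring.irreducible_def)

lemma degx_unit:
  fixes p :: "('n::{finite, linorder}, 'k::field) mpol"
  assumes "p dvd 1" shows "degx x p = 0"
proof -
  have "lookup t x \<le> 0" if "t \<in> keys p" for t
    using lookup_le_mon_deg[of t x] mon_deg_le_tdeg[OF that] assms mpol_dvd_1_iff[of p] by simp
  then have "degx x p \<le> 0" by (simp only: degx_le_iff) blast
  then show ?thesis by simp
qed

lemma combination_reduce: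
  fixes c a f b p u v q :: "'r::comm_ring_1"
  shows "c * (a * f + b * p) - (u * f + v * p) * q = (c * a - q * u) * f + (c * b - q * v) * p"
  by (simp add: algebra_simps)

text \<open>
  Gauss's lemma, one variable at a time: a polynomial that involves \<open>x\<close> and is irreducible has no
  factor free of \<open>x\<close>, and it divides every combination of minimal degree in \<open>x\<close> up to such factors.
\<close>

lemma irreducible_dvd_mult_Rs:
  fixes p f g :: "('n::{finite, linorder}, 'k::field) mpol"
  assumes "finite S" "p \<in> Rs S" "Factorial_Ring.irreducible p"
    "f \<in> Rs S" "g \<in> Rs S" "p dvd f * g"
  shows "p dvd f \<or> p dvd g"
  using assms
proof (induction S arbitrary: p f g rule: finite_induct)
  case empty
  have "p \<noteq> 0" "\<not> p dvd 1" using empty by (auto simp: Factorial_Ring.irreducible_def)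
  moreover have "p = single 0 (lookup p 0)" by (rule Rs_empty[OF empty(1)])
  ultimately have False using single_0_dvd_1[of "lookup p 0"] by (metis single_zero)
  then show ?case ..
next
  case (insert x S)
  let ?R = "Rs (insert x S) :: ('n, 'k) mpol set"
  have ins: "insert x S - {x} = S" using insert by auto
  have sub: "Rs S \<subseteq> ?R" by (rule Rs_mono) auto
  have Rs0: "h \<in> Rs S" if "h \<in> ?R" "degx x h = 0" for h
    unfolding Rs_iff using that by (auto simp: Rs_iff) metis
  have deg0: "degx x h = 0" if "h \<in> Rs S" for h :: "('n, 'k) mpol"
    using that insert by (auto simp: Rs_iff)
  have prime0: "q dvd a \<or> q dvd b"
    if "q \<in> Rs S" "Factorial_Ring.irreducible q" "a \<in> ?R" "b \<in> ?R" "q dvd a * b" for q a b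
    using prime_over_extend[of x q S a b] deg0[OF that(1)] insert.hyps insert.IH[OF that(1,2)] that
    by blast
  have p0: "p \<noteq> 0" "\<not> p dvd 1" using insert.prems by (auto simp: Factorial_Ring.irreducible_def)
  show ?case
  proof (cases "degx x p = 0")
    case True
    then show ?thesis using prime0[of p f g] Rs0 insert.prems by blast
  next
    case pos: False
    \<comment> \<open>Factors of c are removed one irreducible q at a time. Such a q is free of x
      while p is not, so q cannot divide the irreducible p; being prime on k[S][x], it divides
      k.\<close>
    have cancel: "p dvd h" if "c \<noteq> 0" "c \<in> Rs S" "h \<in> ?R" "k \<in> ?R" "c * h = p * k" for c h k
      using that
    proof (induction "tdeg c" arbitrary: c k rule: less_induct)
      case less
      show ?case
      proof (cases "c dvd 1 \<or> h = 0")
        case True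
        then show ?thesis
        proof
          assume "c dvd 1"
          then obtain i where "1 = c * i" by blast
          then have "h = (c * h) * i" by (metis mult.assoc mult.commute mult_1_right)
          then have "h = p * (k * i)" unfolding less.prems(5) by (simp only: mult.assoc)
          then show ?thesis by simp
        qed simp
      next
        case False
        then obtain q where q: "Factorial_Ring.irreducible q" "q dvd c"
          using ex_irreducible_factor less.prems(1) by blast
        then obtain c' where c': "c = q * c'" by blast
        have qS: "q \<in> Rs S" "c' \<in> Rs S" using Rs_factor[of q c' S] less.prems c' by auto
        have q0: "q \<noteq> 0" "\<not> q dvd 1" using q by (auto simp: Factorial_Ring.irreducible_def)
        have c'0: "c' \<noteq> 0" using c' less.prems by auto
        have "\<not> q dvd p"
        proof
          assume "q dvd p"
          then obtain l where l: "p = q * l" by blast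
          then have "l dvd 1" using irreducible_factors[OF insert.prems(2) l] q0 by blast
          then have l0: "l \<noteq> 0" "degx x l = 0" using mpol_dvd_1_iff degx_unit by auto
          then show False using l pos degx_mult[OF q0(1) l0(1), of x] deg0[OF qS(1)] by simp
        qed
        moreover have "q dvd p * k" using less.prems(5) q(2) by (metis dvd_mult2)
        ultimately have "q dvd k" using prime0[OF qS(1) q(1) insert.prems(1) less.prems(4)] by blast
        then obtain k' where k': "k = q * k'" by blast
        have "q * (c' * h) = c * h" by (simp only: c' mult.assoc)
        also have "c * h = p * k" by (rule less.prems(5))
        also have "p * k = q * (p * k')" by (simp only: k' mult_ac)
        finally have "q * (c' * h) = q * (p * k')" .
        then have e: "c' * h = p * k'" using q0 by simp
        then have "k' \<noteq> 0" using c'0 False by auto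
        then have "k' \<in> ?R" using Rs_factor(2)[of q k' "insert x S"] k' less.prems(4) q0 by auto
        moreover have "tdeg c' < tdeg c" using c' tdeg_mult[of q c'] q0 c'0 mpol_dvd_1_iff[of q] by auto
        ultimately show ?thesis using less.hyps[of c' k'] c'0 qS e less.prems(3) by blast
      qed
    qed
    \<comment> \<open>The same removal applied to c p = r q: each irreducible factor of c divides r
      or q, and dividing it out keeps the degrees in x. A factorization of p over the fraction field
      of k[S] thus yields one in the ring.\<close>
    have split: "\<exists>r' q'. p = r' * q' \<and> degx x r' = degx x r \<and> degx x q' = degx x q"
      if "c \<noteq> 0" "c \<in> Rs S" "r \<in> ?R" "q \<in> ?R" "c * p = r * q" for c r q
      using that
    proof (induction "tdeg c" arbitrary: c r q rule: less_induct)
      case less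
      have rq0: "r \<noteq> 0" "q \<noteq> 0" using less.prems(1,5) p0 by auto
      show ?case
      proof (cases "c dvd 1")
        case True
        then obtain i where i: "1 = c * i" by blast
        then have "p = i * (c * p)" by (metis mult.assoc mult.commute mult_1_right)
        then have "p = (i * r) * q" unfolding less.prems(5) by (simp only: mult.assoc)
        moreover have "i \<in> Rs S" using Rs_factor(2)[of c i S] i Rs_1 by (metis one_neq_zero)
        then have "degx x (i * r) = degx x r" using degx_mult[of i r x] i deg0 rq0 by fastforce
        ultimately show ?thesis by blast
      next
        case False
        then obtain s where s: "Factorial_Ring.irreducible s" "s dvd c"
          using ex_irreducible_factor less.prems(1) by blast
        then obtain c' where c': "c = s * c'" by blast
        have sS: "s \<in> Rs S" "c' \<in> Rs S" using Rs_factor[of s c' S] less.prems c' by auto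
        have s0: "s \<noteq> 0" "\<not> s dvd 1" using s by (auto simp: Factorial_Ring.irreducible_def)
        have c'0: "c' \<noteq> 0" using c' less.prems by auto
        have lt: "tdeg c' < tdeg c" using c' tdeg_mult[of s c'] s0 c'0 mpol_dvd_1_iff[of s] by auto
        have "s dvd r * q" using less.prems(5) s(2) by (metis dvd_mult2)
        then consider "s dvd r" | "s dvd q" using prime0[OF sS(1) s(1) less.prems(3,4)] by blast
        then show ?thesis
        proof cases
          case 1
          then obtain r' where r': "r = s * r'" by blast
          have "s * (c' * p) = c * p" by (simp only: c' mult.assoc)
          also have "c * p = r * q" by (rule less.prems(5))
          also have "r * q = s * (r' * q)" by (simp only: r' mult_ac)
          finally have "s * (c' * p) = s * (r' * q)" .
          then have e: "c' * p = r' * q" using s0 by simp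
          have R: "r' \<in> ?R" using Rs_factor(2)[of s r' "insert x S"] r' less.prems(3) rq0 by auto
          have "degx x r' = degx x r" using r' rq0 degx_mult[of s r' x] deg0[OF sS(1)] by auto
          then show ?thesis using less.hyps[OF lt c'0 sS(2) R less.prems(4) e] by auto
        next
          case 2
          then obtain r' where r': "q = s * r'" by blast
          have "s * (c' * p) = c * p" by (simp only: c' mult.assoc)
          also have "c * p = r * q" by (rule less.prems(5))
          also have "r * q = s * (r * r')" by (simp only: r' mult_ac)
          finally have "s * (c' * p) = s * (r * r')" .
          then have e: "c' * p = r * r'" using s0 by simp
          have R: "r' \<in> ?R" using Rs_factor(2)[of s r' "insert x S"] r' less.prems(4) rq0 by auto
          have "degx x r' = degx x q" using r' rq0 degx_mult[of s r' x] deg0[OF sS(1)] by auto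
          then show ?thesis using less.hyps[OF lt c'0 sS(2) less.prems(3) R e] by auto
        qed
      qed
    qed
    show ?thesis
    proof (rule ccontr)
      assume n: "\<not> ?thesis"
      \<comment> \<open>A nonzero combination of f and p of least degree in x plays the role of
        their gcd over the fraction field of k[S]: by pseudo-division it divides every combination
        up to a power of its leading coefficient.\<close>
      define Z where "Z = {r. r \<noteq> 0 \<and> r \<in> ?R \<and> (\<exists>u v. u \<in> ?R \<and> v \<in> ?R \<and> r = u * f + v * p)}"
      have "\<exists>u v. u \<in> ?R \<and> v \<in> ?R \<and> p = u * f + v * p"
        by (rule exI[of _ 0], rule exI[of _ 1]) simp
      then have "p \<in> Z" unfolding Z_def using insert.prems(1) p0(1) by blast
      then obtain r where r: "r \<in> Z" "\<And>s. s \<in> Z \<Longrightarrow> degx x r \<le> degx x s"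
        using ex_has_least_nat[of "\<lambda>r. r \<in> Z" p "degx x"] by auto
      then obtain u v where uv: "u \<in> ?R" "v \<in> ?R" "r = u * f + v * p" by (auto simp: Z_def)
      have r0: "r \<noteq> 0" "r \<in> ?R" using r by (auto simp: Z_def)
      let ?c = "lcx x r"
      have cS: "?c \<in> Rs S" using Rs_lcx[OF r0(2), of x] ins by simp
      have c0: "?c \<noteq> 0" using r0(1) by (rule lcx_neq_0)
      have red: "\<exists>N q. ?c ^ N * h = r * q \<and> q \<in> ?R"
        if "h \<in> ?R" "a \<in> ?R" "b \<in> ?R" "h = a * f + b * p" for h a b
      proof -
        obtain N q s where s: "?c ^ N * h = r * q + s" "s = 0 \<or> degx x s < degx x r"
            and cl: "\<forall>S. x \<in> S \<longrightarrow> r \<in> Rs S \<longrightarrow> h \<in> Rs S \<longrightarrow> q \<in> Rs S \<and> s \<in> Rs S"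
          using pseudo_division[OF r0(1), of x h] by blast
        have qs: "q \<in> ?R" "s \<in> ?R" using cl[rule_format, of "insert x S"] r0(2) that(1) by auto
        have cR: "?c ^ N \<in> ?R" using cS sub by (intro Rs_power) auto
        have "s = ?c ^ N * h - r * q" using s(1) by simp
        also have "\<dots> = ?c ^ N * (a * f + b * p) - (u * f + v * p) * q" by (simp only: that(4) flip: uv(3))
        also have "\<dots> = (?c ^ N * a - q * u) * f + (?c ^ N * b - q * v) * p"
          by (rule combination_reduce)
        finally have "s = (?c ^ N * a - q * u) * f + (?c ^ N * b - q * v) * p" .
        moreover have "?c ^ N * a - q * u \<in> ?R" "?c ^ N * b - q * v \<in> ?R"
          using cR qs that uv by (auto intro!: Rs_diff Rs_mult)
        ultimately have "s \<noteq> 0 \<Longrightarrow> s \<in> Z" using qs(2) unfolding Z_def by blast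
        moreover have "s \<notin> Z" if "s \<noteq> 0" using s(2) r(2)[of s] that by auto
        ultimately have "s = 0" by blast
        then show ?thesis using s(1) qs by auto
      qed
      obtain N q where q: "?c ^ N * p = r * q" "q \<in> ?R"
        using red[of p 0 1] insert.prems by auto
      obtain M l where l: "?c ^ M * f = r * l" "l \<in> ?R"
        using red[of f 1 0] insert.prems by auto
      have cN: "?c ^ k \<in> Rs S" "?c ^ k \<noteq> 0" for k using cS c0 by (auto intro: Rs_power)
      \<comment> \<open>If r is free of x, then f is invertible modulo p over the fraction field and
        p divides g. Otherwise r accounts for a factor of p of positive degree, so by irreducibility
        the cofactor q is free of x and p divides f.\<close>
      show False
      proof (cases "degx x r = 0")
        case True
        then have "r \<in> Rs S" using Rs0 r0 by blast
        obtain w where w: "f * g = p * w" using insert.prems(5) by blast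
        have "w \<in> ?R"
        proof (cases "w = 0")
          case nz: False
          then have "p * w \<noteq> 0" using p0 by simp
          then show ?thesis using w Rs_factor(2)[of p w "insert x S"] Rs_mult[OF insert.prems(3,4)] by simp
        qed simp
        have "r * g = u * (f * g) + v * p * g" by (simp only: uv(3) distrib_right mult.assoc)
        also have "\<dots> = p * (u * w + v * g)" unfolding w by (simp only: distrib_left mult_ac)
        finally have "r * g = p * (u * w + v * g)" .
        moreover have "u * w + v * g \<in> ?R" using uv \<open>w \<in> ?R\<close> insert.prems by (intro Rs_add Rs_mult)
        ultimately have "p dvd g" using cancel[OF r0(1) \<open>r \<in> Rs S\<close> insert.prems(4)] by blast
        then show False using n by blast
      next
        case False
        obtain r' q' where rq: "p = r' * q'" "degx x r' = degx x r" "degx x q' = degx x q"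
          using split[OF cN(2,1) r0(2) q(2,1)] by blast
        have "degx x q = 0"
          using irreducible_factors[OF insert.prems(2) rq(1)] rq degx_unit False by metis
        then have qS: "q \<in> Rs S" using Rs0 q by blast
        have q0: "q \<noteq> 0" using q(1) cN(2)[of N] p0(1) by auto
        have "(?c ^ M * q) * f = (r * l) * q" 
          unfolding l(1)[symmetric] by (simp only: mult_ac)
        also have "\<dots> = (?c ^ N * p) * l" unfolding q(1) by (simp only: mult_ac)
        finally have "(?c ^ M * q) * f = p * (?c ^ N * l)" by (simp only: mult_ac)
        moreover have "?c ^ M * q \<in> Rs S" using cN qS by (intro Rs_mult)
        moreover have "?c ^ N * l \<in> ?R" using cN sub l by (intro Rs_mult) auto
        ultimately have "p dvd f"
          using cancel[of "?c ^ M * q" f "?c ^ N * l"] cN(2)[of M] q0 insert.prems(3) by simp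
        then show False using n by blast
      qed
    qed
  qed
qed

lemma irreducible_imp_prime_elem_mpol:
  fixes p :: "('n::{finite, linorder}, 'k::field) mpol"
  assumes "Factorial_Ring.irreducible p" shows "prime_elem p"
proof (rule prime_elemI)
  show "p dvd a \<or> p dvd b" if "p dvd a * b" for a b
    using irreducible_dvd_mult_Rs[of UNIV p a b] assms that by simp
qed (use assms in \<open>auto simp: Factorial_Ring.irreducible_def\<close>)

lemma ex_prime_factor:
  fixes c :: "('n::{finite, linorder}, 'k::field) mpol"
  assumes "c \<noteq> 0" "\<not> c dvd 1"
  shows "\<exists>p. prime_elem p \<and> p dvd c"
  using ex_irreducible_factor[OF assms] irreducible_imp_prime_elem_mpol by blast

text \<open>Coprimality is tested on primes, so that zero elements need no special
  treatment.\<close>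

definition no_common_prime :: "'r::comm_semiring_1 set \<Rightarrow> bool" where
  "no_common_prime A \<longleftrightarrow> (\<forall>p. prime_elem p \<longrightarrow> (\<exists>a\<in>A. \<not> p dvd a))"

text \<open>A prime factor of y misses some element of A and hence divides x; cancelling it from
  both x and y lowers the degree of y.\<close>

lemma no_common_prime_dvd:
  fixes A :: "('n::{finite, linorder}, 'k::field) mpol set"
  assumes A: "no_common_prime A" and "y \<noteq> 0" "\<And>a. a \<in> A \<Longrightarrow> y dvd x * a"
  shows "y dvd x"
  using assms(2,3)
proof (induction "tdeg y" arbitrary: x y rule: less_induct)
  case less
  show ?case
  proof (cases "y dvd 1")
    case True
    then show ?thesis by (rule dvd_trans) simp
  next
    case False
    then obtain p where p: "prime_elem p" "p dvd y" using ex_prime_factor less.prems(1) by blast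
    then obtain a where a: "a \<in> A" "\<not> p dvd a" using A by (auto simp: no_common_prime_def)
    then have "p dvd x * a" using less.prems(2) p(2) dvd_trans by blast
    then have "p dvd x" using p(1) a(2) prime_elem_dvd_mult_iff by blast
    then obtain x' where x': "x = p * x'" by blast
    obtain y' where y': "y = p * y'" using p by blast
    have y0: "p \<noteq> 0" "y' \<noteq> 0" using y' less.prems(1) by auto
    have "tdeg y' < tdeg y" using y' y0 tdeg_mult[of p y'] p(1) mpol_dvd_1_iff[of p]
      by (auto simp: prime_elem_def)
    moreover have "y' dvd x' * a" if "a \<in> A" for a
    proof -
      have "p * y' dvd p * (x' * a)" using less.prems(2)[OF that] by (simp only: x' y' mult.assoc)
      then show ?thesis using y0 by simp
    qed
    ultimately have "y' dvd x'" using less.hyps y0 by blast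
    then show ?thesis using x' y' by simp
  qed
qed

section \<open>Noetherianity and Hilbert functions of ideals\<close>

section \<open>Ideals and their leading monomials\<close>

lemma ideal_mult: "is_ideal I \<Longrightarrow> p \<in> I \<Longrightarrow> r * p \<in> I"
  by (rule ring_mod.subspace_scale)

lemma cs_subspace_ideal:
  fixes I :: "('n, 'k::field) mpol set"
  assumes "is_ideal I" shows "cs.subspace I"
  unfolding cscale_def using assms
  by (intro cs.subspaceI[unfolded cscale_def])
     (auto intro: ring_mod.subspace_0 ring_mod.subspace_add ring_mod.subspace_scale)

lemma lm_single_mult:
  fixes p :: "('n::{finite, linorder}, 'k::field) mpol"
  assumes "p \<noteq> 0" shows "single s 1 * p \<noteq> 0" "lm (single s 1 * p) = s + lm p"
proof -
  have s: "(single s 1 :: ('n, 'k) mpol) \<noteq> 0"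
    by (metis lookup_single_eq lookup_zero zero_neq_one)
  then show "single s 1 * p \<noteq> 0" using assms by simp
  have "lm (single s 1 :: ('n, 'k) mpol) = s" by (rule lm_eqI) auto
  then show "lm (single s 1 * p) = s + lm p" using lm_mult[OF s assms] by simp
qed

lemma upclosed_lms:
  fixes I :: "('n::{finite, linorder}, 'k::field) mpol set"
  assumes "is_ideal I" shows "upclosed (lms I)"
  unfolding upclosed_def
proof (intro ballI allI)
  fix t s assume "t \<in> lms I"
  then obtain p where p: "p \<in> I" "p \<noteq> 0" "lm p = t" by (auto simp: lms_def)
  then have "single s 1 * p \<in> I - {0}" using lm_single_mult[OF p(2)] ideal_mult[OF assms] by auto
  then have "lm (single s 1 * p) \<in> lms I" unfolding lms_def by blast
  then show "t + s \<in> lms I" using lm_single_mult[OF p(2)] p(3) by (simp add: add.commute)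
qed

lemma lms_memE: "t \<in> lms V \<Longrightarrow> \<exists>p. p \<in> V \<and> p \<noteq> 0 \<and> lm p = t"
  unfolding lms_def by blast

text \<open>An element of I' shares its leading monomial with some element of I, and subtracting a
  multiple of the latter lowers it. This ends because only finitely many monomials lie below a given
  one, degrees being compared first.\<close>

lemma lms_eq_imp_eq:
  fixes I I' :: "('n::{finite, linorder}, 'k::field) mpol set"
  assumes I: "is_ideal I" "is_ideal I'" "I \<subseteq> I'" and eq: "lms I' \<subseteq> lms I"
  shows "I' = I"
proof -
  have "p \<in> I" if "p \<in> I'" for p
    using that
  proof (induction "card {s. s = lm p \<or> mless s (lm p)}" arbitrary: p rule: less_induct)
    case less
    show ?case
    proof (cases "p = 0")
      case True
      then show ?thesis using ring_mod.subspace_0[OF I(1)] by simp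
    next
      case False
      then have "lm p \<in> lms I" using less.prems eq by (auto simp: lms_def)
      then obtain b where b: "b \<in> I" "b \<noteq> 0" "lm b = lm p" by (metis lms_memE)
      define p' where "p' = p - cscale (lookup p (lm p) / lookup b (lm p)) b"
      have cb: "cscale c b \<in> I" for c using b(1) ideal_mult[OF I(1)] by (simp add: cscale_def)
      have "p' \<in> I"
      proof (cases "p' = 0")
        case True
        then show ?thesis using ring_mod.subspace_0[OF I(1)] by simp
      next
        case p'0: False
        have ml: "mless (lm p') (lm p)" using lm_diff_less[OF False b(2,3) p'_def p'0] .
        have "p' \<in> I'" unfolding p'_def
          using less.prems cb I(3) by (intro ring_mod.subspace_diff[OF I(2)]) auto
        moreover have "\<not> (lm p = lm p' \<or> mless (lm p) (lm p'))"
          using ml mless_trans[of "lm p" "lm p'" "lm p"] mless_irrefl[of "lm p"] by metis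
        moreover have "s = lm p' \<or> mless s (lm p') \<Longrightarrow> mless s (lm p)" for s
          using ml mless_trans by metis
        ultimately have "{s. s = lm p' \<or> mless s (lm p')} \<subset> {s. s = lm p \<or> mless s (lm p)}"
          by blast
        moreover have "finite {s. s = lm p \<or> mless s (lm p)}"
          by (rule finite_subset[OF _ finite_mon_deg_le[of "mon_deg (lm p)"]]) (auto simp: mless_def)
        ultimately show ?thesis using less.hyps[of p'] \<open>p' \<in> I'\<close> psubset_card_mono by blast
      qed
      then have "p' + cscale (lookup p (lm p) / lookup b (lm p)) b \<in> I"
        using cb by (intro ring_mod.subspace_add[OF I(1)])
      then show ?thesis by (simp add: p'_def)
    qed
  qed
  then show ?thesis using I(3) by blast
qed

text \<open>Noetherianity: in a strictly ascending chain of ideals the sets of leading monomials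
  would also grow strictly, yet they stabilise by Dickson's lemma.\<close>

lemma ideal_family_maximal:
  fixes \<F> :: "('n::{finite, linorder}, 'k::field) mpol set set"
  assumes "I0 \<in> \<F>" and id: "\<And>I. I \<in> \<F> \<Longrightarrow> is_ideal I"
  shows "\<exists>I\<in>\<F>. \<forall>I'\<in>\<F>. I \<subseteq> I' \<longrightarrow> I' = I"
proof (rule ccontr)
  assume n: "\<not> ?thesis"
  have "\<exists>f. \<forall>n. f n \<in> \<F> \<and> f n \<subset> f (Suc n)"
    by (rule dependent_nat_choice) (use assms(1) n in blast)+
  then obtain f where f: "\<And>n. f n \<in> \<F>" "\<And>n. f n \<subset> f (Suc n)" by blast
  have mono: "f i \<subseteq> f j" if "i \<le> j" for i j
    using that f(2) by (induction j rule: dec_induct) auto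
  obtain j0 where j0: "\<And>j. j \<ge> j0 \<Longrightarrow> lms (f j) = lms (f j0)"
    using upclosed_stable[of "\<lambda>j. lms (f j)"] upclosed_lms id f(1) lms_mono mono by metis
  have "f (Suc j0) = f j0"
    using lms_eq_imp_eq[of "f j0" "f (Suc j0)"] id f mono j0[of "Suc j0"] by simp
  then show False using f(2)[of j0] by simp
qed

section \<open>Hilbert functions\<close>

text \<open>Macaulay's count of the monomials that are not leading. For homogeneous I it is the
  Hilbert function of R/I; for an arbitrary ideal it is the jump at degree m in the filtration of
  R/I by degree.\<close>

definition HF :: "('n::{finite, linorder}, 'k::field) mpol set \<Rightarrow> nat \<Rightarrow> nat" where
  "HF I = mon_count (lms I) UNIV"

lemma HF_eq: "HF I m = card {t. t \<notin> lms I \<and> mon_deg t = m}"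
  by (simp add: HF_def mon_count_def)

lemma ev_poly_HF: "is_ideal I \<Longrightarrow> ev_poly (HF I)"
  unfolding HF_def by (intro ev_poly_mon_count upclosed_lms) auto

lemma HF_antimono: "I \<subseteq> I' \<Longrightarrow> HF I' m \<le> HF I m"
  unfolding HF_eq using lms_mono[of I I']
  by (intro card_mono finite_subset[OF _ finite_mon_deg_eq[of m]]) auto

text \<open>The degree is an integer: for negative m the set is empty, so shifted dimensions need no
  side condition.\<close>

definition ndim :: "'n::finite itself \<Rightarrow> int \<Rightarrow> nat" where
  "ndim _ m = card {t :: 'n \<Rightarrow>\<^sub>0 nat. int (mon_deg t) = m}"

lemma homog_keys: "homog m p \<Longrightarrow> keys p \<subseteq> {t. int (mon_deg t) = m}"
  by (auto simp: homog_def)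

lemma finite_int_deg: "finite {t :: 'n::finite \<Rightarrow>\<^sub>0 nat. int (mon_deg t) = m}"
  by (rule finite_subset[OF _ finite_mon_deg_eq[of "nat m"]]) auto

lemma subspace_homog:
  fixes I :: "('n::{finite, linorder}, 'k::field) mpol set"
  assumes "cs.subspace I" shows "cs.subspace {p \<in> I. homog m p}"
  using assms
  by (intro cs.subspaceI)
     (auto intro: cs.subspace_0 cs.subspace_add cs.subspace_scale homog_add homog_cscale)

lemma dim_homog:
  "cs.dim {p :: ('n::{finite, linorder}, 'k::field) mpol. homog m p} = ndim TYPE('n) m"
proof -
  have "lms {p :: ('n, 'k) mpol. homog m p} = {t. int (mon_deg t) = m}"
  proof (intro equalityI subsetI)
    fix t :: "'n \<Rightarrow>\<^sub>0 nat" assume t: "t \<in> {t. int (mon_deg t) = m}"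
    have "homog m (single t (1::'k))" using t by (simp add: homog_def)
    moreover have "single t (1::'k) \<noteq> 0" by (metis lookup_single_eq lookup_zero zero_neq_one)
    moreover have "lm (single t (1::'k)) = t" by (rule lm_eqI) auto
    ultimately show "t \<in> lms {p :: ('n, 'k) mpol. homog m p}"
      unfolding lms_def by (metis DiffI image_eqI mem_Collect_eq singletonD)
  qed (auto simp: lms_def homog_def dest: lm_in_keys)
  moreover have "cs.dim {p :: ('n, 'k) mpol. homog m p} = card (lms {p :: ('n, 'k) mpol. homog m p})"
    using subspace_homog[of UNIV m] homog_keys[of m] finite_int_deg[of m]
    by (intro dim_eq_card_lms[where F = "{t. int (mon_deg t) = m}"]) auto
  ultimately show ?thesis by (simp add: ndim_def)
qed

text \<open>The form of homogeneity used in computations; \<open>homog_ideal_hideal\<close> and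
  \<open>hideal_homog_ideal\<close> show that it agrees with the one by generators.\<close>

definition hideal :: "('n::finite, 'k::field) mpol set \<Rightarrow> bool" where
  "hideal I \<longleftrightarrow> is_ideal I \<and> (\<forall>p\<in>I. \<forall>m. hcomp m p \<in> I)"

lemma hideal_is_ideal: "hideal I \<Longrightarrow> is_ideal I" by (simp add: hideal_def)

lemma homog_ideal_hideal:
  fixes I :: "('n::finite, 'k::field) mpol set"
  assumes "homog_ideal I" shows "hideal I"
proof -
  obtain S where S: "\<And>g. g \<in> S \<Longrightarrow> \<exists>m. homog m g" "I = ideal_gen S"
    using assms by (auto simp: homog_ideal_def)
  have "\<forall>m. hcomp m p \<in> ideal_gen S" if "p \<in> ideal_gen S" for p
    using that
  proof (induction rule: ring_mod.span_induct_alt)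
    case base
    then show ?case by (simp add: ring_mod.span_zero)
  next
    case (step c g y)
    then obtain l where l: "homog l g" using S(1) by blast
    have "hcomp m (c * g + y) \<in> ideal_gen S" for m
      unfolding hcomp_add hcomp_mult[OF l]
      by (rule ring_mod.span_add[OF ring_mod.span_scale[OF ring_mod.span_base[OF step(1)]]])
        (use step in blast)
    then show ?case by blast
  qed
  then show ?thesis using S(2) by (simp add: hideal_def)
qed

lemma ideal_hcomps:
  assumes I: "is_ideal I" and "\<And>m. hcomp m p \<in> I" shows "p \<in> I"
proof -
  obtain D where "\<And>t. t \<in> keys p \<Longrightarrow> mon_deg t \<le> D" using ex_degree_bound[of "{p}"] by auto
  then have "(\<Sum>i\<le>D. hcomp (int i) p) = p" by (rule sum_hcomp)
  moreover have "(\<Sum>i\<le>D. hcomp (int i) p) \<in> I" using assms by (intro ring_mod.subspace_sum) auto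
  ultimately show ?thesis by simp
qed

lemma hideal_homog_ideal:
  fixes I :: "('n::finite, 'k::field) mpol set"
  assumes "hideal I" shows "homog_ideal I"
proof -
  let ?S = "{p \<in> I. \<exists>m. homog m p}"
  have "ideal_gen ?S \<subseteq> I"
    using assms by (intro ring_mod.span_minimal) (auto simp: hideal_def)
  moreover have "p \<in> ideal_gen ?S" if "p \<in> I" for p
  proof (rule ideal_hcomps)
    fix m show "hcomp m p \<in> ideal_gen ?S"
      using assms that homog_hcomp by (intro ring_mod.span_base) (auto simp: hideal_def)
  qed auto
  ultimately show ?thesis unfolding homog_ideal_def by (intro exI[of _ ?S]) auto
qed

lemma lms_homog:
  fixes I :: "('n::{finite, linorder}, 'k::field) mpol set"
  assumes "hideal I"
  shows "lms {p \<in> I. homog m p} = {t \<in> lms I. int (mon_deg t) = m}"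
proof (intro equalityI subsetI)
  fix t assume "t \<in> {t \<in> lms I. int (mon_deg t) = m}"
  then obtain p where p: "p \<in> I" "p \<noteq> 0" "lm p = t" "int (mon_deg t) = m" by (auto simp: lms_def)
  have k: "keys (hcomp m p) = keys p \<inter> {t. int (mon_deg t) = m}" by (simp add: hcomp_def keys_restrict)
  have "t \<in> keys (hcomp m p)" using lm_in_keys[OF p(2)] p k by auto
  moreover from this have "hcomp m p \<noteq> 0" by auto
  moreover have "lm (hcomp m p) = t"
    by (rule lm_eqI) (use calculation(1) k lm_max[OF p(2)] p(3) in auto)
  moreover have "hcomp m p \<in> I" using assms p by (simp add: hideal_def)
  ultimately show "t \<in> lms {p \<in> I. homog m p}" using homog_hcomp[of m p]
    unfolding lms_def by blast
qed (auto simp: lms_def homog_def dest: lm_in_keys)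

lemma dim_hideal_add_HF:
  fixes I :: "('n::{finite, linorder}, 'k::field) mpol set"
  assumes "hideal I"
  shows "cs.dim {p \<in> I. homog (int m) p} + HF I m = ndim TYPE('n) (int m)"
proof -
  have "cs.dim {p \<in> I. homog (int m) p} = card (lms {p \<in> I. homog (int m) p})"
    using subspace_homog[OF cs_subspace_ideal[OF hideal_is_ideal[OF assms]], of "int m"]
      homog_keys[of "int m"] finite_int_deg[of "int m"]
    by (intro dim_eq_card_lms[where F = "{t. int (mon_deg t) = int m}"]) blast+
  also have "\<dots> = card {t \<in> lms I. int (mon_deg t) = int m}" by (simp only: lms_homog[OF assms])
  finally have d: "cs.dim {p \<in> I. homog (int m) p} = card {t \<in> lms I. mon_deg t = m}" by simp
  have "{t. int (mon_deg t) = int m} = {t \<in> lms I. mon_deg t = m} \<union> {t. t \<notin> lms I \<and> mon_deg t = m}"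
    by auto
  moreover have "card ({t \<in> lms I. mon_deg t = m} \<union> {t. t \<notin> lms I \<and> mon_deg t = m}) =
      card {t \<in> lms I. mon_deg t = m} + card {t. t \<notin> lms I \<and> mon_deg t = m}"
    by (rule card_Un_disjoint) (auto intro: finite_subset[OF _ finite_mon_deg_eq[of m]])
  ultimately show ?thesis unfolding d HF_eq ndim_def by (simp only:)
qed

lemma hilb_fun_eq_HF:
  fixes I :: "('n::{finite, linorder}, 'k::field) mpol set"
  assumes "hideal I" shows "hilb_fun I m = HF I m"
  unfolding hilb_fun_def dim_homog using dim_hideal_add_HF[OF assms, of m] by simp

section \<open>Dimension counts for triples of polynomials\<close>

definition cscale3 :: "'k::field \<Rightarrow> ('n, 'k) poly3 \<Rightarrow> ('n, 'k) poly3" where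
  "cscale3 c = scale3 (single 0 c)"

lemma cscale3_simp [simp]: "cscale3 c (x, y, z) = (cscale c x, cscale c y, cscale c z)"
  by (simp add: cscale3_def scale3_def cscale_def)

interpretation cs3: Vector_Spaces.vector_space "cscale3 :: 'k::field \<Rightarrow> ('n, 'k) poly3 \<Rightarrow> _"
  by unfold_locales
    (auto simp: cs.scale_right_distrib cs.scale_left_distrib)

lemma cscale_mult: "cscale c p * q = cscale c (p * q)" "p * cscale c q = cscale c (p * q)"
  for p q :: "('n, 'k::field) mpol"
  by (simp_all add: cscale_def mult.assoc mult.left_commute)

lemmas rank_nullity33 = vector_space_pair.rank_nullity[OF vector_space_pair.intro[OF
    cs3.vector_space_axioms cs3.vector_space_axioms]]

lemmas rank_nullity31 = vector_space_pair.rank_nullity[OF vector_space_pair.intro[OF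
    cs3.vector_space_axioms cs.vector_space_axioms]]

lemmas rank_nullity13 = vector_space_pair.rank_nullity[OF vector_space_pair.intro[OF
    cs.vector_space_axioms cs3.vector_space_axioms]]

lemma dim_inj_image3:
  assumes h: "Vector_Spaces.linear cscale cscale3 h" and W: "cs.subspace W" "W \<subseteq> cs.span G" "finite G"
    and inj: "\<And>x. x \<in> W \<Longrightarrow> h x = 0 \<Longrightarrow> x = 0"
  shows "cs3.dim (h ` W) = cs.dim W"
proof -
  have "{x \<in> W. h x = 0} = {0}"
    using inj cs.subspace_0[OF W(1)] Vector_Spaces.linear.axioms h
    by (auto simp: module_hom.zero[OF Vector_Spaces.linear.axioms(3)[OF h]])
  moreover have "cs.dim {0} = 0" by (metis cs.dim_span cs.span_empty cs.dim_eq_card_independent cs.independent_empty card.empty)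
  ultimately show ?thesis using rank_nullity13[OF h W] by simp
qed

lemma linear3I:
  fixes f :: "('n, 'k::field) poly3 \<Rightarrow> ('n, 'k) poly3"
  assumes "\<And>x y. f (x + y) = f x + f y" "\<And>c x. f (cscale3 c x) = cscale3 c (f x)"
  shows "Vector_Spaces.linear cscale3 cscale3 f"
  using assms cs3.vector_space_axioms by (simp add: Vector_Spaces.linear_iff)

lemma linear31I:
  fixes f :: "('n, 'k::field) poly3 \<Rightarrow> ('n, 'k) mpol"
  assumes "\<And>x y. f (x + y) = f x + f y" "\<And>c x. f (cscale3 c x) = cscale c (f x)"
  shows "Vector_Spaces.linear cscale3 cscale f"
  using assms cs3.vector_space_axioms cs.vector_space_axioms by (simp add: Vector_Spaces.linear_iff)

lemma linear13I:
  fixes f :: "('n, 'k::field) mpol \<Rightarrow> ('n, 'k) poly3"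
  assumes "\<And>x y. f (x + y) = f x + f y" "\<And>c x. f (cscale c x) = cscale3 c (f x)"
  shows "Vector_Spaces.linear cscale cscale3 f"
  using assms cs3.vector_space_axioms cs.vector_space_axioms by (simp add: Vector_Spaces.linear_iff)

lemma finite_span_triples:
  fixes A B C :: "('n, 'k::field) mpol set"
  assumes "finite F" "\<And>p. p \<in> A \<union> B \<union> C \<Longrightarrow> keys p \<subseteq> F"
  shows "\<exists>G. finite G \<and> A \<times> B \<times> C \<subseteq> cs3.span G"
proof -
  obtain G where G: "finite G" "A \<union> B \<union> C \<subseteq> cs.span G"
    using finite_span_bounded[of F "A \<union> B \<union> C"] assms by blast
  let ?G = "(\<lambda>p. (p, 0, 0)) ` G \<union> (\<lambda>p. (0, p, 0)) ` G \<union> (\<lambda>p. (0, 0, p)) ` G"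
  have s: "(p, 0, 0) \<in> cs3.span ?G \<and> (0, p, 0) \<in> cs3.span ?G \<and> (0, 0, p) \<in> cs3.span ?G"
    if "p \<in> cs.span G" for p
    using that
  proof (induction rule: cs.span_induct_alt)
    case base
    have "(0, 0, 0) = (0 :: ('n, 'k) poly3)" by (simp add: zero_prod_def)
    then show ?case using cs3.span_zero[of ?G] by simp
  next
    case (step c x y)
    have g: "(x, 0, 0) \<in> ?G" "(0, x, 0) \<in> ?G" "(0, 0, x) \<in> ?G" using step(1) by auto
    have y: "(y, 0, 0) \<in> cs3.span ?G" "(0, y, 0) \<in> cs3.span ?G" "(0, 0, y) \<in> cs3.span ?G"
      using step by auto
    note sum = cs3.span_add[OF cs3.span_scale[OF cs3.span_base]]
    show ?case using sum[OF g(1) y(1), of c] sum[OF g(2) y(2), of c] sum[OF g(3) y(3), of c] by simp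
  qed
  have "(a, b, c) \<in> cs3.span ?G" if "a \<in> A" "b \<in> B" "c \<in> C" for a b c
  proof -
    have "(a, 0, 0) + (0, b, 0) + (0, 0, c) \<in> cs3.span ?G"
      using s G(2) that by (intro cs3.span_add) blast+
    then show ?thesis by simp
  qed
  then show ?thesis using G(1) by (intro exI[of _ ?G]) auto
qed

lemma dim_triples:
  fixes A B C :: "('n, 'k::field) mpol set"
  assumes F: "finite F" "\<And>p. p \<in> A \<union> B \<union> C \<Longrightarrow> keys p \<subseteq> F"
    and sub: "cs.subspace A" "cs.subspace B" "cs.subspace C"
  shows "cs3.dim (A \<times> B \<times> C) = cs.dim A + cs.dim B + cs.dim C"
proof -
  have fin: "\<exists>G. finite G \<and> A' \<times> B' \<times> C' \<subseteq> cs3.span G"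
    if "A' \<subseteq> insert 0 A" "B' \<subseteq> insert 0 B" "C' \<subseteq> insert 0 C" for A' B' C'
    by (rule finite_span_triples[OF F(1)]) (use F(2) that in fastforce)
  have sb: "cs3.subspace (A' \<times> B' \<times> C')" if "cs.subspace A'" "cs.subspace B'" "cs.subspace C'"
    for A' B' C' :: "('n, 'k) mpol set"
    using that by (intro cs3.subspaceI)
      (auto simp: zero_prod_def intro: cs.subspace_0 cs.subspace_add cs.subspace_scale)
  have z: "cs.subspace {0}" by (rule cs.subspace_single_0)
  have m: "0 \<in> A" "0 \<in> B" "0 \<in> C" using sub cs.subspace_0 by auto
  have l: "Vector_Spaces.linear cscale3 cscale (\<lambda>x. fst x :: ('n, 'k) mpol)"
      "Vector_Spaces.linear cscale3 cscale (\<lambda>x. fst (snd x) :: ('n, 'k) mpol)"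
    by (rule linear31I; auto)+
  obtain G where G: "finite G" "A \<times> B \<times> C \<subseteq> cs3.span G" using fin[of A B C] by blast
  have "{x \<in> A \<times> B \<times> C. fst x = 0} = {0} \<times> B \<times> C" "(\<lambda>x. fst x) ` (A \<times> B \<times> C) = A"
    using m by (auto simp: image_iff)
  with rank_nullity31[OF l(1) sb[OF sub] G(2,1)]
  have 1: "cs3.dim (A \<times> B \<times> C) = cs3.dim ({0} \<times> B \<times> C) + cs.dim A" by (simp only:)
  obtain G where G: "finite G" "{0} \<times> B \<times> C \<subseteq> cs3.span G" using fin[of "{0}" B C] by blast
  have "{x \<in> {0 :: ('n, 'k) mpol} \<times> B \<times> C. fst (snd x) = 0} = {0} \<times> {0} \<times> C"
      "(\<lambda>x. fst (snd x)) ` ({0 :: ('n, 'k) mpol} \<times> B \<times> C) = B"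
    using m by (auto simp: image_iff)
  with rank_nullity31[OF l(2) sb[OF z sub(2,3)] G(2,1)]
  have 2: "cs3.dim ({0} \<times> B \<times> C) = cs3.dim ({0} \<times> {0} \<times> C) + cs.dim B" by (simp only:)
  have "Vector_Spaces.linear cscale cscale3 (\<lambda>p. (0, 0, p) :: ('n, 'k) poly3)"
    by (rule linear13I) auto
  moreover obtain G where "finite G" "C \<subseteq> cs.span G"
    using finite_span_bounded[of F C] F by blast
  ultimately have "cs3.dim ((\<lambda>p. (0, 0, p)) ` C) = cs.dim C"
    using sub(3) by (intro dim_inj_image3[where G = G]) (auto simp: zero_prod_def)
  moreover have "(\<lambda>p. (0, 0, p) :: ('n, 'k) poly3) ` C = {0} \<times> {0} \<times> C" by auto
  ultimately show ?thesis using 1 2 by simp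
qed

lemma dim_direct_sum_le:
  fixes A B W :: "('n, 'k::field) mpol set"
  assumes F: "finite F" "\<And>p. p \<in> W \<Longrightarrow> keys p \<subseteq> F"
    and sub: "cs.subspace A" "cs.subspace B" "cs.subspace W"
    and AB: "A \<subseteq> W" "B \<subseteq> W" "A \<inter> B \<subseteq> {0}"
  shows "cs.dim A + cs.dim B \<le> cs.dim W"
proof -
  let ?f = "\<lambda>x. fst x + fst (snd x) :: ('n, 'k) mpol"
  \<comment> \<open>The third factor is a dummy that makes the lemmas on triples applicable to
    pairs.\<close>
  let ?V = "A \<times> B \<times> {0 :: ('n, 'k) mpol}"
  have z: "cs.subspace {0 :: ('n, 'k) mpol}" by (rule cs.subspace_single_0)
  have F': "keys p \<subseteq> F" if "p \<in> A \<union> B \<union> {0}" for p using F(2) that AB by fastforce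
  obtain G where G: "finite G" "?V \<subseteq> cs3.span G" using finite_span_triples[of F A B "{0}"] F(1) F' by blast
  have l: "Vector_Spaces.linear cscale3 cscale ?f"
    by (rule linear31I) (auto simp: cs.scale_right_distrib)
  have V: "cs3.subspace ?V"
    using sub by (intro cs3.subspaceI)
      (auto simp: zero_prod_def intro: cs.subspace_0 cs.subspace_add cs.subspace_scale)
  have d: "cs3.dim ?V = cs.dim A + cs.dim B"
  proof -
    have "cs.dim {0 :: ('n, 'k) mpol} = 0"
      by (metis cs.dim_span cs.span_empty cs.dim_eq_card_independent cs.independent_empty card.empty)
    then show ?thesis using dim_triples[OF F(1) F' sub(1,2) z] by simp
  qed
  have k: "{x \<in> ?V. ?f x = 0} = {0}"
  proof -
    have "a = 0 \<and> b = 0" if "a \<in> A" "b \<in> B" "a + b = 0" for a b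
    proof -
      have "a = - b" using that(3) by (simp add: eq_neg_iff_add_eq_0)
      then have "a \<in> A \<inter> B" using that cs.subspace_neg[OF sub(2)] by auto
      then show ?thesis using AB(3) that(3) by auto
    qed
    then show ?thesis using cs.subspace_0[OF sub(1)] cs.subspace_0[OF sub(2)] by (auto simp: zero_prod_def)
  qed
  have "cs3.dim {0 :: ('n, 'k) poly3} = 0"
    by (metis cs3.dim_span cs3.span_empty cs3.dim_eq_card_independent cs3.independent_empty card.empty)
  then have "cs3.dim ?V = cs.dim (?f ` ?V)"
    using rank_nullity31[OF l V G(2,1)] k by simp
  moreover obtain H where "finite H" "W \<subseteq> cs.span H" using finite_span_bounded[of F W] F by blast
  moreover have "?f ` ?V \<subseteq> W" using subsetD[OF AB(1)] subsetD[OF AB(2)]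
    by (auto intro!: cs.subspace_add[OF sub(3)])
  ultimately show ?thesis using d cs.dim_mono_finite[of "?f ` ?V" W H] by simp
qed

section \<open>Dimension as the growth rate of a Hilbert function\<close>

section \<open>Growth of polynomials\<close>

lemma rat_poly_ge_lead_coeff:
  fixes p :: "rat poly"
  assumes "lead_coeff p > 0"
  shows "\<exists>n. \<forall>x\<ge>n. poly p x \<ge> lead_coeff p"
  using assms
proof (induction p)
  case 0
  then show ?case by simp
next
  case (pCons a q)
  show ?case
  proof (cases "q = 0")
    case True
    then show ?thesis by auto
  next
    case False
    then have lq: "lead_coeff q > 0" using pCons.prems by simp
    then obtain n where n: "\<And>x. x \<ge> n \<Longrightarrow> poly q x \<ge> lead_coeff q" using pCons.IH by blast
    define c where "c = lead_coeff q"
    have c: "c > 0" using lq c_def by simp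
    have "poly (pCons a q) x \<ge> c" if x: "x \<ge> max n (1 + \<bar>a\<bar> / c)" for x
    proof -
      have "(1 + \<bar>a\<bar> / c) * c \<le> x * poly q x"
        using x n[of x] c by (intro mult_mono) (auto simp: c_def intro: order_trans[of 0 "1 + \<bar>a\<bar> / c"])
      moreover have "(1 + \<bar>a\<bar> / c) * c = c + \<bar>a\<bar>" using c by (simp add: distrib_right)
      ultimately show ?thesis by simp
    qed
    then show ?thesis using False c_def by (intro exI[of _ "max n (1 + \<bar>a\<bar> / c)"]) auto
  qed
qed

lemma rat_poly_eventually_pos:
  fixes p :: "rat poly"
  assumes "lead_coeff p > 0"
  shows "\<forall>\<^sub>F m in sequentially. poly p (of_nat m) > 0"
proof -
  obtain n where n: "\<And>x. x \<ge> n \<Longrightarrow> poly p x \<ge> lead_coeff p" using rat_poly_ge_lead_coeff[OF assms] by blast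
  obtain N :: nat where N: "n \<le> of_nat N" using real_arch_simple by blast
  have "poly p (of_nat m) > 0" if "m \<ge> N" for m
  proof -
    have "n \<le> of_nat m" using N that by (meson of_nat_le_iff order_trans)
    then show ?thesis using n assms by (meson less_le_trans)
  qed
  then show ?thesis unfolding eventually_sequentially by blast
qed

lemma eventually_nonneg_lead_coeff:
  fixes p :: "rat poly"
  assumes "\<forall>\<^sub>F m in sequentially. poly p (of_nat m) \<ge> 0"
  shows "lead_coeff p \<ge> 0"
proof (rule ccontr)
  assume "\<not> ?thesis"
  then have "lead_coeff (- p) > 0" by simp
  from eventually_conj[OF rat_poly_eventually_pos[OF this] assms]
  have "\<forall>\<^sub>F m in sequentially. False" by (rule eventually_mono) auto
  then show False by simp
qed

text \<open>Both claims follow from the leading coefficients of p and q - p being nonnegative.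
  Comparing at \<open>degree q\<close> keeps the second claim meaningful when p has smaller
  degree.\<close>

lemma eventually_le_degree_lead_coeff:
  fixes p q :: "rat poly"
  assumes "\<forall>\<^sub>F m in sequentially. 0 \<le> poly p (of_nat m) \<and> poly p (of_nat m) \<le> poly q (of_nat m)"
  shows "degree p \<le> degree q" "coeff p (degree q) \<le> lead_coeff q"
proof -
  have p: "lead_coeff p \<ge> 0"
    by (rule eventually_nonneg_lead_coeff) (use assms in \<open>auto elim: eventually_mono\<close>)
  have d: "lead_coeff (q - p) \<ge> 0"
    by (rule eventually_nonneg_lead_coeff) (use assms in \<open>auto elim: eventually_mono\<close>)
  show le: "degree p \<le> degree q"
  proof (rule ccontr)
    assume n: "\<not> ?thesis"
    then have "degree (q - p) = degree p" "lead_coeff (q - p) = - lead_coeff p"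
      using degree_add_eq_right[of q "- p"] by (auto simp: coeff_eq_0)
    then have "lead_coeff p = 0" using p d by simp
    then show False using n by simp
  qed
  show "coeff p (degree q) \<le> lead_coeff q"
  proof (cases "degree (q - p) = degree q")
    case True
    then show ?thesis using d by simp
  next
    case False
    have "degree (q - p) \<le> degree q" using le by (intro degree_diff_le) auto
    then have "coeff (q - p) (degree q) = 0" using False by (intro coeff_eq_0) simp
    then show ?thesis by simp
  qed
qed

lemma rat_poly_eq_eventually:
  fixes p q :: "rat poly"
  assumes "\<forall>\<^sub>F m in sequentially. poly p (of_nat m) = poly q (of_nat m)"
  shows "p = q"
proof -
  have "lead_coeff (p - q) \<ge> 0"
    by (rule eventually_nonneg_lead_coeff) (use assms in \<open>auto elim: eventually_mono\<close>)
  moreover have "lead_coeff (q - p) \<ge> 0"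
    by (rule eventually_nonneg_lead_coeff) (use assms in \<open>auto elim: eventually_mono\<close>)
  moreover have "q - p = - (p - q)" by simp
  ultimately have "lead_coeff (p - q) = 0" by (metis degree_minus coeff_minus neg_0_le_iff_le order_antisym)
  then have "p - q = 0" by (simp only: leading_coeff_0_iff)
  then show ?thesis by simp
qed

text \<open>The top term of the difference comes from the first derivative; all further Taylor terms
  have smaller degree.\<close>

lemma degree_pcompose_diff:
  fixes P :: "rat poly"
  assumes "degree P = Suc k"
  shows "degree (P - pcompose P [:- c, 1:]) \<le> k"
    and "coeff (P - pcompose P [:- c, 1:]) k = c * of_nat (Suc k) * lead_coeff P"
proof -
  obtain r where r: "pcompose P [:- c, 1:] =
      P + smult (- c) (pderiv P) + smult ((- c)^2 / 2) (pderiv (pderiv P)) + r"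
    and r0: "\<And>j. degree P < j + 3 \<Longrightarrow> coeff r j = 0"
    using taylor_shift[of P "- c"] by blast
  have z: "coeff P j = 0" if "j > Suc k" for j using that assms by (simp add: coeff_eq_0)
  have c: "coeff (P - pcompose P [:- c, 1:]) j =
      c * of_nat (Suc j) * coeff P (Suc j)" if "j \<ge> k" for j
    using r0[of j] z[of "Suc (Suc j)"] that assms unfolding r by (simp add: coeff_pderiv)
  show "degree (P - pcompose P [:- c, 1:]) \<le> k"
    by (rule degree_le) (use c z in auto)
  show "coeff (P - pcompose P [:- c, 1:]) k = c * of_nat (Suc k) * lead_coeff P"
    using c[of k] assms by simp
qed

lemma binomial_poly:
  "\<exists>B :: rat poly. degree B = s \<and> lead_coeff B = 1 / fact s \<and>
    (\<forall>m. of_nat ((m + s) choose m) = poly B (of_nat m))"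
proof -
  let ?f = "\<lambda>i. [:of_nat (s - i), 1:] :: rat poly"
  let ?B = "smult (1 / fact s) (\<Prod>i = 0..<s. ?f i)"
  have "poly ?B (of_nat m) = of_nat ((m + s) choose m)" for m
  proof -
    have "of_nat ((m + s) choose m) = (of_nat ((m + s) choose s) :: rat)"
      using binomial_symmetric[of m "m + s"] by simp
    also have "\<dots> = (of_nat (m + s) :: rat) gchoose s" by (rule binomial_gbinomial)
    also have "\<dots> = (\<Prod>i = 0..<s. of_nat (m + s) - of_nat i) / fact s" by (rule gbinomial_prod_rev)
    also have "(\<Prod>i = 0..<s. of_nat (m + s) - of_nat i :: rat) = (\<Prod>i = 0..<s. poly (?f i) (of_nat m))"
      by (intro prod.cong) (auto simp: of_nat_diff)
    finally show ?thesis by (simp add: poly_prod)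
  qed
  moreover have "degree (\<Prod>i = 0..<s. ?f i) = s"
    by (subst degree_prod_eq_sum_degree) auto
  moreover have "lead_coeff (\<Prod>i = 0..<s. ?f i) = 1" by (simp add: lead_coeff_prod)
  ultimately show ?thesis by (intro exI[of _ ?B]) auto
qed

section \<open>Dimension of ideals\<close>

text \<open>The affine Hilbert function: the dimension of the image in R/I of the polynomials of
  degree at most m, meaningful for ideals that are not homogeneous.\<close>

definition aHF :: "('n::{finite, linorder}, 'k::field) mpol set \<Rightarrow> nat \<Rightarrow> nat" where
  "aHF I m = (\<Sum>j\<le>m. HF I j)"

lemma card_deg_le_sum:
  fixes A :: "('n::finite \<Rightarrow>\<^sub>0 nat) set"
  shows "card {t \<in> A. mon_deg t \<le> m} = (\<Sum>j\<le>m. card {t \<in> A. mon_deg t = j})"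
proof -
  have "{t \<in> A. mon_deg t \<le> m} = (\<Union>j\<le>m. {t \<in> A. mon_deg t = j})" by auto
  moreover have "card (\<Union>j\<le>m. {t \<in> A. mon_deg t = j}) = (\<Sum>j\<le>m. card {t \<in> A. mon_deg t = j})"
    by (rule card_UN_disjoint) (auto intro: finite_subset[OF _ finite_mon_deg_eq])
  ultimately show ?thesis by simp
qed

lemma aHF_eq: "aHF I m = card {t \<in> - lms I. mon_deg t \<le> m}"
  unfolding card_deg_le_sum aHF_def HF_eq by simp

definition trunc :: "('n::finite, 'k::zero) mpol set \<Rightarrow> nat \<Rightarrow> ('n, 'k) mpol set" where
  "trunc I m = {p \<in> I. \<forall>t\<in>keys p. mon_deg t \<le> m}"

lemma subspace_keys:
  fixes I :: "('n, 'k::field) mpol set"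
  assumes "cs.subspace I" shows "cs.subspace {p \<in> I. \<forall>t\<in>keys p. P t}"
proof (rule cs.subspaceI)
  fix p q assume "p \<in> {p \<in> I. \<forall>t\<in>keys p. P t}" "q \<in> {p \<in> I. \<forall>t\<in>keys p. P t}"
  then show "p + q \<in> {p \<in> I. \<forall>t\<in>keys p. P t}"
    using cs.subspace_add[OF assms] keys_add[of p q] by blast
next
  fix c p assume "p \<in> {p \<in> I. \<forall>t\<in>keys p. P t}"
  then show "cscale c p \<in> {p \<in> I. \<forall>t\<in>keys p. P t}"
    using cs.subspace_scale[OF assms] by (auto simp: in_keys_iff)
qed (use cs.subspace_0[OF assms] in auto)

lemma subspace_trunc: "cs.subspace I \<Longrightarrow> cs.subspace (trunc I m)"
  unfolding trunc_def by (rule subspace_keys)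

lemma dim_trunc:
  fixes I :: "('n::{finite, linorder}, 'k::field) mpol set"
  assumes "cs.subspace I"
  shows "cs.dim (trunc I m) = card {t \<in> lms I. mon_deg t \<le> m}"
proof -
  have "lms (trunc I m) = {t \<in> lms I. mon_deg t \<le> m}"
  proof (intro equalityI subsetI)
    fix t assume t: "t \<in> {t \<in> lms I. mon_deg t \<le> m}"
    then obtain p where p: "p \<in> I" "p \<noteq> 0" "lm p = t" using lms_memE[of t I] by auto
    then have "p \<in> trunc I m"
      using t mon_deg_le_tdeg[of _ p] by (auto simp: trunc_def tdeg_def intro: order_trans)
    then show "t \<in> lms (trunc I m)" using p unfolding lms_def by blast
  next
    fix t assume "t \<in> lms (trunc I m)"
    then obtain p where "p \<in> trunc I m" "p \<noteq> 0" "lm p = t" using lms_memE[of t "trunc I m"] by auto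
    then show "t \<in> {t \<in> lms I. mon_deg t \<le> m}"
      using lm_in_keys[of p] unfolding lms_def trunc_def by blast
  qed
  moreover have "cs.dim (trunc I m) = card (lms (trunc I m))"
    by (rule dim_eq_card_lms[where F = "{t. mon_deg t \<le> m}"])
       (use subspace_trunc[OF assms] finite_mon_deg_le in \<open>auto simp: trunc_def\<close>)
  ultimately show ?thesis by simp
qed

lemma dim_keys_subset:
  fixes T :: "('n::{finite, linorder} \<Rightarrow>\<^sub>0 nat) set"
  assumes "finite T"
  shows "cs.dim {p :: ('n, 'k::field) mpol. keys p \<subseteq> T} = card T"
proof -
  have "lms {p :: ('n, 'k) mpol. keys p \<subseteq> T} = T"
  proof (intro equalityI subsetI)
    fix t assume t: "t \<in> T"
    have "(single t 1 :: ('n, 'k) mpol) \<noteq> 0" by (metis lookup_single_eq lookup_zero zero_neq_one)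
    moreover have "lm (single t 1 :: ('n, 'k) mpol) = t" by (rule lm_eqI) auto
    moreover have "(single t 1 :: ('n, 'k) mpol) \<in> {p. keys p \<subseteq> T}" using t by simp
    ultimately show "t \<in> lms {p :: ('n, 'k) mpol. keys p \<subseteq> T}"
      unfolding lms_def by (metis DiffI image_eqI singletonD)
  next
    fix t assume "t \<in> lms {p :: ('n, 'k) mpol. keys p \<subseteq> T}"
    then obtain p :: "('n, 'k) mpol" where "keys p \<subseteq> T" "p \<noteq> 0" "lm p = t"
      using lms_memE[of t "{p :: ('n, 'k) mpol. keys p \<subseteq> T}"] by auto
    then show "t \<in> T" using lm_in_keys[of p] by blast
  qed
  moreover have "cs.subspace {p :: ('n, 'k) mpol. keys p \<subseteq> T}"
    using subspace_keys[of UNIV "\<lambda>t. t \<in> T"] by (simp add: subset_eq)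
  then have "cs.dim {p :: ('n, 'k) mpol. keys p \<subseteq> T} = card (lms {p :: ('n, 'k) mpol. keys p \<subseteq> T})"
    by (rule dim_eq_card_lms[OF _ assms]) auto
  ultimately show ?thesis by (simp only:)
qed

lemma card_lms_add_aHF:
  "card {t \<in> lms I. mon_deg t \<le> m} + aHF I m = card {t :: 'n \<Rightarrow>\<^sub>0 nat. mon_deg t \<le> m}"
  for I :: "('n::{finite, linorder}, 'k::field) mpol set"
proof -
  have "card ({t \<in> lms I. mon_deg t \<le> m} \<union> {t \<in> - lms I. mon_deg t \<le> m}) =
      card {t \<in> lms I. mon_deg t \<le> m} + card {t \<in> - lms I. mon_deg t \<le> m}"
    by (rule card_Un_disjoint) (auto intro: finite_subset[OF _ finite_mon_deg_le[of m]])
  moreover have "{t \<in> lms I. mon_deg t \<le> m} \<union> {t \<in> - lms I. mon_deg t \<le> m} = {t. mon_deg t \<le> m}" by auto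
  ultimately show ?thesis unfolding aHF_eq by simp
qed

lemma aHF_antimono: "I \<subseteq> I' \<Longrightarrow> aHF I' m \<le> aHF I m"
  unfolding aHF_def by (intro sum_mono HF_antimono)

lemma ideal_UNIV_iff: "is_ideal I \<Longrightarrow> I = UNIV \<longleftrightarrow> 1 \<in> I"
  using ideal_mult[of I 1] by auto

lemma unit_in_ideal:
  assumes "is_ideal I" "p \<in> I" "p dvd 1" shows "I = UNIV"
proof -
  obtain i where "1 = p * i" using assms(3) by blast
  then have "1 \<in> I" using ideal_mult[OF assms(1,2), of i] by (simp add: mult.commute)
  then show ?thesis using ideal_UNIV_iff[OF assms(1)] by simp
qed

lemma aHF_pos:
  fixes I :: "('n::{finite, linorder}, 'k::field) mpol set"
  assumes "is_ideal I" "I \<noteq> UNIV" shows "aHF I m > 0"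
proof -
  have "0 \<notin> lms I"
  proof
    assume "0 \<in> lms I"
    then obtain p where p: "p \<in> I" "p \<noteq> 0" "lm p = 0" using lms_memE by blast
    then have "p dvd 1" using mpol_dvd_1_iff[of p] by (simp add: tdeg_def)
    then show False using unit_in_ideal assms p by blast
  qed
  then have "0 \<in> {t \<in> - lms I. mon_deg t \<le> m}" by simp
  moreover have "finite {t \<in> - lms I. mon_deg t \<le> m}"
    by (rule finite_subset[OF _ finite_mon_deg_le[of m]]) auto
  ultimately show ?thesis unfolding aHF_eq by (metis card_gt_0_iff emptyE)
qed

definition aHP :: "('n::{finite, linorder}, 'k::field) mpol set \<Rightarrow> rat poly" where
  "aHP I = (SOME P. \<forall>\<^sub>F m in sequentially. of_nat (aHF I m) = poly P (of_nat m))"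

lemma aHP:
  assumes "is_ideal I"
  shows "\<forall>\<^sub>F m in sequentially. of_nat (aHF I m) = poly (aHP I) (of_nat m)"
proof -
  have "ev_poly (aHF I)" unfolding aHF_def using ev_poly_partial_sums[OF ev_poly_HF[OF assms]] .
  then have "\<exists>P :: rat poly. \<forall>\<^sub>F m in sequentially. of_nat (aHF I m) = poly P (of_nat m)"
    by (simp add: ev_poly_def)
  then show ?thesis unfolding aHP_def by (rule someI_ex)
qed

text \<open>The growth rate of the affine Hilbert function, which for a proper ideal is the Krull
  dimension of R/I.\<close>

definition adim :: "('n::{finite, linorder}, 'k::field) mpol set \<Rightarrow> nat" where
  "adim I = degree (aHP I)"

lemma adim_antimono:
  assumes "is_ideal I" "is_ideal I'" "I \<subseteq> I'" shows "adim I' \<le> adim I"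
  unfolding adim_def
proof (rule eventually_le_degree_lead_coeff(1))
  from eventually_conj[OF aHP[OF assms(1)] aHP[OF assms(2)]]
  show "\<forall>\<^sub>F m in sequentially. 0 \<le> poly (aHP I') (of_nat m) \<and>
      poly (aHP I') (of_nat m) \<le> poly (aHP I) (of_nat m)"
  proof (rule eventually_mono)
    fix m assume *: "of_nat (aHF I m) = poly (aHP I) (of_nat m) \<and> of_nat (aHF I' m) = poly (aHP I') (of_nat m)"
    have "(of_nat (aHF I' m) :: rat) \<le> of_nat (aHF I m)" using aHF_antimono[OF assms(3)] by simp
    then show "0 \<le> poly (aHP I') (of_nat m) \<and> poly (aHP I') (of_nat m) \<le> poly (aHP I) (of_nat m)"
      using * by (metis of_nat_0_le_iff)
  qed
qed

lemma card_deg_le: "card {t :: 'n::finite \<Rightarrow>\<^sub>0 nat. mon_deg t \<le> m \<and> keys t \<subseteq> S} = (m + card S) choose m"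
proof -
  have "card {t \<in> {t :: 'n \<Rightarrow>\<^sub>0 nat. keys t \<subseteq> S}. mon_deg t \<le> m} = (\<Sum>j\<le>m. mon_count {} S j)"
    unfolding card_deg_le_sum by (simp add: mon_count_def)
  also have "\<dots> = (m + card S) choose m"
    using sum_choose_pred[where s = "card S"] by (simp add: mon_count_all)
  finally show ?thesis by (simp add: conj_commute)
qed

lemma adim_le_card:
  fixes I :: "('n::{finite, linorder}, 'k::field) mpol set"
  assumes "is_ideal I" shows "adim I \<le> CARD('n)"
proof -
  obtain B :: "rat poly" where B: "degree B = CARD('n)" "\<And>m. of_nat ((m + CARD('n)) choose m) = poly B (of_nat m)"
    using binomial_poly[of "CARD('n)"] by blast
  have "adim I \<le> degree B" unfolding adim_def
  proof (rule eventually_le_degree_lead_coeff(1), rule eventually_mono[OF aHP[OF assms]])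
    fix m assume *: "of_nat (aHF I m) = poly (aHP I) (of_nat m)"
    have "aHF I m \<le> card {t :: 'n \<Rightarrow>\<^sub>0 nat. mon_deg t \<le> m}"
      using card_lms_add_aHF[of I m] by simp
    also have "\<dots> = (m + CARD('n)) choose m" using card_deg_le[of m "UNIV :: 'n set"] by simp
    finally have "(of_nat (aHF I m) :: rat) \<le> poly B (of_nat m)" by (simp flip: B(2))
    then show "0 \<le> poly (aHP I) (of_nat m) \<and> poly (aHP I) (of_nat m) \<le> poly B (of_nat m)"
      using * by (metis of_nat_0_le_iff)
  qed
  then show ?thesis using B by simp
qed

text \<open>Polynomials in the variables S inject into R/I, and the number of their monomials up to
  degree m is a polynomial of degree \<open>card S\<close> in m.\<close>

lemma card_le_adim:
  fixes I :: "('n::{finite, linorder}, 'k::field) mpol set"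
  assumes I: "is_ideal I" and S: "I \<inter> Rs S \<subseteq> {0}" shows "card S \<le> adim I"
proof -
  obtain B :: "rat poly" where B: "degree B = card S" "\<And>m. of_nat ((m + card S) choose m) = poly B (of_nat m)"
    using binomial_poly[of "card S"] by blast
  have le: "(m + card S) choose m \<le> aHF I m" for m
  proof -
    let ?T = "{t :: 'n \<Rightarrow>\<^sub>0 nat. mon_deg t \<le> m \<and> keys t \<subseteq> S}"
    let ?V = "{p :: ('n, 'k) mpol. keys p \<subseteq> ?T}"
    have sI: "cs.subspace I" by (rule cs_subspace_ideal[OF I])
    have fT: "finite ?T" by (rule finite_subset[OF _ finite_mon_deg_le[of m]]) auto
    have sV: "cs.subspace ?V" using subspace_keys[of UNIV "\<lambda>t. t \<in> ?T"] by (simp add: subset_eq)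
    have "cs.dim (trunc I m) + cs.dim ?V \<le> cs.dim (trunc (UNIV :: ('n, 'k) mpol set) m)"
    proof (rule dim_direct_sum_le[OF finite_mon_deg_le[of m]])
      show "trunc I m \<inter> ?V \<subseteq> {0}" using S by (auto simp: trunc_def Rs_def)
    qed (use subspace_trunc[OF sI] sV subspace_trunc[of UNIV m] in \<open>auto simp: trunc_def\<close>)
    then have "card {t \<in> lms I. mon_deg t \<le> m} + card ?T \<le>
        card {t \<in> lms (UNIV :: ('n, 'k) mpol set). mon_deg t \<le> m}"
      using dim_trunc[OF sI] dim_trunc[of "UNIV :: ('n, 'k) mpol set" m] dim_keys_subset[OF fT, where 'k = 'k] by simp
    also have "\<dots> \<le> card {t :: 'n \<Rightarrow>\<^sub>0 nat. mon_deg t \<le> m}"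
      by (rule card_mono[OF finite_mon_deg_le]) auto
    finally show ?thesis using card_lms_add_aHF[of I m] card_deg_le[of m S] by simp
  qed
  have "degree B \<le> adim I" unfolding adim_def
  proof (rule eventually_le_degree_lead_coeff(1), rule eventually_mono[OF aHP[OF I]])
    fix m assume *: "of_nat (aHF I m) = poly (aHP I) (of_nat m)"
    have "of_nat ((m + card S) choose m) \<le> (of_nat (aHF I m) :: rat)" using le[of m] by simp
    then show "0 \<le> poly B (of_nat m) \<and> poly B (of_nat m) \<le> poly (aHP I) (of_nat m)"
      using * B(2) by (metis of_nat_0_le_iff)
  qed
  then show ?thesis using B by simp
qed

lemma prime_ideal_is_ideal: "is_prime_ideal P \<Longrightarrow> is_ideal P" by (simp add: is_prime_ideal_def)

text \<open>Pick q in Q' but not in Q, of degree c. Multiplication by q carries the span of the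
  monomials outside \<open>lms Q\<close> of degree at most m - c injectively into Q', and since Q is
  prime the image meets Q only in 0. Hence \<open>aHF Q' m\<close> is at most
  \<open>aHF Q m - aHF Q (m - c)\<close>, and taking this difference lowers the degree of the
  polynomial.\<close>

lemma adim_strict_antimono:
  fixes Q Q' :: "('n::{finite, linorder}, 'k::field) mpol set"
  assumes Q: "is_prime_ideal Q" and Q': "is_prime_ideal Q'" and lt: "Q \<subset> Q'"
  shows "adim Q' < adim Q"
proof -
  have iQ: "is_ideal Q" "is_ideal Q'" using Q Q' prime_ideal_is_ideal by auto
  note sQ = cs_subspace_ideal[OF iQ(1)] cs_subspace_ideal[OF iQ(2)]
  obtain q where q: "q \<in> Q'" "q \<notin> Q" using lt by blast
  have q0: "q \<noteq> 0" using q ring_mod.subspace_0[OF iQ(1)] by auto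
  define c where "c = tdeg q"
  have main: "aHF Q' m + aHF Q (m - c) \<le> aHF Q m" if m: "m \<ge> c" for m
  proof -
    let ?T = "{t \<in> - lms Q. mon_deg t \<le> m - c}"
    let ?C = "{p :: ('n, 'k) mpol. keys p \<subseteq> ?T}"
    let ?B = "(\<lambda>p. q * p) ` ?C"
    have fT: "finite ?T" by (rule finite_subset[OF _ finite_mon_deg_le[of "m - c"]]) auto
    have sC: "cs.subspace ?C" using subspace_keys[of UNIV "\<lambda>t. t \<in> ?T"] by (simp add: subset_eq)
    have lin: "Vector_Spaces.linear cscale cscale (\<lambda>p. q * p)"
      using cs.vector_space_axioms by (simp add: Vector_Spaces.linear_iff distrib_left cscale_mult)
    obtain G where G: "finite G" "?C \<subseteq> cs.span G" using finite_span_bounded[OF fT, of ?C] by blast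
    have "{p \<in> ?C. q * p = 0} = {0}" using q0 cs.subspace_0[OF sC] by auto
    moreover have "cs.dim {0 :: ('n, 'k) mpol} = 0"
      by (metis cs.dim_span cs.span_empty cs.dim_eq_card_independent cs.independent_empty card.empty)
    ultimately have dB: "cs.dim ?B = aHF Q (m - c)"
      using vector_space_pair.rank_nullity[OF vector_space_pair.intro[OF cs.vector_space_axioms
          cs.vector_space_axioms] lin sC G(2,1)] dim_keys_subset[OF fT, where 'k = 'k]
      by (simp add: aHF_eq)
    have sB: "cs.subspace ?B"
      by (rule module_hom.subspace_image[OF Vector_Spaces.linear.axioms(3)[OF lin] sC])
    have BW: "?B \<subseteq> trunc Q' m"
    proof
      fix x assume "x \<in> ?B"
      then obtain p where p: "x = q * p" "keys p \<subseteq> ?T" by auto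
      have "mon_deg t \<le> m" if "t \<in> keys x" for t
      proof -
        obtain u v where uv: "t = u + v" "u \<in> keys q" "v \<in> keys p" using \<open>t \<in> keys x\<close> p keys_mult[of q p] by blast
        then have "mon_deg u \<le> c" "mon_deg v \<le> m - c" using mon_deg_le_tdeg[of u q] p c_def by auto
        then show ?thesis using uv m by (simp add: mon_deg_add)
      qed
      moreover have "x \<in> Q'" using p ideal_mult[OF iQ(2) q(1), of p] by (simp add: mult.commute)
      ultimately show "x \<in> trunc Q' m" by (simp add: trunc_def)
    qed
    have "cs.dim (trunc Q m) + cs.dim ?B \<le> cs.dim (trunc Q' m)"
    proof (rule dim_direct_sum_le[OF finite_mon_deg_le[of m]])
      show "trunc Q m \<inter> ?B \<subseteq> {0}"
      proof
        fix x assume x: "x \<in> trunc Q m \<inter> ?B"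
        then obtain p where p: "x = q * p" "keys p \<subseteq> ?T" by auto
        then have "p \<in> Q" using x Q q(2) by (auto simp: trunc_def is_prime_ideal_def)
        \<comment> \<open>A nonzero p in Q would have its leading monomial in \<open>lms Q\<close>,
          while all its monomials avoid that set.\<close>
        have "p = 0"
        proof (rule ccontr)
          assume "p \<noteq> 0"
          then have "lm p \<in> lms Q" "lm p \<in> ?T" using \<open>p \<in> Q\<close> p lm_in_keys[of p] by (auto simp: lms_def)
          then show False by simp
        qed
        then show "x \<in> {0}" using p by simp
      qed
      show "trunc Q m \<subseteq> trunc Q' m" using lt by (auto simp: trunc_def)
    qed (use sB BW subspace_trunc[OF sQ(1)] subspace_trunc[OF sQ(2)] in \<open>auto simp: trunc_def\<close>)
    then show ?thesis
      using dB dim_trunc[OF sQ(1), of m] dim_trunc[OF sQ(2), of m]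
        card_lms_add_aHF[of Q m] card_lms_add_aHF[of Q' m] by simp
  qed
  define D where "D = aHP Q - pcompose (aHP Q) [:- of_nat c, 1:]"
  have ev: "\<forall>\<^sub>F m in sequentially. 1 \<le> poly (aHP Q') (of_nat m) \<and>
      poly (aHP Q') (of_nat m) \<le> poly D (of_nat m)"
  proof -
    have "\<forall>\<^sub>F m in sequentially. of_nat (aHF Q (m - c)) = poly (aHP Q) (of_nat (m - c))"
      using aHP[OF iQ(1)] sequentially_offset[of _ c] unfolding eventually_sequentially
      by (metis add.commute le_add_diff_inverse2 add_leE diff_add_inverse2 le_diff_conv2 nat_le_linear)
    with aHP[OF iQ(1)] aHP[OF iQ(2)] eventually_ge_at_top[of c]
    show ?thesis
    proof eventually_elim
      case (elim m)
      have "(of_nat (aHF Q' m) :: rat) + of_nat (aHF Q (m - c)) \<le> of_nat (aHF Q m)"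
        using main[OF elim(3)] by (metis of_nat_add of_nat_le_iff)
      moreover have "aHF Q' m > 0" using aHF_pos[OF iQ(2)] Q' by (simp add: is_prime_ideal_def)
      ultimately show ?case using elim
        by (simp add: D_def poly_pcompose of_nat_diff)
    qed
  qed
  have le: "degree (aHP Q') \<le> degree D"
    by (rule eventually_le_degree_lead_coeff(1)) (use ev in \<open>auto elim: eventually_mono\<close>)
  show ?thesis
  proof (cases "degree (aHP Q)")
    case 0
    \<comment> \<open>A constant \<open>aHP Q\<close> makes the bound D vanish, although
      \<open>aHF Q' m\<close> is at least 1 for the proper ideal Q'.\<close>
    then obtain a where "aHP Q = [:a:]" by (auto elim: degree_eq_zeroE)
    then have "D = 0" by (simp add: D_def)
    have "\<forall>\<^sub>F m in sequentially :: nat filter. False"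
      by (rule eventually_mono[OF ev]) (simp add: \<open>D = 0\<close>, linarith)
    then show ?thesis by simp
  next
    case (Suc k)
    then have "degree D \<le> k" unfolding D_def by (rule degree_pcompose_diff(1))
    then show ?thesis using le Suc by (simp add: adim_def)
  qed
qed

section \<open>Heights of primes and their relation to coprimality\<close>

section \<open>Height of prime ideals\<close>

lemma height_prime_leI:
  assumes "\<And>m C. (\<And>i. i \<le> m \<Longrightarrow> is_prime_ideal (C i)) \<Longrightarrow> (\<And>i. i < m \<Longrightarrow> C i \<subset> C (Suc i)) \<Longrightarrow>
    C m = P \<Longrightarrow> enat m \<le> h"
  shows "height_prime P \<le> h"
  unfolding height_prime_def by (rule Sup_least) (use assms in blast)

lemma height_prime_le:
  fixes P :: "('n::{finite, linorder}, 'k::field) mpol set"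
  assumes "is_prime_ideal P"
  shows "height_prime P \<le> enat (CARD('n) - adim P)"
proof (rule height_prime_leI)
  fix m C
  assume C: "\<And>i. i \<le> m \<Longrightarrow> is_prime_ideal (C i)" "\<And>i. i < m \<Longrightarrow> C i \<subset> C (Suc i)" "C m = P"
  have "adim (C i) + i \<le> adim (C 0)" if "i \<le> m" for i
    using that
  proof (induction i)
    case (Suc i)
    then have "adim (C (Suc i)) < adim (C i)" using C by (intro adim_strict_antimono) auto
    then show ?case using Suc by simp
  qed simp
  from this[of m] have "adim P + m \<le> adim (C 0)" using C by simp
  moreover have "adim (C 0) \<le> CARD('n)" using adim_le_card prime_ideal_is_ideal C(1)[of 0] by blast
  ultimately show "enat m \<le> enat (CARD('n) - adim P)" by simp
qed

lemma height_prime_geI: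
  assumes "\<And>i. i \<le> m \<Longrightarrow> is_prime_ideal (C i)" "\<And>i. i < m \<Longrightarrow> C i \<subset> C (Suc i)" "C m = P"
  shows "enat m \<le> height_prime P"
  unfolding height_prime_def by (rule Sup_upper) (use assms in blast)

text \<open>The ideal generated by the part of P that is free of x.\<close>

definition contract_var :: "'n \<Rightarrow> ('n, 'k::comm_monoid_add) mpol set \<Rightarrow> ('n, 'k) mpol set" where
  "contract_var x P = {p. \<forall>j. coeff (upoly x p) j \<in> P}"

lemma contract_var_subset:
  fixes P :: "('n::{finite, linorder}, 'k::field) mpol set"
  assumes "is_ideal P" shows "contract_var x P \<subseteq> P"
proof
  fix p assume p: "p \<in> contract_var x P"
  have "poly (upoly x p) (pvar x) \<in> P"
    unfolding poly_altdef
  proof (rule ring_mod.subspace_sum[OF assms])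
    fix i
    show "coeff (upoly x p) i * pvar x ^ i \<in> P"
      using p ideal_mult[OF assms, of "coeff (upoly x p) i" "pvar x ^ i"]
      by (simp add: contract_var_def mult.commute)
  qed
  then show "p \<in> P" by (simp add: poly_upoly)
qed

lemma contract_var_prime:
  fixes P :: "('n::{finite, linorder}, 'k::field) mpol set"
  assumes P: "is_prime_ideal P" shows "is_prime_ideal (contract_var x P)"
proof -
  have iP: "is_ideal P" using P by (rule prime_ideal_is_ideal)
  have "is_ideal (contract_var x P)"
  proof (rule ring_mod.subspaceI)
    show "0 \<in> contract_var x P" by (simp add: contract_var_def ring_mod.subspace_0[OF iP])
    fix p q assume "p \<in> contract_var x P" "q \<in> contract_var x P"
    then show "p + q \<in> contract_var x P"
      by (simp add: contract_var_def upoly_add ring_mod.subspace_add[OF iP])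
  next
    fix r p assume p: "p \<in> contract_var x P"
    have "coeff (upoly x (r * p)) j \<in> P" for j
      unfolding upoly_mult coeff_mult
      using p by (intro ring_mod.subspace_sum[OF iP] ideal_mult[OF iP]) (simp add: contract_var_def)
    then show "r * p \<in> contract_var x P" by (simp add: contract_var_def)
  qed
  moreover have "contract_var x P \<noteq> UNIV" using contract_var_subset[OF iP, of x] P unfolding is_prime_ideal_def by blast
  moreover have "a \<in> contract_var x P \<or> b \<in> contract_var x P" if "a * b \<in> contract_var x P" for a b
    using coeff_mult_in_ideal[OF iP, of "upoly x a" "upoly x b"] that P
    by (auto simp: contract_var_def upoly_mult is_prime_ideal_def)
  ultimately show ?thesis by (auto simp: is_prime_ideal_def)
qed

text \<open>Descend from P by contracting one variable of X at a time. A step is strict because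
  otherwise the witness q for x would have all its coefficients in the intersection of P with k[S],
  hence be 0. Witnesses for the remaining variables are free of x and survive the
  contraction.\<close>

lemma prime_chain:
  fixes P :: "('n::{finite, linorder}, 'k::field) mpol set"
  assumes "finite X" "X \<inter> S = {}" "is_prime_ideal P" "P \<inter> Rs S \<subseteq> {0}"
    "\<And>x. x \<in> X \<Longrightarrow> \<exists>q\<in>P \<inter> Rs (insert x S). q \<noteq> 0"
  shows "\<exists>C. (\<forall>i\<le>card X. is_prime_ideal (C i)) \<and> (\<forall>i<card X. C i \<subset> C (Suc i)) \<and> C (card X) = P"
  using assms
proof (induction X arbitrary: P rule: finite_induct)
  case empty
  then show ?case by (intro exI[of _ "\<lambda>_. P"]) auto
next
  case (insert x X)
  let ?P = "contract_var x P"
  have iP: "is_ideal P" using insert.prems(2) by (rule prime_ideal_is_ideal)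
  have sub: "?P \<subseteq> P" by (rule contract_var_subset[OF iP])
  have "\<exists>q\<in>?P \<inter> Rs (insert y S). q \<noteq> 0" if y: "y \<in> X" for y
  proof -
    obtain q where q: "q \<in> P" "q \<in> Rs (insert y S)" "q \<noteq> 0" using insert.prems(4)[of y] y by auto
    have "x \<notin> insert y S" using insert y by auto
    then have "degx x q = 0" using q(2) by (auto simp: Rs_iff)
    then have "upoly x q = [:q:]" by (rule upoly_const)
    then have "q \<in> ?P" using q(1) ring_mod.subspace_0[OF iP] by (auto simp: contract_var_def coeff_pCons split: nat.splits)
    then show ?thesis using q by blast
  qed
  moreover have "X \<inter> S = {}" "?P \<inter> Rs S \<subseteq> {0}" using insert.prems(1,3) sub by auto
  ultimately obtain C where C: "\<And>i. i \<le> card X \<Longrightarrow> is_prime_ideal (C i)" "\<And>i. i < card X \<Longrightarrow> C i \<subset> C (Suc i)"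
      "C (card X) = ?P"
    using insert.IH[of ?P, OF _ contract_var_prime[OF insert.prems(2)]] by metis
  have "?P \<noteq> P"
  proof
    assume eq: "?P = P"
    obtain q where q: "q \<in> P" "q \<in> Rs (insert x S)" "q \<noteq> 0" using insert.prems(4)[of x] by auto
    have "insert x S - {x} = S" using insert.prems(1) by auto
    then have "coeff (upoly x q) j \<in> P \<inter> Rs S" for j
      using Rs_coeff[OF q(2), of x j] q(1) eq by (auto simp: contract_var_def)
    then have "coeff (upoly x q) j = 0" for j using insert.prems(3) by blast
    then have "upoly x q = 0" by (intro poly_eqI) simp
    then show False using q(3) by simp
  qed
  then have lt: "?P \<subset> P" using sub by blast
  let ?C = "\<lambda>i. if i \<le> card X then C i else P"
  have "card (insert x X) = Suc (card X)" using insert by simp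
  moreover have "is_prime_ideal (?C i)" for i using C(1) insert.prems(2) by auto
  moreover have "?C i \<subset> ?C (Suc i)" if "i < Suc (card X)" for i
    using C(2)[of i] C(3) lt that by (cases "i = card X") auto
  ultimately show ?case by (intro exI[of _ ?C]) auto
qed

text \<open>The empty set of variables is independent, since a proper ideal contains no nonzero
  constant; with finitely many variables a maximal independent set exists.\<close>

lemma ex_maximal_independent_vars:
  fixes P :: "('n::{finite, linorder}, 'k::field) mpol set"
  assumes "is_prime_ideal P"
  shows "\<exists>S. P \<inter> Rs S \<subseteq> {0} \<and> (\<forall>x. x \<notin> S \<longrightarrow> (\<exists>q\<in>P \<inter> Rs (insert x S). q \<noteq> 0))"
proof -
  have iP: "is_ideal P" "P \<noteq> UNIV" using assms by (auto simp: is_prime_ideal_def)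
  let ?A = "{S. P \<inter> Rs S \<subseteq> {0}}"
  have "p = 0" if "p \<in> P \<inter> Rs {}" for p
  proof (rule ccontr)
    assume "p \<noteq> 0"
    moreover have "p = single 0 (lookup p 0)" using that by (intro Rs_empty) simp
    ultimately have "p dvd 1" using single_0_dvd_1[of "lookup p 0"] by (metis single_zero)
    then show False using unit_in_ideal[OF iP(1)] iP(2) that by blast
  qed
  then have ne: "{} \<in> ?A" by auto
  have "\<exists>S\<in>?A. \<forall>T\<in>?A. S \<le> T \<longrightarrow> S = T"
    by (rule finite_has_maximal) (use ne in \<open>simp, blast\<close>)
  then obtain S where S: "S \<in> ?A" and max: "\<forall>T\<in>?A. S \<le> T \<longrightarrow> S = T" by (rule bexE)
  have "\<exists>q\<in>P \<inter> Rs (insert x S). q \<noteq> 0" if "x \<notin> S" for x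
  proof (rule ccontr)
    assume "\<not> ?thesis"
    then have "insert x S \<in> ?A" by auto
    then have "S = insert x S" using max by (meson subset_insertI)
    then show False using that by blast
  qed
  then show ?thesis using S by blast
qed

text \<open>The upper bound is the strict drop of \<open>adim\<close> along chains. For the lower
  bound a maximal independent set S gives a chain with \<open>CARD('n) - card S\<close> steps, and
  \<open>card S\<close> is at most \<open>adim P\<close>.\<close>

lemma height_prime_eq:
  fixes P :: "('n::{finite, linorder}, 'k::field) mpol set"
  assumes P: "is_prime_ideal P"
  shows "height_prime P = enat (CARD('n) - adim P)"
proof (rule antisym[OF height_prime_le[OF P]])
  obtain S where S: "P \<inter> Rs S \<subseteq> {0}" "\<And>x. x \<notin> S \<Longrightarrow> \<exists>q\<in>P \<inter> Rs (insert x S). q \<noteq> 0"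
    using ex_maximal_independent_vars[OF P] by blast
  obtain C where C: "\<And>i. i \<le> card (- S) \<Longrightarrow> is_prime_ideal (C i)" "\<And>i. i < card (- S) \<Longrightarrow> C i \<subset> C (Suc i)"
      "C (card (- S)) = P"
    using prime_chain[of "- S" S P] S P by auto
  have "enat (card (- S)) \<le> height_prime P" by (rule height_prime_geI[of _ C]) (use C in auto)
  moreover have "card (- S) = CARD('n) - card S" by (simp add: Compl_eq_Diff_UNIV card_Diff_subset)
  moreover have "card S \<le> adim P" using card_le_adim[OF prime_ideal_is_ideal[OF P] S(1)] .
  ultimately show "enat (CARD('n) - adim P) \<le> height_prime P"
    by (metis diff_le_mono2 enat_ord_simps(1) order_trans)
qed

section \<open>Height and common factors\<close>

lemma height_le: "is_prime_ideal P \<Longrightarrow> I \<subseteq> P \<Longrightarrow> height I \<le> height_prime P"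
  unfolding height_def by (rule Inf_lower) blast

lemma height_geI:
  assumes "\<And>P. is_prime_ideal P \<Longrightarrow> I \<subseteq> P \<Longrightarrow> h \<le> height_prime P" shows "h \<le> height I"
  unfolding height_def by (rule Inf_greatest) (use assms in blast)

text \<open>The infimum is attained: if all primes over I had height at least 3, so would I.\<close>

lemma height_two_witness:
  assumes "height I = 2" obtains P where "is_prime_ideal P" "I \<subseteq> P" "height_prime P = 2"
proof -
  have "\<exists>P. is_prime_ideal P \<and> I \<subseteq> P \<and> \<not> 3 \<le> height_prime P"
  proof (rule ccontr)
    assume "\<not> ?thesis"
    then have "3 \<le> height I" by (intro height_geI) blast
    then show False using assms by simp
  qed
  then obtain P where P: "is_prime_ideal P" "I \<subseteq> P" "\<not> 3 \<le> height_prime P" by blast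
  have "2 \<le> height_prime P" using height_le[OF P(1,2)] assms by simp
  moreover have "height_prime P < 3" using P(3) by simp
  ultimately have "height_prime P = 2"
    by (cases "height_prime P") (auto simp: numeral_eq_enat)
  then show ?thesis using that P by blast
qed

lemma principal_prime_ideal:
  fixes p :: "'r::comm_ring_1"
  assumes "prime_elem p" shows "is_prime_ideal {h. p dvd h}"
proof -
  have "1 \<notin> {h. p dvd h}" using assms by (simp add: prime_elem_def)
  then have "{h. p dvd h} \<noteq> UNIV" by blast
  then show ?thesis using assms is_ideal_dvd[of p] by (simp add: is_prime_ideal_def prime_elem_dvd_mult_iff)
qed

text \<open>As p is not in Q, an element of Q is p times another element of Q; the degree cannot
  drop forever, so the element is 0.\<close>

lemma prime_ideal_below_principal:
  fixes p :: "('n::{finite, linorder}, 'k::field) mpol"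
  assumes p: "prime_elem p" and Q: "is_prime_ideal Q" "Q \<subset> {h. p dvd h}"
  shows "Q = {0}"
proof -
  have iQ: "is_ideal Q" using Q(1) by (rule prime_ideal_is_ideal)
  have pQ: "p \<notin> Q"
  proof
    assume "p \<in> Q"
    then have "h \<in> Q" if "p dvd h" for h
      using that ideal_mult[OF iQ, of p] by (auto simp: dvd_def mult.commute)
    then show False using Q(2) by blast
  qed
  have "h = 0" if "h \<in> Q" for h
    using that
  proof (induction "tdeg h" arbitrary: h rule: less_induct)
    case less
    show ?case
    proof (rule ccontr)
      assume h0: "h \<noteq> 0"
      obtain h' where h': "h = p * h'" using less.prems Q(2) by (auto simp: dvd_def)
      then have "h' \<in> Q" using less.prems pQ Q(1) by (auto simp: is_prime_ideal_def)
      moreover have "tdeg h' < tdeg h"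
        using h' h0 tdeg_mult[of p h'] p mpol_dvd_1_iff[of p] by (auto simp: prime_elem_def)
      ultimately have "h' = 0" using less.hyps by blast
      then show False using h' h0 by simp
    qed
  qed
  then show ?thesis using ring_mod.subspace_0[OF iQ] by blast
qed

lemma height_prime_principal:
  fixes p :: "('n::{finite, linorder}, 'k::field) mpol"
  assumes p: "prime_elem p"
  shows "height_prime {h. p dvd h} \<le> 1"
proof (rule height_prime_leI)
  fix m C
  assume C: "\<And>i. i \<le> m \<Longrightarrow> is_prime_ideal (C i)" "\<And>i. i < m \<Longrightarrow> C i \<subset> C (Suc i)" "C m = {h. p dvd h}"
  have "m \<le> 1"
  proof (rule ccontr)
    assume "\<not> m \<le> 1"
    then obtain l where l: "m = Suc (Suc l)" by (metis One_nat_def le_0_eq not0_implies_Suc not_less_eq_eq)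
    have "C (Suc l) = {0}"
      using prime_ideal_below_principal[OF p C(1)[of "Suc l"]] C(2)[of "Suc l"] C(3) l by simp
    then have "C l \<subset> {0}" using C(2)[of l] l by simp
    moreover have "0 \<in> C l" using C(1)[of l] l by (simp add: prime_ideal_is_ideal ring_mod.subspace_0)
    ultimately show False by blast
  qed
  then show "enat m \<le> 1" by (simp add: one_enat_def)
qed

lemma height_two_not_subset_principal:
  fixes p :: "('n::{finite, linorder}, 'k::field) mpol"
  assumes "height I = 2" "prime_elem p" shows "\<not> I \<subseteq> {h. p dvd h}"
proof
  assume "I \<subseteq> {h. p dvd h}"
  then have "height I \<le> 1"
    using height_le[OF principal_prime_ideal[OF assms(2)]] height_prime_principal[OF assms(2)] order_trans by blast
  then show False using assms(1) by simp
qed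

lemma height_two_no_common_prime:
  fixes A :: "('n::{finite, linorder}, 'k::field) mpol set"
  assumes "height (ideal_gen A) = 2" shows "no_common_prime A"
  unfolding no_common_prime_def
proof (intro allI impI, rule ccontr)
  fix p :: "('n, 'k) mpol" assume p: "prime_elem p" "\<not> (\<exists>a\<in>A. \<not> p dvd a)"
  then have "ideal_gen A \<subseteq> {h. p dvd h}" by (intro ring_mod.span_minimal is_ideal_dvd) blast
  then show False using height_two_not_subset_principal[OF assms p(1)] by blast
qed

text \<open>A variable is a nonzero nonunit. Since every prime divides 0, the existence of one shows
  that a coprime set has a nonzero element.\<close>

lemma ex_prime_elem: "\<exists>p :: ('n::{finite, linorder}, 'k::field) mpol. prime_elem p"
proof -
  fix x :: 'n
  have "lm (pvar x :: ('n, 'k) mpol) = single x 1" unfolding pvar_def by (rule lm_eqI) auto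
  then have "tdeg (pvar x :: ('n, 'k) mpol) = 1" by (simp add: tdeg_def)
  moreover have "(pvar x :: ('n, 'k) mpol) \<noteq> 0"
    unfolding pvar_def by (metis lookup_single_eq lookup_zero zero_neq_one)
  ultimately show ?thesis using ex_prime_factor[of "pvar x :: ('n, 'k) mpol"] mpol_dvd_1_iff[of "pvar x :: ('n, 'k) mpol"] by auto
qed

lemma no_common_prime_nonzero:
  fixes A :: "('n::{finite, linorder}, 'k::field) mpol set"
  assumes "no_common_prime A" shows "\<exists>a\<in>A. a \<noteq> 0"
  using ex_prime_elem[where 'n = 'n and 'k = 'k] assms unfolding no_common_prime_def by (metis dvd_0_right)

lemma prime_factor_in_prime_ideal:
  fixes a :: "('n::{finite, linorder}, 'k::field) mpol"
  assumes P: "is_prime_ideal P" and "a \<in> P" "a \<noteq> 0"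
  shows "\<exists>p\<in>P. prime_elem p"
  using assms(2,3)
proof (induction "tdeg a" arbitrary: a rule: less_induct)
  case less
  have "\<not> a dvd 1" using less.prems unit_in_ideal P unfolding is_prime_ideal_def by blast
  then obtain p where p: "prime_elem p" "p dvd a" using ex_prime_factor less.prems by blast
  then obtain b where b: "a = p * b" by blast
  then consider "p \<in> P" | "b \<in> P" using P less.prems(1) by (auto simp: is_prime_ideal_def)
  then show ?case
  proof cases
    case 2
    have b0: "b \<noteq> 0" "p \<noteq> 0" using b less.prems by auto
    then have "tdeg b < tdeg a"
      using b tdeg_mult[of p b] p mpol_dvd_1_iff[of p] by (auto simp: prime_elem_def)
    then show ?thesis using less.hyps[of b] 2 b0 by blast
  qed (use p in blast)
qed

text \<open>The chain is 0, (p), P: the prime ideal P contains a prime factor p of some nonzero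
  element of A, and some element of A is not divisible by p.\<close>

lemma height_prime_ge_2:
  fixes A :: "('n::{finite, linorder}, 'k::field) mpol set"
  assumes A: "no_common_prime A" "A \<subseteq> P" and P: "is_prime_ideal P"
  shows "2 \<le> height_prime P"
proof -
  obtain a where a: "a \<in> A" "a \<noteq> 0" using no_common_prime_nonzero[OF A(1)] by blast
  then obtain p where p: "p \<in> P" "prime_elem p" using prime_factor_in_prime_ideal[OF P] A(2) by blast
  obtain b where b: "b \<in> P" "\<not> p dvd b" using A p(2) unfolding no_common_prime_def by blast
  let ?p = "{h. p dvd h}"
  have sub: "?p \<subset> P"
  proof
    show "?p \<subseteq> P"
      using p(1) ideal_mult[OF prime_ideal_is_ideal[OF P], of p] by (auto simp: dvd_def mult.commute)
    show "?p \<noteq> P" using b by blast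
  qed
  have z: "is_prime_ideal {0 :: ('n, 'k) mpol}" by (simp add: is_prime_ideal_def ring_mod.subspace_single_0) (metis UNIV_I singletonD zero_neq_one)
  have pp: "is_prime_ideal ?p" by (rule principal_prime_ideal[OF p(2)])
  have "p \<noteq> 0" "p \<in> ?p" "0 \<in> ?p" using p(2) by simp_all
  then have zp: "{0} \<subset> ?p" by blast
  let ?C = "\<lambda>i :: nat. if i = 0 then {0} else if i = 1 then ?p else P"
  have "enat 2 \<le> height_prime P"
  proof (rule height_prime_geI[of _ ?C])
    fix i :: nat assume "i < 2"
    then have "i = 0 \<or> i = 1" by auto
    then show "?C i \<subset> ?C (Suc i)" using sub zp by auto
  qed (use z pp P in auto)
  then show ?thesis by (simp add: numeral_eq_enat)
qed

section \<open>The Bourbaki ideal of a coprime syzygy: construction, unmixedness, dimension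
  counts\<close>

section \<open>Cross products and the Bourbaki ideal\<close>

definition cross3 :: "'r::comm_ring_1 \<times> 'r \<times> 'r \<Rightarrow> 'r \<times> 'r \<times> 'r \<Rightarrow> 'r \<times> 'r \<times> 'r" where
  "cross3 = (\<lambda>(a1, a2, a3) (w1, w2, w3). (a2 * w3 - a3 * w2, a3 * w1 - a1 * w3, a1 * w2 - a2 * w1))"

lemma scale3_simp [simp]: "scale3 r (x, y, z) = (r * x, r * y, r * z)"
  by (simp add: scale3_def)

lemma cross3_simp [simp]: "cross3 (a1, a2, a3) (w1, w2, w3) =
    (a2 * w3 - a3 * w2, a3 * w1 - a1 * w3, a1 * w2 - a2 * w1)"
  by (simp add: cross3_def)

lemma cross3_add: "cross3 a (v + w) = cross3 a v + cross3 a w"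
  by (cases a; cases v; cases w) (simp add: algebra_simps)

lemma cross3_diff: "cross3 a (v - w) = cross3 a v - cross3 a w"
  by (cases a; cases v; cases w) (simp add: algebra_simps)

lemma cross3_scale: "cross3 a (scale3 r w) = scale3 r (cross3 a w)"
  by (cases a; cases w) (simp add: algebra_simps)

lemma cross3_self: "cross3 a (scale3 r a) = 0"
  by (cases a) (simp add: algebra_simps zero_prod_def)

lemma cross3_0 [simp]: "cross3 a 0 = 0"
  by (cases a) (simp add: zero_prod_def)

lemma scale3_cancel:
  fixes c :: "'r::idom"
  assumes "c \<noteq> 0" "scale3 c v = scale3 c w" shows "v = w"
  using assms by (cases v; cases w) simp

lemma scale3_cancel_right:
  fixes c :: "'r::idom"
  assumes "v \<noteq> 0" "scale3 c v = scale3 c' v" shows "c = c'"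
  using assms by (cases v) (auto simp: zero_prod_def)

definition dot3 :: "'r::comm_ring_1 \<times> 'r \<times> 'r \<Rightarrow> 'r \<times> 'r \<times> 'r \<Rightarrow> 'r" where
  "dot3 = (\<lambda>(a1, a2, a3) (w1, w2, w3). a1 * w1 + a2 * w2 + a3 * w3)"

lemma dot3_simp [simp]: "dot3 (a1, a2, a3) (w1, w2, w3) = a1 * w1 + a2 * w2 + a3 * w3"
  by (simp add: dot3_def)

lemma dot3_0 [simp]: "dot3 0 w = 0"
  by (cases w) (simp add: zero_prod_def)

lemma dot3_cross3: "dot3 w (cross3 a w) = 0"
  by (cases a; cases w) (simp add: algebra_simps)

lemma dot3_scale: "dot3 w (scale3 g f) = g * dot3 w f" "dot3 (scale3 g w) f = g * dot3 w f"
  by (cases f; cases w; simp add: algebra_simps)+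

lemma dot3_add: "dot3 (v + w) f = dot3 v f + dot3 w f"
  by (cases f; cases w; cases v) (simp add: algebra_simps)

lemma Syz_iff: "a \<in> Syz f1 f2 f3 \<longleftrightarrow> dot3 a (f1, f2, f3) = 0"
  by (cases a) (simp add: Syz_def)

text \<open>The double cross product \<open>(a \<times> w) \<times> f\<close> vanishes when \<open>f\<close> is orthogonal to \<open>a\<close> and \<open>w\<close>.\<close>

lemma cross3_orthogonal:
  fixes a1 :: "'r::comm_ring_1"
  assumes "dot3 (a1, a2, a3) (f1, f2, f3) = 0" "dot3 (w1, w2, w3) (f1, f2, f3) = 0"
    and u: "cross3 (a1, a2, a3) (w1, w2, w3) = (u1, u2, u3)"
  shows "u1 * f2 = u2 * f1" "u1 * f3 = u3 * f1" "u2 * f3 = u3 * f2"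
proof -
  let ?A = "a1 * f1 + a2 * f2 + a3 * f3" and ?W = "w1 * f1 + w2 * f2 + w3 * f3"
  have z: "?A = 0" "?W = 0" using assms by auto
  have u': "u1 = a2 * w3 - a3 * w2" "u2 = a3 * w1 - a1 * w3" "u3 = a1 * w2 - a2 * w1" using u by simp_all
  have "u1 * f2 - u2 * f1 = w3 * ?A - a3 * ?W" unfolding u' by (simp add: algebra_simps)
  then show "u1 * f2 = u2 * f1" unfolding z by simp
  have "u1 * f3 - u3 * f1 = a2 * ?W - w2 * ?A" unfolding u' by (simp add: algebra_simps)
  then show "u1 * f3 = u3 * f1" unfolding z by simp
  have "u2 * f3 - u3 * f2 = w1 * ?A - a1 * ?W" unfolding u' by (simp add: algebra_simps)
  then show "u2 * f3 = u3 * f2" unfolding z by simp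
qed

text \<open>If f1 is nonzero, it divides u1 times each of f1, f2, f3, hence u1, and the quotient
  also serves the other entries. Any of the three may vanish, which is why cases are needed.\<close>

lemma parallel_no_common_prime:
  fixes f1 f2 f3 :: "('n::{finite, linorder}, 'k::field) mpol"
  assumes f: "no_common_prime {f1, f2, f3}"
    and u: "u1 * f2 = u2 * f1" "u1 * f3 = u3 * f1" "u2 * f3 = u3 * f2"
  shows "\<exists>g. (u1, u2, u3) = scale3 g (f1, f2, f3)"
proof -
  have key: "\<exists>g. x = g * y \<and> (\<forall>v b. x * b = v * y \<longrightarrow> v = g * b)"
    if y: "y \<noteq> 0" and d: "\<And>a. a \<in> {f1, f2, f3} \<Longrightarrow> y dvd x * a" for x y
  proof -
    have "y dvd x" using no_common_prime_dvd[OF f y d] .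
    then obtain g where g: "x = g * y" by (metis dvd_def mult.commute)
    have "v = g * b" if "x * b = v * y" for v b
    proof -
      have "(g * b) * y = v * y" using that unfolding g by (simp only: mult_ac)
      then show ?thesis using y by simp
    qed
    then show ?thesis using g by blast
  qed
  obtain a where "a \<in> {f1, f2, f3}" "a \<noteq> 0" using no_common_prime_nonzero[OF f] by blast
  then consider "f1 \<noteq> 0" | "f2 \<noteq> 0" | "f3 \<noteq> 0" by blast
  then show ?thesis
  proof cases
    case 1
    have "f1 dvd u1 * a" if "a \<in> {f1, f2, f3}" for a using that u by auto
    from key[OF 1 this] obtain g where "u1 = g * f1" "u2 = g * f2" "u3 = g * f3" using u by blast
    then show ?thesis by (intro exI[of _ g]) simp
  next
    case 2
    have "f2 dvd u2 * a" if "a \<in> {f1, f2, f3}" for a using that u by (auto simp flip: u(1))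
    from key[OF 2 this] obtain g where "u1 = g * f1" "u2 = g * f2" "u3 = g * f3" using u by metis
    then show ?thesis by (intro exI[of _ g]) simp
  next
    case 3
    have "f3 dvd u3 * a" if "a \<in> {f1, f2, f3}" for a using that u by (auto simp flip: u(2,3))
    from key[OF 3 this] obtain g where "u1 = g * f1" "u2 = g * f2" "u3 = g * f3" using u by metis
    then show ?thesis by (intro exI[of _ g]) simp
  qed
qed

definition hcomp3 :: "int \<Rightarrow> ('n::finite, 'k::comm_monoid_add) poly3 \<Rightarrow> ('n, 'k) poly3" where
  "hcomp3 m = (\<lambda>(x, y, z). (hcomp m x, hcomp m y, hcomp m z))"

lemma hcomp3_simp [simp]: "hcomp3 m (x, y, z) = (hcomp m x, hcomp m y, hcomp m z)"
  by (simp add: hcomp3_def)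

lemma homog3_simp [simp]: "homog3 m (x, y, z) \<longleftrightarrow> homog m x \<and> homog m y \<and> homog m z"
  by (simp add: homog3_def)

lemma homog3_hcomp3: "homog3 m (hcomp3 m a)"
  by (cases a) (simp add: homog_hcomp)

lemma hcomp3_eqI:
  assumes "\<And>m. hcomp3 m a = hcomp3 m b" shows "a = b"
proof -
  obtain a1 a2 a3 b1 b2 b3 where ab: "a = (a1, a2, a3)" "b = (b1, b2, b3)" by (metis prod_cases3)
  have "hcomp m a1 = hcomp m b1 \<and> hcomp m a2 = hcomp m b2 \<and> hcomp m a3 = hcomp m b3" for m
    using assms[of m] unfolding ab by simp
  then show ?thesis unfolding ab using hcomp_eqI[of a1 b1] hcomp_eqI[of a2 b2] hcomp_eqI[of a3 b3] by blast
qed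

lemma hcomp3_homog3: "homog3 l a \<Longrightarrow> hcomp3 m a = (if l = m then a else 0)"
  by (cases a) (auto simp: hcomp_homog zero_prod_def)

lemma hcomp3_scale3:
  fixes a :: "('n::finite, 'k::field) poly3"
  assumes "homog3 l a" shows "hcomp3 m (scale3 r a) = scale3 (hcomp (m - l) r) a"
  using assms by (cases a) (simp add: hcomp_mult[where d = l])

lemma hcomp3_add: "hcomp3 m (a + b) = hcomp3 m a + hcomp3 m b"
  by (cases a; cases b) (simp add: hcomp_add)

lemma hcomp3_sum: "hcomp3 m (sum f A) = (\<Sum>a\<in>A. hcomp3 m (f a))"
  by (induction A rule: infinite_finite_induct) (auto simp: hcomp3_add zero_prod_def)

lemma hcomp3_cross3:
  fixes a w :: "('n::finite, 'k::field) poly3"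
  assumes "homog3 l a" shows "hcomp3 m (cross3 a w) = cross3 a (hcomp3 (m - l) w)"
  using assms by (cases a; cases w) (simp add: hcomp_diff hcomp_mult_left[where d = l])

lemma hcomp_dot3:
  fixes f w :: "('n::finite, 'k::field) poly3"
  assumes "homog3 l f" shows "hcomp m (dot3 w f) = dot3 (hcomp3 (m - l) w) f"
  using assms by (cases f; cases w) (simp add: hcomp_add hcomp_mult[where d = l])

text \<open>Coprimality of the entries of \<nu> is assumed instead of minimality of its degree: it
  is all that the construction of I uses. Minimality appears as an explicit hypothesis where
  generators are exchanged.\<close>

locale syzygy_pair =
  fixes f1 f2 f3 a1 a2 a3 :: "('n::{finite, linorder}, 'k::field) mpol" and d e :: nat
  assumes hf: "homog (int d) f1" "homog (int d) f2" "homog (int d) f3"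
    and cf: "no_common_prime {f1, f2, f3}"
    and syz: "(a1, a2, a3) \<in> Syz f1 f2 f3"
    and ha: "homog (int e) a1" "homog (int e) a2" "homog (int e) a3"
    and ca: "no_common_prime {a1, a2, a3}"
begin

abbreviation f where "f \<equiv> (f1, f2, f3)"
abbreviation \<nu> where "\<nu> \<equiv> (a1, a2, a3)"
abbreviation M where "M \<equiv> Syz f1 f2 f3"

text \<open>Here w ranges over all triples: for g \<noteq> 0 the relation makes w orthogonal to f,
  hence a syzygy, and for g = 0 one may take w = 0 (\<open>I_E\<close>).\<close>

definition I where "I = {g. \<exists>w. cross3 \<nu> w = scale3 g f}"

lemma hf3: "homog3 (int d) f" and ha3: "homog3 (int e) \<nu>" using hf ha by auto

lemma f_neq_0: "f \<noteq> 0" using no_common_prime_nonzero[OF cf] by (auto simp: zero_prod_def)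
lemma \<nu>_neq_0: "\<nu> \<noteq> 0" using no_common_prime_nonzero[OF ca] by (auto simp: zero_prod_def)

lemma M_0: "0 \<in> M" by (simp add: Syz_iff zero_prod_def)

lemma M_subspace: "mod3.subspace M"
  by (rule mod3.subspaceI) (auto simp: M_0 Syz_iff dot3_add dot3_scale)

lemma M_hcomp3: "w \<in> M \<Longrightarrow> hcomp3 m w \<in> M"
  using hcomp_dot3[OF hf3, of "m + int d" w] by (simp add: Syz_iff)

lemma I_E:
  assumes "g \<in> I" shows "\<exists>w\<in>M. cross3 \<nu> w = scale3 g f"
proof (cases "g = 0")
  case True
  then show ?thesis using M_0 by (intro bexI[of _ 0]) (simp_all add: zero_prod_def)
next
  case False
  obtain w where w: "cross3 \<nu> w = scale3 g f" using assms by (auto simp: I_def)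
  then have "g * dot3 w f = 0" using dot3_cross3[of w \<nu>] dot3_scale(1)[of w g f] by metis
  then have "w \<in> M" using False by (simp add: Syz_iff)
  then show ?thesis using w by blast
qed

lemma M_cross:
  assumes "w \<in> M" shows "\<exists>g. cross3 \<nu> w = scale3 g f"
proof -
  obtain w1 w2 w3 where w: "w = (w1, w2, w3)" by (metis prod_cases3)
  obtain u1 u2 u3 where u: "cross3 \<nu> w = (u1, u2, u3)" by (metis prod_cases3)
  have z: "dot3 \<nu> f = 0" "dot3 (w1, w2, w3) f = 0" using syz assms w Syz_iff by metis+
  show ?thesis
    using parallel_no_common_prime[OF cf cross3_orthogonal[OF z u[unfolded w]]] u by simp
qed

lemma cross_eq_0_iff: "cross3 \<nu> w = 0 \<longleftrightarrow> (\<exists>r. w = scale3 r \<nu>)"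
proof
  assume z: "cross3 \<nu> w = 0"
  obtain w1 w2 w3 where w: "w = (w1, w2, w3)" by (metis prod_cases3)
  have "w1 * a2 = w2 * a1" "w1 * a3 = w3 * a1" "w2 * a3 = w3 * a2"
    using z unfolding w by (auto simp: zero_prod_def mult.commute)
  then show "\<exists>r. w = scale3 r \<nu>" using parallel_no_common_prime[OF ca] w by blast
qed (auto simp: cross3_self simp del: cross3_simp scale3_simp)

lemma I_ideal: "is_ideal I"
proof (rule ring_mod.subspaceI)
  have "cross3 \<nu> 0 = scale3 0 f" by (simp add: zero_prod_def)
  then show "0 \<in> I" unfolding I_def by blast
next
  fix g h assume "g \<in> I" "h \<in> I"
  then obtain v w where "cross3 \<nu> v = scale3 g f" "cross3 \<nu> w = scale3 h f" by (auto simp: I_def)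
  then have "cross3 \<nu> (v + w) = scale3 (g + h) f" by (simp only: cross3_add mod3.scale_left_distrib)
  then show "g + h \<in> I" unfolding I_def by blast
next
  fix r g assume "g \<in> I"
  then obtain w where "cross3 \<nu> w = scale3 g f" by (auto simp: I_def)
  then have "cross3 \<nu> (scale3 r w) = scale3 (r * g) f" by (simp only: cross3_scale mod3.scale_scale)
  then show "r * g \<in> I" unfolding I_def by blast
qed

lemma cross3_hcomp:
  assumes "cross3 \<nu> w = scale3 g f"
  shows "cross3 \<nu> (hcomp3 (m + int d - int e) w) = scale3 (hcomp m g) f"
proof -
  have "hcomp3 (m + int d) (cross3 \<nu> w) = cross3 \<nu> (hcomp3 (m + int d - int e) w)"
    by (rule hcomp3_cross3[OF ha3])
  moreover have "hcomp3 (m + int d) (scale3 g f) = scale3 (hcomp m g) f"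
    using hcomp3_scale3[OF hf3, of "m + int d" g] by simp
  ultimately show ?thesis using assms by simp
qed

lemma I_hideal: "hideal I"
  unfolding hideal_def
proof (intro conjI ballI allI)
  fix g m assume "g \<in> I"
  then obtain w where "cross3 \<nu> w = scale3 g f" unfolding I_def by blast
  then have "cross3 \<nu> (hcomp3 (m + int d - int e) w) = scale3 (hcomp m g) f" by (rule cross3_hcomp)
  then show "hcomp m g \<in> I" unfolding I_def by blast
qed (rule I_ideal)

lemma a_in_I: "{a1, a2, a3} \<subseteq> I"
proof -
  have z: "a1 * f1 + a2 * f2 + a3 * f3 = 0" using syz by (simp add: Syz_def)
  have neg: "- q - r = p" if "p + q + r = 0" for p q r :: "'r::comm_ring_1"
  proof -
    have "p = - (q + r)"
      by (rule eq_neg_iff_add_eq_0[THEN iffD2]) (use that in \<open>simp add: add.assoc\<close>)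
    then show ?thesis by simp
  qed
  \<comment> \<open>The three test vectors are the cross products of g with the standard basis
    vectors.\<close>
  have g: "cross3 (b1, b2, b3) (0, g3, - g2) = scale3 b1 (g1, g2, g3)"
      "cross3 (b1, b2, b3) (- g3, 0, g1) = scale3 b2 (g1, g2, g3)"
      "cross3 (b1, b2, b3) (g2, - g1, 0) = scale3 b3 (g1, g2, g3)"
    if "b1 * g1 + b2 * g2 + b3 * g3 = 0" for b1 b2 b3 g1 g2 g3 :: "'r::comm_ring_1"
  proof -
    have "- (b2 * g2) - b3 * g3 = b1 * g1" "- (b3 * g3) - b1 * g1 = b2 * g2" "- (b1 * g1) - b2 * g2 = b3 * g3"
      using that by (intro neg; simp add: add_ac)+
    then show "cross3 (b1, b2, b3) (0, g3, - g2) = scale3 b1 (g1, g2, g3)"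
      "cross3 (b1, b2, b3) (- g3, 0, g1) = scale3 b2 (g1, g2, g3)"
      "cross3 (b1, b2, b3) (g2, - g1, 0) = scale3 b3 (g1, g2, g3)" by simp_all
  qed
  show ?thesis using g[OF z] unfolding I_def by blast
qed

lemma prime_over_I:
  assumes "is_prime_ideal P" "I \<subseteq> P"
  shows "2 \<le> height_prime P" "adim P + 2 \<le> CARD('n)"
proof -
  show "2 \<le> height_prime P" using height_prime_ge_2[OF ca _ assms(1)] a_in_I assms(2) by blast
  then show "adim P + 2 \<le> CARD('n)" using height_prime_eq[OF assms(1)] by (simp add: numeral_eq_enat)
qed

definition h where "h w = (THE g. cross3 \<nu> w = scale3 g f)"

lemma h_eqI: "cross3 \<nu> w = scale3 g f \<Longrightarrow> h w = g"
  unfolding h_def using scale3_cancel_right[OF f_neq_0] by (metis (mono_tags, lifting) the_equality)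

lemma h_cross: "w \<in> M \<Longrightarrow> cross3 \<nu> w = scale3 (h w) f"
  using M_cross h_eqI by metis

lemma quot_iso_I: "quot_iso_shift M \<nu> I"
  unfolding quot_iso_shift_def
\<comment> \<open>Origin of the shift: for w of degree m the vector \<nu> \<times> w has degree m +
  e, and it equals \<open>h w\<close> times forms of degree d.\<close>
proof (intro exI[of _ h] exI[of _ "int e - int d"] conjI ballI allI impI)
  fix a b assume "a \<in> M" "b \<in> M"
  then show "h (a + b) = h a + h b"
    by (intro h_eqI) (simp only: cross3_add h_cross mod3.scale_left_distrib)
next
  fix r a assume "a \<in> M"
  then show "h (scale3 r a) = r * h a"
    by (intro h_eqI) (simp only: cross3_scale h_cross mod3.scale_scale)
next
  fix m a assume a: "a \<in> M" "homog3 m a"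
  let ?m = "m + (int e - int d)"
  have "cross3 \<nu> (hcomp3 (?m + int d - int e) a) = scale3 (hcomp ?m (h a)) f"
    by (rule cross3_hcomp[OF h_cross[OF a(1)]])
  moreover have "hcomp3 (?m + int d - int e) a = a" using hcomp3_homog3[OF a(2), of m] by simp
  ultimately have "h a = hcomp ?m (h a)" using h_eqI by metis
  then show "homog ?m (h a)" using homog_hcomp[of ?m "h a"] by simp
next
  show "h ` M = I"
  proof (intro equalityI subsetI)
    fix g assume "g \<in> h ` M"
    then show "g \<in> I" unfolding I_def using h_cross by blast
  next
    fix g assume "g \<in> I"
    then show "g \<in> h ` M" using I_E h_eqI by (metis image_eqI)
  qed
next
  show "{a \<in> M. h a = 0} = mod3.span {\<nu>}"
  proof (intro equalityI subsetI)
    fix a assume a: "a \<in> {a \<in> M. h a = 0}"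
    then have "cross3 \<nu> a = 0" using h_cross[of a] by (simp add: zero_prod_def del: cross3_simp)
    then show "a \<in> mod3.span {\<nu>}" using cross_eq_0_iff unfolding mod3.span_singleton by blast
  next
    fix a assume "a \<in> mod3.span {\<nu>}"
    then obtain r where r: "a = scale3 r \<nu>" unfolding mod3.span_singleton by blast
    then have "a \<in> M" using syz by (simp only: Syz_iff dot3_scale mult_zero_right)
    moreover have "cross3 \<nu> a = scale3 0 f"
      unfolding r cross3_self by (simp add: zero_prod_def)
    ultimately show "a \<in> {a \<in> M. h a = 0}" using h_eqI[of a 0] by simp
  qed
qed

end

section \<open>Unmixedness of the Bourbaki ideal\<close>

text \<open>Over the fraction field of k[S], p involves x alone and q does not involve x, so they
  share no factor. Concretely, if r is the pseudo-remainder of A by p, then q r is a multiple of p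
  of smaller degree in x, hence 0.\<close>

lemma dvd_up_to_multiplier:
  fixes p q A B :: "('n::{finite, linorder}, 'k::field) mpol"
  assumes p: "p \<in> Rs (insert x S)" "p \<noteq> 0" and x: "x \<notin> S"
    and q: "degx x q = 0" "q \<noteq> 0" and eq: "q * A = p * B"
  shows "\<exists>c u. c \<in> Rs S \<and> c \<noteq> 0 \<and> c * A = p * u"
proof -
  have ins: "insert x S - {x} = S" using x by auto
  let ?c = "lcx x p"
  have c: "?c \<in> Rs S" "?c \<noteq> 0" using Rs_lcx[OF p(1), of x] ins lcx_neq_0[OF p(2)] by auto
  obtain N u r where r: "?c ^ N * A = p * u + r" "r = 0 \<or> degx x r < degx x p"
    using pseudo_division[OF p(2), of x A] by blast
  have "r = 0"
  proof (rule ccontr)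
    assume r0: "r \<noteq> 0"
    have "q * r = ?c ^ N * (q * A) - p * (q * u)"
    proof -
      have "q * r = q * (?c ^ N * A - p * u)" using r(1) by simp
      then show ?thesis by (simp only: right_diff_distrib mult_ac)
    qed
    also have "\<dots> = p * (?c ^ N * B - q * u)" unfolding eq by (simp only: right_diff_distrib mult_ac)
    finally have e: "q * r = p * (?c ^ N * B - q * u)" .
    then have "?c ^ N * B - q * u \<noteq> 0" using q r0 by auto
    then have "degx x (p * (?c ^ N * B - q * u)) \<ge> degx x p" using p degx_mult[of p _ x] by simp
    moreover have "degx x (q * r) = degx x r" using q r0 by (simp add: degx_mult)
    ultimately show False using r r0 e by simp
  qed
  then show ?thesis using r(1) c by (intro exI[of _ "?c ^ N"] exI[of _ u]) (auto intro: Rs_power)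
qed

text \<open>
  Pseudo-division makes the degrees of \<open>r\<close> in \<open>x\<^sub>1\<close> and \<open>x\<^sub>2\<close> smaller than those of \<open>p\<^sub>1\<close> and \<open>p\<^sub>2\<close>;
  since \<open>p\<^sub>3\<close> involves neither variable, comparing degrees then gives \<open>r = 0\<close>.
\<close>

lemma regular_up_to_multiplier:
  fixes p1 p2 p3 :: "('n::{finite, linorder}, 'k::field) mpol"
  assumes p: "p1 \<in> Rs (insert x1 S)" "p2 \<in> Rs (insert x2 S)" "p3 \<in> Rs (insert x3 S)"
      "p1 \<noteq> 0" "p2 \<noteq> 0" "p3 \<noteq> 0"
    and x: "x1 \<notin> S" "x2 \<notin> S" "x3 \<notin> S" "x1 \<noteq> x2" "x1 \<noteq> x3" "x2 \<noteq> x3"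
    and eq: "p3 * r = p1 * A + p2 * B"
  shows "\<exists>c u v. c \<in> Rs S \<and> c \<noteq> 0 \<and> c * r = p1 * u + p2 * v"
proof -
  have ins: "insert x1 S - {x1} = S" "insert x2 S - {x2} = S" using x by auto
  let ?c1 = "lcx x1 p1" and ?c2 = "lcx x2 p2"
  have c: "?c1 \<in> Rs S" "?c1 \<noteq> 0" "?c2 \<in> Rs S" "?c2 \<noteq> 0"
    by (rule Rs_lcx[OF p(1), of x1, unfolded ins] lcx_neq_0[OF p(4)]
        Rs_lcx[OF p(2), of x2, unfolded ins] lcx_neq_0[OF p(5)])+
  have cp: "?c1 ^ N \<in> Rs S" "?c1 ^ N \<noteq> 0" "?c2 ^ N \<in> Rs S" "?c2 ^ N \<noteq> 0" for N
    using c by (auto intro: Rs_power)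
  have deg0: "degx x2 p1 = 0" "degx x1 p2 = 0" "degx x1 p3 = 0" "degx x2 p3 = 0"
    using p x by (auto simp: Rs_iff)
  have degS: "degx x1 b = 0" "degx x2 b = 0" if "b \<in> Rs S" for b :: "('n, 'k) mpol"
    using that x by (auto simp: Rs_iff)
  obtain N1 u1 s where s: "?c1 ^ N1 * r = p1 * u1 + s" "s = 0 \<or> degx x1 s < degx x1 p1"
    using pseudo_division[OF p(4), of x1 r] by blast
  show ?thesis
  proof (cases "s = 0")
    case True
    then show ?thesis using s(1) cp(1,2)[of N1] by (intro exI[of _ "?c1 ^ N1"] exI[of _ u1] exI[of _ 0]) simp
  next
    case s0: False
    obtain N2 u2 t where t: "?c2 ^ N2 * s = p2 * u2 + t" "t = 0 \<or> degx x2 t < degx x2 p2"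
        "degx x1 t \<le> degx x1 s"
      using pseudo_division[OF p(5), of x2 s] deg0(2) x(4) by blast
    define b1 b2 where "b1 = ?c1 ^ N1" and "b2 = ?c2 ^ N2"
    have b: "b1 \<in> Rs S" "b1 \<noteq> 0" "b2 \<in> Rs S" "b2 \<noteq> 0" using cp by (auto simp: b1_def b2_def)
    have red: "(b2 * b1) * r = p1 * (b2 * u1) + p2 * u2 + t"
    proof -
      have "(b2 * b1) * r = b2 * (p1 * u1 + s)" using s(1) by (simp only: b1_def b2_def mult.assoc)
      also have "\<dots> = p1 * (b2 * u1) + b2 * s" by (simp only: distrib_left mult_ac)
      also have "b2 * s = p2 * u2 + t" using t(1) by (simp only: b2_def)
      finally show ?thesis by (simp only: add.assoc)
    qed
    have "t = 0"
    proof (rule ccontr)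
      assume t0: "t \<noteq> 0"
      have lt1: "degx x1 t < degx x1 p1" using s(2) t(3) s0 by simp
      have lt2: "degx x2 t < degx x2 p2" using t t0 by simp
      \<comment> \<open>Inserting the reduction of r into \<open>eq\<close> gives a relation of the
        same kind for t, whose degrees in x1 and x2 are both small.\<close>
      define A1 B1 where "A1 = (b2 * b1) * A - p3 * (b2 * u1)" and "B1 = (b2 * b1) * B - p3 * u2"
      have e1: "p3 * t = p1 * A1 + p2 * B1"
      proof -
        have "p3 * t = p3 * ((b2 * b1) * r - p1 * (b2 * u1) - p2 * u2)" unfolding red by simp
        also have "\<dots> = (b2 * b1) * (p3 * r) - p1 * (p3 * (b2 * u1)) - p2 * (p3 * u2)"
          by (simp only: right_diff_distrib mult_ac)
        also have "\<dots> = (b2 * b1) * (p1 * A + p2 * B) - p1 * (p3 * (b2 * u1)) - p2 * (p3 * u2)"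
          unfolding eq ..
        also have "\<dots> = p1 * A1 + p2 * B1"
          unfolding A1_def B1_def by (simp add: right_diff_distrib distrib_left mult_ac)
        finally show ?thesis .
      qed
      obtain N3 v A2 where A2: "?c2 ^ N3 * A1 = p2 * v + A2" "A2 = 0 \<or> degx x2 A2 < degx x2 p2"
        using pseudo_division[OF p(5), of x2 A1] by blast
      \<comment> \<open>Multiples of p2 are moved from the coefficient of p1 to that of p2, so that
        the former is reduced in x2. Comparing degrees in x2 then kills B2, and comparing degrees in
        x1 gives the contradiction.\<close>
      define b3 B2 where "b3 = ?c2 ^ N3" and "B2 = p1 * v + b3 * B1"
      have b3: "b3 \<in> Rs S" "b3 \<noteq> 0" using cp by (auto simp: b3_def)
      have e2: "b3 * (p3 * t) = p1 * A2 + p2 * B2"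
      proof -
        have "b3 * (p3 * t) = p1 * (b3 * A1) + p2 * (b3 * B1)"
          unfolding e1 by (simp only: distrib_left mult_ac)
        also have "b3 * A1 = p2 * v + A2" using A2(1) by (simp only: b3_def)
        finally show ?thesis unfolding B2_def by (simp only: distrib_left mult_ac add_ac)
      qed
      have d2: "degx x2 (b3 * (p3 * t)) < degx x2 p2"
        using lt2 degS(2)[OF b3(1)] b3(2) deg0 p(6) t0 by (simp add: degx_mult)
      have "B2 = 0"
      proof (rule ccontr)
        assume "B2 \<noteq> 0"
        then have ge: "degx x2 (p2 * B2) \<ge> degx x2 p2" using p(5) by (simp add: degx_mult)
        have d3: "degx x2 (p1 * A2) < degx x2 p2"
          using A2(2) lt2 deg0(1) p(4) by (cases "A2 = 0") (auto simp: degx_mult)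
        define D where "D = max (degx x2 (b3 * (p3 * t))) (degx x2 (p1 * A2))"
        have "p2 * B2 = b3 * (p3 * t) - p1 * A2" unfolding e2 by simp
        then have "degx x2 (p2 * B2) \<le> D"
          using degx_diff_le[of x2 "b3 * (p3 * t)" D "p1 * A2"] by (simp add: D_def)
        then show False using ge d2 d3 by (simp add: D_def)
      qed
      then have e3: "b3 * (p3 * t) = p1 * A2" using e2 by simp
      then have "A2 \<noteq> 0" using b3 p(6) t0 by auto
      then have "degx x1 (p1 * A2) \<ge> degx x1 p1" using p(4) by (simp add: degx_mult)
      moreover have "degx x1 (b3 * (p3 * t)) = degx x1 t"
        using degS(1)[OF b3(1)] b3(2) deg0(3) p(6) t0 by (simp add: degx_mult)
      ultimately show False using e3 lt1 by simp
    qed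
    then have "(b2 * b1) * r = p1 * (b2 * u1) + p2 * u2" using red by simp
    moreover have "b2 * b1 \<in> Rs S" "b2 * b1 \<noteq> 0" using b by (auto intro: Rs_mult)
    ultimately show ?thesis by blast
  qed
qed

lemma ex_three_distinct:
  assumes "finite A" "3 \<le> card A" shows "\<exists>x y z. x \<in> A \<and> y \<in> A \<and> z \<in> A \<and> x \<noteq> y \<and> x \<noteq> z \<and> y \<noteq> z"
proof -
  obtain B where "B \<subseteq> A" "card B = 3" using assms obtain_subset_with_card_n by metis
  then show ?thesis unfolding card_3_iff by blast
qed

lemma scale3_mult: "scale3 a (scale3 b w) = scale3 (a * b) w"
  by (cases w) (simp add: mult.assoc)

text \<open>Two consecutive Koszul differentials compose to zero. This yields the linear relation
  between the three obstructions to gluing lifts.\<close>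

lemma koszul_combination:
  fixes p1 p2 p3 :: "'r::comm_ring_1"
  shows "scale3 p3 (scale3 p2 w1 - scale3 p1 w2) - scale3 p2 (scale3 p3 w1 - scale3 p1 w3) +
    scale3 p1 (scale3 p3 w2 - scale3 p2 w3) = 0"
  by (cases w1; cases w2; cases w3) (simp add: algebra_simps zero_prod_def)

text \<open>Altering the lifts w1 and w2 by multiples of v changes their discrepancy by a
  combination of p1 and p2, which removes it once c times the obstruction lies in (p1, p2).\<close>

lemma koszul_correction:
  fixes p1 p2 a b c :: "'r::comm_ring_1"
  shows "scale3 p2 (scale3 c w1 - scale3 b v) - scale3 p1 (scale3 c w2 + scale3 a v) =
    scale3 c (scale3 p2 w1 - scale3 p1 w2) - scale3 (p1 * a + p2 * b) v"
  by (cases w1; cases w2; cases v) (simp add: algebra_simps)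

context syzygy_pair
begin

text \<open>Each p_i in P gives a lift w_i with \<nu> \<times> w_i = p_i g f, and lifts are unique
  up to multiples of \<nu>. The cross differences of the w_i are therefore r, s, t times \<nu>, and
  the Koszul relation places p3 r in (p1, p2). Regularity up to a multiplier gives c r in (p1, p2)
  with nonzero c in k[S]. The corrected lift is divisible by p1 up to further multipliers, and
  dividing yields a lift of a multiple of g, so P meets k[S] outside 0.\<close>

lemma assoc_prime_adim:
  assumes P: "is_prime_ideal P" and Pg: "P = {a. a * g \<in> I}"
  shows "CARD('n) \<le> adim P + 2"
proof (rule ccontr)
  assume small: "\<not> ?thesis"
  obtain S where S: "P \<inter> Rs S \<subseteq> {0}" "\<And>x. x \<notin> S \<Longrightarrow> \<exists>q\<in>P \<inter> Rs (insert x S). q \<noteq> 0"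
    using ex_maximal_independent_vars[OF P] by blast
  have "card S \<le> adim P" using card_le_adim[OF prime_ideal_is_ideal[OF P] S(1)] .
  moreover have "card (- S) = CARD('n) - card S" by (simp add: Compl_eq_Diff_UNIV card_Diff_subset)
  ultimately have "3 \<le> card (- S)" using small by simp
  then obtain x1 x2 x3 where x: "x1 \<notin> S" "x2 \<notin> S" "x3 \<notin> S" "x1 \<noteq> x2" "x1 \<noteq> x3" "x2 \<noteq> x3"
    using ex_three_distinct[of "- S"] by auto
  obtain p1 where p1: "p1 \<in> P" "p1 \<in> Rs (insert x1 S)" "p1 \<noteq> 0" using S(2)[OF x(1)] by blast
  obtain p2 where p2: "p2 \<in> P" "p2 \<in> Rs (insert x2 S)" "p2 \<noteq> 0" using S(2)[OF x(2)] by blast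
  obtain p3 where p3: "p3 \<in> P" "p3 \<in> Rs (insert x3 S)" "p3 \<noteq> 0" using S(2)[OF x(3)] by blast
  obtain w1 where w1: "cross3 \<nu> w1 = scale3 (p1 * g) f" using p1(1) Pg unfolding I_def by blast
  obtain w2 where w2: "cross3 \<nu> w2 = scale3 (p2 * g) f" using p2(1) Pg unfolding I_def by blast
  obtain w3 where w3: "cross3 \<nu> w3 = scale3 (p3 * g) f" using p3(1) Pg unfolding I_def by blast
  have par: "\<exists>r. scale3 q v - scale3 p w = scale3 r \<nu>"
    if "cross3 \<nu> v = scale3 (p * g) f" "cross3 \<nu> w = scale3 (q * g) f" for p q v w
  proof -
    have "cross3 \<nu> (scale3 q v - scale3 p w) = scale3 q (scale3 (p * g) f) - scale3 p (scale3 (q * g) f)"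
      by (simp only: cross3_diff cross3_scale that)
    also have "\<dots> = 0" by (simp only: scale3_mult mult_ac) simp
    finally show ?thesis using cross_eq_0_iff by blast
  qed
  obtain r where r: "scale3 p2 w1 - scale3 p1 w2 = scale3 r \<nu>" using par[OF w1 w2] by blast
  obtain s where s: "scale3 p3 w1 - scale3 p1 w3 = scale3 s \<nu>" using par[OF w1 w3] by blast
  obtain t where t: "scale3 p3 w2 - scale3 p2 w3 = scale3 t \<nu>" using par[OF w2 w3] by blast
  have "scale3 (p3 * r - p2 * s + p1 * t) \<nu> = 0"
    using koszul_combination[of p3 p2 w1 p1 w2 w3] unfolding r s t
    by (simp only: scale3_mult mod3.scale_left_distrib mod3.scale_left_diff_distrib)
  then have "scale3 (p3 * r - p2 * s + p1 * t) \<nu> = scale3 0 \<nu>" by (simp add: zero_prod_def)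
  then have "p3 * r - p2 * s + p1 * t = 0" using scale3_cancel_right[OF \<nu>_neq_0] by blast
  then have "p3 * r = p1 * (- t) + p2 * s" by (simp add: algebra_simps eq_neg_iff_add_eq_0)
  then obtain c \<alpha> \<beta> where c: "c \<in> Rs S" "c \<noteq> 0" "c * r = p1 * \<alpha> + p2 * \<beta>"
    using regular_up_to_multiplier[OF p1(2) p2(2) p3(2) p1(3) p2(3) p3(3) x] by blast
  \<comment> \<open>Another lift of c p1 g, chosen so that p2 v becomes divisible by p1.\<close>
  let ?v = "scale3 c w1 - scale3 \<beta> \<nu>"
  have v: "scale3 p2 ?v = scale3 p1 (scale3 c w2 + scale3 \<alpha> \<nu>)"
  proof -
    have "scale3 p2 ?v - scale3 p1 (scale3 c w2 + scale3 \<alpha> \<nu>) =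
        scale3 c (scale3 p2 w1 - scale3 p1 w2) - scale3 (p1 * \<alpha> + p2 * \<beta>) \<nu>"
      by (rule koszul_correction)
    also have "\<dots> = 0" unfolding r c(3)[symmetric] by (simp only: scale3_mult) simp
    finally show ?thesis by simp
  qed
  obtain v1 v2 v3 where vv: "?v = (v1, v2, v3)" by (metis prod_cases3)
  obtain z1 z2 z3 where zz: "scale3 c w2 + scale3 \<alpha> \<nu> = (z1, z2, z3)" by (metis prod_cases3)
  have eqs: "p2 * v1 = p1 * z1" "p2 * v2 = p1 * z2" "p2 * v3 = p1 * z3"
    using v unfolding vv zz by simp_all
  have "degx x1 p2 = 0" using p2(2) x by (auto simp: Rs_iff)
  note L = dvd_up_to_multiplier[OF p1(2,3) x(1) this p2(3)]
  obtain c1 u1 where c1: "c1 \<in> Rs S" "c1 \<noteq> 0" "c1 * v1 = p1 * u1" using L[OF eqs(1)] by blast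
  obtain c2 u2 where c2: "c2 \<in> Rs S" "c2 \<noteq> 0" "c2 * v2 = p1 * u2" using L[OF eqs(2)] by blast
  obtain c3 u3 where c3: "c3 \<in> Rs S" "c3 \<noteq> 0" "c3 * v3 = p1 * u3" using L[OF eqs(3)] by blast
  \<comment> \<open>A common multiplier for the three entries of v, each of which becomes divisible
    by p1 after a multiplier of its own.\<close>
  let ?c = "c1 * c2 * c3" and ?u = "(c2 * c3 * u1, c1 * c3 * u2, c1 * c2 * u3)"
  have "?c * v1 = (c2 * c3) * (c1 * v1)" "?c * v2 = (c1 * c3) * (c2 * v2)" "?c * v3 = (c1 * c2) * (c3 * v3)"
    by (simp_all only: mult_ac)
  then have "?c * v1 = p1 * (c2 * c3 * u1)" "?c * v2 = p1 * (c1 * c3 * u2)" "?c * v3 = p1 * (c1 * c2 * u3)"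
    unfolding c1(3) c2(3) c3(3) by (simp_all only: mult_ac)
  then have u: "scale3 ?c ?v = scale3 p1 ?u" unfolding vv by simp
  have "scale3 p1 (cross3 \<nu> ?u) = scale3 ?c (cross3 \<nu> ?v)"
    by (simp only: u cross3_scale[symmetric])
  also have "cross3 \<nu> ?v = scale3 c (scale3 (p1 * g) f)"
    by (simp only: cross3_diff cross3_scale w1 cross3_self[of \<nu> 1, unfolded mod3.scale_one] mod3.scale_zero_right diff_zero)
  also have "scale3 ?c (scale3 c (scale3 (p1 * g) f)) = scale3 p1 (scale3 (?c * c * g) f)"
    by (simp only: scale3_mult mult_ac)
  finally have "cross3 \<nu> ?u = scale3 (?c * c * g) f" using scale3_cancel[OF p1(3)] by blast
  then have "?c * c * g \<in> I" unfolding I_def by blast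
  then have "?c * c \<in> P" using Pg by simp
  moreover have "?c * c \<in> Rs S" using c c1 c2 c3 by (intro Rs_mult)
  ultimately have "?c * c = 0" using S(1) by blast
  then show False using c c1 c2 c3 by simp
qed

lemma I_proper_height:
  assumes "I \<noteq> UNIV" shows "height I = 2" "unmixed I"
proof -
  have h: "height_prime P = 2" if P: "P \<in> assoc_primes I" for P
  proof -
    obtain g where g: "is_prime_ideal P" "P = {a. a * g \<in> I}" using P by (auto simp: assoc_primes_def)
    have "I \<subseteq> P" using g(2) ideal_mult[OF I_ideal] by (auto simp: mult.commute)
    then have "adim P + 2 \<le> CARD('n)" using prime_over_I(2)[OF g(1)] by blast
    then have "CARD('n) - adim P = 2" using assoc_prime_adim[OF g] by simp
    then show ?thesis using height_prime_eq[OF g(1)] by (simp add: numeral_eq_enat)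
  qed
  have ex: "\<exists>P. P \<in> assoc_primes I \<and> I \<subseteq> P"
  proof -
    \<comment> \<open>A maximal member of this family of colon ideals is prime. It is an associated
      prime over I and so bounds the height of I from above.\<close>
    let ?F = "{{a. a * g \<in> I} | g. g \<notin> I}"
    have id: "is_ideal {a. a * g \<in> I}" for g
      by (rule ring_mod.subspaceI)
        (auto simp: ring_mod.subspace_0[OF I_ideal] distrib_right ring_mod.subspace_add[OF I_ideal]
          mult.assoc ideal_mult[OF I_ideal])
    have "1 \<notin> I" using assms ideal_UNIV_iff[OF I_ideal] by blast
    then have "{a. a * 1 \<in> I} \<in> ?F" by blast
    then have "\<exists>P\<in>?F. \<forall>P'\<in>?F. P \<subseteq> P' \<longrightarrow> P' = P"
      by (rule ideal_family_maximal) (use id in blast)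
    then obtain P where P: "P \<in> ?F" "\<forall>P'\<in>?F. P \<subseteq> P' \<longrightarrow> P' = P" by (rule bexE)
    then obtain g where g: "P = {a. a * g \<in> I}" "g \<notin> I" by blast
    have "is_prime_ideal P"
      unfolding is_prime_ideal_def
    proof (intro conjI allI impI)
      show "is_ideal P" using id g by simp
      have "1 \<notin> P" using g by simp
      then show "P \<noteq> UNIV" by blast
      fix a b assume ab: "a * b \<in> P"
      show "a \<in> P \<or> b \<in> P"
      proof (rule ccontr)
        assume n: "\<not> ?thesis"
        then have "b * g \<notin> I" using g by simp
        then have "{a. a * (b * g) \<in> I} \<in> ?F" by blast
        moreover have "P \<subseteq> {a. a * (b * g) \<in> I}"
        proof
          fix x assume "x \<in> P"
          then have "b * (x * g) \<in> I" using g ideal_mult[OF I_ideal] by blast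
          then show "x \<in> {a. a * (b * g) \<in> I}" by (simp add: mult.left_commute)
        qed
        ultimately have "{a. a * (b * g) \<in> I} = P" using P(2) by blast
        moreover have "a \<in> {a. a * (b * g) \<in> I}" using ab g by (simp add: mult.assoc)
        ultimately show False using n by blast
      qed
    qed
    then have "P \<in> assoc_primes I" using g unfolding assoc_primes_def by blast
    moreover have "I \<subseteq> P" using g ideal_mult[OF I_ideal] by (auto simp: mult.commute)
    ultimately show ?thesis by blast
  qed
  show hI: "height I = 2"
  proof (rule antisym)
    show "2 \<le> height I" using prime_over_I(1) by (intro height_geI)
    obtain P where "P \<in> assoc_primes I" "I \<subseteq> P" using ex by blast
    then show "height I \<le> 2" using h height_le[of P I] by (simp add: assoc_primes_def)
  qed
  show "unmixed I" unfolding unmixed_def using h hI by simp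
qed

section \<open>Counting syzygies\<close>

lemma ideal_gen_f: "ideal_gen {f1, f2, f3} = range (\<lambda>w. dot3 w f)"
proof (intro equalityI subsetI)
  fix p assume "p \<in> ideal_gen {f1, f2, f3}"
  then obtain k1 k2 k3 where "p - k1 * f1 - k2 * f2 - k3 * f3 = 0"
    by (auto simp: ring_mod.span_breakdown_eq)
  then have "p = dot3 (k1, k2, k3) f" by (simp add: algebra_simps)
  then show "p \<in> range (\<lambda>w. dot3 w f)" by blast
next
  fix p assume "p \<in> range (\<lambda>w. dot3 w f)"
  then obtain w where w: "p = dot3 w f" by blast
  obtain w1 w2 w3 where ws: "w = (w1, w2, w3)" by (metis prod_cases3)
  show "p \<in> ideal_gen {f1, f2, f3}" unfolding w ws dot3_simp
    by (rule ring_mod.span_add, rule ring_mod.span_add;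
        rule ring_mod.span_scale, rule ring_mod.span_base) simp_all
qed

lemma homog3_product: "{w :: ('n, 'k) poly3. homog3 m w} = {p. homog m p} \<times> {p. homog m p} \<times> {p. homog m p}"
  by (auto simp: homog3_def)

lemma finite_span_homog3: "\<exists>G. finite G \<and> {w :: ('n, 'k) poly3. homog3 m w} \<subseteq> cs3.span G"
  unfolding homog3_product using homog_keys[of m] finite_int_deg[of m]
  by (intro finite_span_triples[where F = "{t. int (mon_deg t) = m}"]) blast+

lemma dim_homog3: "cs3.dim {w :: ('n, 'k) poly3. homog3 m w} = 3 * ndim TYPE('n) m"
proof -
  have s: "cs.subspace {p :: ('n, 'k) mpol. homog m p}" using subspace_homog[of UNIV m] by simp
  have "cs3.dim {w :: ('n, 'k) poly3. homog3 m w} =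
      cs.dim {p :: ('n, 'k) mpol. homog m p} + cs.dim {p :: ('n, 'k) mpol. homog m p} + cs.dim {p :: ('n, 'k) mpol. homog m p}"
    unfolding homog3_product
    by (rule dim_triples[where F = "{t. int (mon_deg t) = m}"])
      (use homog_keys[of m] finite_int_deg[of m] s in blast)+
  then show ?thesis by (simp add: dim_homog)
qed

lemma subspace_homog3: "cs3.subspace {w :: ('n, 'k) poly3. homog3 m w}"
  unfolding homog3_product
  using subspace_homog[of "UNIV :: ('n, 'k) mpol set" m]
  by (intro cs3.subspaceI)
    (auto simp: zero_prod_def intro: homog_add homog_cscale)

text \<open>Rank formula for the surjection of R^3 onto J with kernel Syz(J); it raises degrees by
  d.\<close>

lemma dim_syz_add_dim_J:
  "3 * ndim TYPE('n) m = cs3.dim {w \<in> M. homog3 m w} +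
    cs.dim {p \<in> ideal_gen {f1, f2, f3}. homog (m + int d) p}"
proof -
  let ?V = "{w :: ('n, 'k) poly3. homog3 m w}" and ?g = "\<lambda>w. dot3 w f"
  have lin: "Vector_Spaces.linear cscale3 cscale ?g"
    by (rule linear31I) (auto simp: dot3_add cscale3_def cscale_def dot3_scale)
  have img: "?g ` ?V = {p \<in> ideal_gen {f1, f2, f3}. homog (m + int d) p}"
  proof (intro equalityI subsetI)
    fix p assume "p \<in> ?g ` ?V"
    then obtain w where w: "homog3 m w" "p = dot3 w f" by blast
    have "hcomp (m + int d) p = p"
      using hcomp_dot3[OF hf3, of "m + int d" w] hcomp3_homog3[OF w(1), of m] w(2) by simp
    then have "homog (m + int d) p" using homog_hcomp by metis
    then show "p \<in> {p \<in> ideal_gen {f1, f2, f3}. homog (m + int d) p}"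
      using w by (auto simp: ideal_gen_f)
  next
    fix p assume p: "p \<in> {p \<in> ideal_gen {f1, f2, f3}. homog (m + int d) p}"
    then obtain w where w: "p = dot3 w f" by (auto simp: ideal_gen_f)
    have "p = dot3 (hcomp3 m w) f"
      using hcomp_dot3[OF hf3, of "m + int d" w] hcomp_homog[of "m + int d" p "m + int d"] p w by simp
    then show "p \<in> ?g ` ?V" using homog3_hcomp3 by blast
  qed
  have ker: "{w \<in> ?V. ?g w = 0} = {w \<in> M. homog3 m w}" by (auto simp: Syz_iff)
  obtain G where "finite G" "?V \<subseteq> cs3.span G" using finite_span_homog3 by blast
  from rank_nullity31[OF lin subspace_homog3 this(2,1)]
  show ?thesis unfolding img ker dim_homog3 .
qed

text \<open>Rank formula for w going to \<nu> \<times> w on syzygies of degree m. The kernel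
  consists of the multiples of \<nu>, the image of the triples g f with g in I, and degrees match
  when g has degree m + e - d.\<close>

lemma dim_syz:
  "cs3.dim {w \<in> M. homog3 m w} = ndim TYPE('n) (m - int e) + cs.dim {p \<in> I. homog (m + int e - int d) p}"
proof -
  let ?V = "{w \<in> M. homog3 m w}"
  let ?Ik = "{p \<in> I. homog (m + int e - int d) p}"
  have lin: "Vector_Spaces.linear cscale3 cscale3 (cross3 \<nu>)"
    by (rule linear3I) (simp_all only: cross3_add cscale3_def cross3_scale)
  have lin2: "Vector_Spaces.linear cscale cscale3 (\<lambda>r. scale3 r a)" for a :: "('n, 'k) poly3"
    by (rule linear13I) (simp_all only: mod3.scale_left_distrib cscale3_def cscale_def scale3_mult)
  have sV: "cs3.subspace ?V"
  proof (rule cs3.subspaceI)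
    show "0 \<in> ?V" using M_0 by (simp add: zero_prod_def)
    show "x + y \<in> ?V" if "x \<in> ?V" "y \<in> ?V" for x y
      using that mod3.subspace_add[OF M_subspace] cs3.subspace_add[OF subspace_homog3, of x m y] by auto
    show "cscale3 c x \<in> ?V" if "x \<in> ?V" for c x
      using that mod3.subspace_scale[OF M_subspace] cs3.subspace_scale[OF subspace_homog3, of x m c]
      by (auto simp: cscale3_def)
  qed
  have inj: "r = 0" if "scale3 r a = 0" "a \<noteq> 0" for r and a :: "('n, 'k) poly3"
    using that by (cases a) (auto simp: zero_prod_def)
  have img: "cross3 \<nu> ` ?V = (\<lambda>g. scale3 g f) ` ?Ik"
  proof (intro equalityI subsetI)
    fix u assume "u \<in> cross3 \<nu> ` ?V"
    then obtain w where w: "w \<in> M" "homog3 m w" "u = cross3 \<nu> w" by blast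
    let ?k = "m + int e - int d"
    have c: "cross3 \<nu> w = scale3 (h w) f" by (rule h_cross[OF w(1)])
    have "hcomp3 (?k + int d - int e) w = w" using hcomp3_homog3[OF w(2), of m] by simp
    then have "cross3 \<nu> w = scale3 (hcomp ?k (h w)) f" using cross3_hcomp[OF c, of ?k] by simp
    moreover from this have "hcomp ?k (h w) \<in> I" unfolding I_def by blast
    ultimately show "u \<in> (\<lambda>g. scale3 g f) ` ?Ik" using w(3) homog_hcomp[of ?k "h w"] by blast
  next
    fix u assume "u \<in> (\<lambda>g. scale3 g f) ` ?Ik"
    then obtain g where g: "g \<in> I" "homog (m + int e - int d) g" "u = scale3 g f" by blast
    let ?k = "m + int e - int d"
    obtain w where w: "w \<in> M" "cross3 \<nu> w = scale3 g f" using I_E[OF g(1)] by blast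
    have "cross3 \<nu> (hcomp3 m w) = scale3 g f"
      using cross3_hcomp[OF w(2), of ?k] hcomp_homog[OF g(2), of ?k] by simp
    moreover have "hcomp3 m w \<in> ?V" using M_hcomp3[OF w(1)] homog3_hcomp3 by blast
    ultimately show "u \<in> cross3 \<nu> ` ?V" using g(3) by (intro image_eqI[of u "cross3 \<nu>" "hcomp3 m w"]) (simp_all only:)
  qed
  have ker: "{w \<in> ?V. cross3 \<nu> w = 0} = (\<lambda>r. scale3 r \<nu>) ` {r. homog (m - int e) r}"
  proof (intro equalityI subsetI)
    fix w assume w: "w \<in> {w \<in> ?V. cross3 \<nu> w = 0}"
    then obtain r where r: "w = scale3 r \<nu>" using cross_eq_0_iff by blast
    have "hcomp3 m w = w" using w hcomp3_homog3[of m w m] by simp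
    then have "w = scale3 (hcomp (m - int e) r) \<nu>" using hcomp3_scale3[OF ha3, of m r] r by simp
    then show "w \<in> (\<lambda>r. scale3 r \<nu>) ` {r. homog (m - int e) r}" using homog_hcomp[of "m - int e" r] by blast
  next
    fix w assume "w \<in> (\<lambda>r. scale3 r \<nu>) ` {r. homog (m - int e) r}"
    then obtain r where r: "homog (m - int e) r" "w = scale3 r \<nu>" by blast
    have "hcomp3 m w = w"
      using hcomp3_scale3[OF ha3, of m r] hcomp_homog[OF r(1), of "m - int e"] r(2) by simp
    then have "homog3 m w" using homog3_hcomp3 by metis
    moreover have "w \<in> M" using r(2) syz by (simp only: Syz_iff dot3_scale mult_zero_right)
    moreover have "cross3 \<nu> w = 0" unfolding r(2) by (rule cross3_self)
    ultimately show "w \<in> {w \<in> ?V. cross3 \<nu> w = 0}" by blast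
  qed
  obtain G where G: "finite G" "{w :: ('n, 'k) poly3. homog3 m w} \<subseteq> cs3.span G" using finite_span_homog3 by blast
  then have "?V \<subseteq> cs3.span G" by blast
  from rank_nullity33[OF lin sV this G(1)]
  have "cs3.dim ?V = cs3.dim ((\<lambda>r. scale3 r \<nu>) ` {r. homog (m - int e) r}) + cs3.dim ((\<lambda>g. scale3 g f) ` ?Ik)"
    unfolding img ker .
  moreover have "cs3.dim ((\<lambda>r. scale3 r \<nu>) ` {r. homog (m - int e) r}) = ndim TYPE('n) (m - int e)"
  proof -
    obtain H where H: "finite H" "{r :: ('n, 'k) mpol. homog (m - int e) r} \<subseteq> cs.span H"
      using finite_span_bounded[OF finite_int_deg[of "m - int e"], of "{r :: ('n, 'k) mpol. homog (m - int e) r}"] homog_keys by blast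
    have "cs.subspace {r :: ('n, 'k) mpol. homog (m - int e) r}" using subspace_homog[of UNIV "m - int e"] by simp
    from dim_inj_image3[OF lin2 this H(2,1)] show ?thesis using inj[OF _ \<nu>_neq_0] dim_homog by metis
  qed
  moreover have "cs3.dim ((\<lambda>g. scale3 g f) ` ?Ik) = cs.dim ?Ik"
  proof -
    obtain H where H: "finite H" "?Ik \<subseteq> cs.span H"
      using finite_span_bounded[OF finite_int_deg[of "m + int e - int d"], of ?Ik] homog_keys by blast
    have "cs.subspace ?Ik" by (rule subspace_homog[OF cs_subspace_ideal[OF I_ideal]])
    from dim_inj_image3[OF lin2 this H(2,1)] show ?thesis using inj[OF _ f_neq_0] by blast
  qed
  ultimately show ?thesis by simp
qed

end

section \<open>Degrees of R/I and R/J from Hilbert polynomials\<close>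

section \<open>Hilbert polynomials\<close>

text \<open>The two linear conditions cancel the terms of order zero and one in the Taylor
  expansions; the remainders do not reach coefficient j, so only the second-order term is
  left.\<close>

lemma shift_combination:
  fixes P :: "rat poly"
  assumes "c0 + c1 + c2 + c3 = 0" "c1 * h1 + c2 * h2 + c3 * h3 = 0" "degree P < j + 3"
  shows "coeff (smult c0 P + smult c1 (pcompose P [:h1, 1:]) + smult c2 (pcompose P [:h2, 1:]) +
      smult c3 (pcompose P [:h3, 1:])) j =
    (c1 * h1^2 + c2 * h2^2 + c3 * h3^2) / 2 * coeff (pderiv (pderiv P)) j"
proof -
  let ?a = "coeff P j" and ?b = "coeff (pderiv P) j"
    and ?c = "coeff (pderiv (pderiv P)) j"
  have s: "coeff (pcompose P [:h, 1:]) j = ?a + h * ?b + h^2 / 2 * ?c" for h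
  proof -
    obtain r where r: "pcompose P [:h, 1:] = P + smult h (pderiv P) + smult (h^2 / 2) (pderiv (pderiv P)) + r"
        "\<And>j. degree P < j + 3 \<Longrightarrow> coeff r j = 0"
      using taylor_shift[of P h] by blast
    show ?thesis unfolding r(1) using r(2)[OF assms(3)] by simp
  qed
  have "c0 * ?a + c1 * (?a + h1 * ?b + h1^2 / 2 * ?c) + c2 * (?a + h2 * ?b + h2^2 / 2 * ?c) +
      c3 * (?a + h3 * ?b + h3^2 / 2 * ?c) =
      (c0 + c1 + c2 + c3) * ?a + (c1 * h1 + c2 * h2 + c3 * h3) * ?b +
      (c1 * h1^2 + c2 * h2^2 + c3 * h3^2) / 2 * ?c"
    by (simp add: field_simps)
  then show ?thesis unfolding assms(1,2) by (simp add: s)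
qed

lemma coeff_pcompose_shift:
  fixes P :: "rat poly"
  assumes "degree P \<le> j" shows "coeff (pcompose P [:h, 1:]) j = coeff P j"
proof -
  obtain r where r: "pcompose P [:h, 1:] = P + smult h (pderiv P) + smult (h^2 / 2) (pderiv (pderiv P)) + r"
      "\<And>j. degree P < j + 3 \<Longrightarrow> coeff r j = 0"
    using taylor_shift[of P h] by blast
  have "coeff P (Suc j) = 0" "coeff P (Suc (Suc j)) = 0"
    using assms by (simp_all add: coeff_eq_0)
  then show ?thesis unfolding r(1) using r(2)[of j] assms by (simp add: coeff_pderiv)
qed

text \<open>With k + 3 variables, quotients of codimension two have Hilbert polynomials of degree k.
  The second derivative is normalised here because it is what second differences of B leave at
  coefficient k.\<close>

lemma ndim_poly:
  assumes "CARD('n::finite) = k + 3"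
  shows "\<exists>B :: rat poly. degree B = k + 2 \<and> coeff (pderiv (pderiv B)) k = 1 / fact k \<and>
    (\<forall>m. of_nat (ndim TYPE('n) (int m)) = poly B (of_nat m))"
proof -
  obtain B :: "rat poly" where B: "degree B = k + 2" "lead_coeff B = 1 / fact (k + 2)"
      "\<And>m. of_nat ((m + (k + 2)) choose m) = poly B (of_nat m)"
    using binomial_poly[of "k + 2"] by blast
  have "ndim TYPE('n) (int m) = mon_count {} (UNIV :: 'n set) m" for m
    by (simp add: ndim_def mon_count_def)
  then have "ndim TYPE('n) (int m) = (m + (k + 2)) choose m" for m
    using assms by (simp add: mon_count_all)
  moreover have "coeff (pderiv (pderiv B)) k = 1 / fact k"
  proof -
    have "coeff (pderiv (pderiv B)) k = of_nat (Suc k) * (of_nat (Suc (Suc k)) * lead_coeff B)"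
      using B(1) by (simp add: coeff_pderiv)
    also have "lead_coeff B = 1 / (of_nat (Suc (Suc k)) * (of_nat (Suc k) * fact k))"
      using B(2) by (simp add: fact_Suc numeral_2_eq_2)
    finally show ?thesis by (simp add: field_simps del: of_nat_Suc)
  qed
  ultimately show ?thesis using B by (intro exI[of _ B]) auto
qed

lemma HF_eventually_poly:
  assumes "is_ideal I"
  shows "\<exists>(P :: rat poly) N. \<forall>m\<ge>N. of_nat (HF I m) = poly P (of_nat m)"
  using ev_poly_HF[OF assms] unfolding ev_poly_def eventually_sequentially by blast

lemma hilb_poly_eqI:
  assumes "hideal I" "\<And>m. m \<ge> N \<Longrightarrow> of_nat (HF I m) = poly P (of_nat m)"
  shows "hilb_poly I = P"
  unfolding hilb_poly_def
proof (rule the_equality)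
  show "\<forall>\<^sub>F m in sequentially. of_nat (hilb_fun I m) = poly P (of_nat m)"
    unfolding eventually_sequentially hilb_fun_eq_HF[OF assms(1)] using assms(2) by blast
next
  fix Q :: "rat poly" assume "\<forall>\<^sub>F m in sequentially. of_nat (hilb_fun I m) = poly Q (of_nat m)"
  moreover have "\<forall>\<^sub>F m in sequentially. of_nat (hilb_fun I m) = poly P (of_nat m)"
    unfolding eventually_sequentially hilb_fun_eq_HF[OF assms(1)] using assms(2) by blast
  ultimately have "\<forall>\<^sub>F m in sequentially. poly Q (of_nat m) = poly P (of_nat m)"
    by eventually_elim simp
  then show "Q = P" by (rule rat_poly_eq_eventually)
qed

text \<open>A prime of height two over I has \<open>adim\<close> equal to k + 1, so the affine
  Hilbert polynomial of I has degree at least k + 1; P is its first difference and loses exactly one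
  degree.\<close>

lemma height_two_degree:
  fixes I :: "('n::{finite, linorder}, 'k::field) mpol set" and P :: "rat poly"
  assumes n: "CARD('n) = k + 3" and I: "is_ideal I" "height I = 2"
    and P: "\<And>m. m \<ge> N \<Longrightarrow> of_nat (HF I m) = poly P (of_nat m)"
  shows "P \<noteq> 0" "k \<le> degree P"
proof -
  obtain Q where Q: "is_prime_ideal Q" "I \<subseteq> Q" "height_prime Q = 2"
    using height_two_witness[OF I(2)] by blast
  have "CARD('n) - adim Q = 2" using height_prime_eq[OF Q(1)] Q(3) by (simp add: numeral_eq_enat)
  then have "k + 1 \<le> adim Q" using n by simp
  also have "adim Q \<le> adim I" using adim_antimono[OF I(1) prime_ideal_is_ideal[OF Q(1)] Q(2)] .
  finally obtain l where l: "adim I = Suc l" "k \<le> l" by (cases "adim I") auto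
  let ?D = "aHP I - pcompose (aHP I) [:- 1, 1:]"
  have dl: "degree (aHP I) = Suc l" using l(1) by (simp add: adim_def)
  then have "lead_coeff (aHP I) \<noteq> 0" using leading_coeff_0_iff[of "aHP I"] by fastforce
  with dl have D: "degree ?D \<le> l" "coeff ?D l \<noteq> 0"
    using degree_pcompose_diff[OF dl, of 1] by (simp_all del: coeff_diff of_nat_Suc)
  obtain N' where N': "\<And>m. m \<ge> N' \<Longrightarrow> of_nat (aHF I m) = poly (aHP I) (of_nat m)"
    using aHP[OF I(1)] unfolding eventually_sequentially by blast
  have "poly P (of_nat m) = poly ?D (of_nat m)" if m: "m \<ge> N + N' + 1" for m
  proof -
    obtain m' where m': "m = Suc m'" using m by (cases m) auto
    have "aHF I m = aHF I m' + HF I m" unfolding aHF_def m' by simp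
    then have "(of_nat (aHF I m) :: rat) = of_nat (aHF I m') + of_nat (HF I m)" by simp
    then show ?thesis using N'[of m] N'[of m'] P[of m] m m' by (simp add: poly_pcompose)
  qed
  then have "P = ?D" by (intro rat_poly_eq_eventually) (auto simp: eventually_sequentially)
  then show "P \<noteq> 0" "k \<le> degree P" using D l(2) le_degree[of ?D l] by auto
qed

section \<open>Coprime pairs\<close>

lemma prime_elem_dvd_prodD:
  fixes q :: "'r::comm_semiring_1"
  assumes "finite T" "prime_elem q" "q dvd (\<Prod>t\<in>T. p t)" shows "\<exists>s\<in>T. q dvd p s"
  using assms
proof (induction T rule: finite_induct)
  case empty
  then show ?case by (simp add: prime_elem_def)
next
  case (insert t T)
  then show ?case by (auto simp: prime_elem_dvd_mult_iff)
qed

text \<open>If every t failed, each would give a prime \<open>p t\<close> dividing a. For s \<noteq>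
  t these do not divide one another, because a common divisor of b + s c and b + t c divides c and
  b. So the product over any finite set of scalars divides a, impossible for more than
  \<open>tdeg a\<close> of them; characteristic zero supplies that many.\<close>

lemma coprime_combination:
  fixes a b c :: "('n::{finite, linorder}, 'k::field_char_0) mpol"
  assumes a: "a \<noteq> 0" and abc: "no_common_prime {a, b, c}"
  shows "\<exists>t. no_common_prime {a, b + cscale t c}"
proof (rule ccontr)
  assume "\<not> ?thesis"
  then have "\<forall>t. \<exists>p. prime_elem p \<and> p dvd a \<and> p dvd b + cscale t c"
    unfolding no_common_prime_def by blast
  then obtain p where p: "\<And>t. prime_elem (p t)" "\<And>t. p t dvd a" "\<And>t. p t dvd b + cscale t c" by metis
  have ndvd: "\<not> p s dvd p t" if "s \<noteq> t" for s t
  proof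
    assume "p s dvd p t"
    then have "p s dvd (b + cscale s c) - (b + cscale t c)" using p(3) dvd_trans by (intro dvd_diff) blast+
    also have "(b + cscale s c) - (b + cscale t c) = cscale (s - t) c" by (simp add: cs.scale_left_diff_distrib)
    finally have "p s dvd cscale (inverse (s - t)) 1 * cscale (s - t) c" by (rule dvd_mult)
    also have "cscale (inverse (s - t)) 1 * cscale (s - t) c = c"
      using that by (simp add: cscale_mult)
    finally have c: "p s dvd c" .
    then have "p s dvd cscale s 1 * c" by (rule dvd_mult)
    then have "p s dvd cscale s c" by (simp add: cscale_mult)
    then have "p s dvd b" using p(3)[of s] by (simp add: dvd_add_left_iff)
    then show False using abc p(1)[of s] p(2)[of s] c unfolding no_common_prime_def by blast
  qed
  have dvd: "(\<Prod>t\<in>T. p t) dvd a" if "finite T" for T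
    using that
  proof (induction T rule: finite_induct)
    case (insert t T)
    then obtain q where q: "a = (\<Prod>t\<in>T. p t) * q" by blast
    have "\<not> p t dvd (\<Prod>t\<in>T. p t)"
    proof
      assume "p t dvd (\<Prod>t\<in>T. p t)"
      then obtain s where "s \<in> T" "p t dvd p s" using prime_elem_dvd_prodD[OF insert(1) p(1)] by blast
      then show False using ndvd[of t s] insert by auto
    qed
    then have "p t dvd q" using p(2)[of t] q prime_elem_dvd_mult_iff[OF p(1)[of t]] by simp
    then show ?case using q insert(1,2) by (metis mult.commute mult_dvd_mono dvd_refl prod.insert)
  qed simp
  have nz: "p t \<noteq> 0" "tdeg (p t) \<ge> 1" for t
    using p(1)[of t] mpol_dvd_1_iff[of "p t"] by (auto simp: prime_elem_def)
  have deg: "(\<Prod>t\<in>T. p t) \<noteq> 0 \<and> card T \<le> tdeg (\<Prod>t\<in>T. p t)" if "finite T" for T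
    using that
  proof (induction T rule: finite_induct)
    case (insert t T)
    then show ?case using nz[of t] by (simp add: tdeg_mult)
  qed simp
  let ?T = "of_nat ` {..tdeg a} :: 'k set"
  have "card ?T = Suc (tdeg a)" by (subst card_image) (auto simp: inj_on_def)
  moreover obtain q where q: "a = (\<Prod>t\<in>?T. p t) * q" using dvd[of ?T] by blast
  moreover have "q \<noteq> 0" using a q by auto
  moreover have "card ?T \<le> tdeg (\<Prod>t\<in>?T. p t)" "(\<Prod>t\<in>?T. p t) \<noteq> 0" using deg[of ?T] by auto
  ultimately have "Suc (tdeg a) \<le> tdeg a"
    by (metis le_add1 order_trans tdeg_mult)
  then show False by simp
qed

text \<open>The three entries are permuted so that a nonzero one comes first; the other two are then
  merged into one form of the same degree.\<close>

lemma ex_coprime_pair: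
  fixes a1 a2 a3 :: "('n::{finite, linorder}, 'k::field_char_0) mpol"
  assumes a: "no_common_prime {a1, a2, a3}" and I: "is_ideal I" "{a1, a2, a3} \<subseteq> I"
    and h: "homog m a1" "homog m a2" "homog m a3"
  shows "\<exists>a b. no_common_prime {a, b} \<and> a \<noteq> 0 \<and> a \<in> I \<and> b \<in> I \<and> homog m a \<and> homog m b"
proof -
  have key: ?thesis if s: "{x, y, z} = {a1, a2, a3}" "x \<noteq> 0" for x y z
  proof -
    obtain t where t: "no_common_prime {x, y + cscale t z}"
      using coprime_combination[OF s(2), of y z] a[folded s(1)] by blast
    have xyz: "x \<in> I" "y \<in> I" "z \<in> I" "homog m x" "homog m y" "homog m z"
      using s(1) I(2) h by (auto simp: set_eq_iff)
    then have "y + cscale t z \<in> I" "homog m (y + cscale t z)"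
      unfolding cscale_def using ideal_mult[OF I(1)] ring_mod.subspace_add[OF I(1)]
        homog_add homog_cscale[unfolded cscale_def] by blast+
    then show ?thesis using t xyz s(2) by blast
  qed
  obtain x where "x \<in> {a1, a2, a3}" "x \<noteq> 0" using no_common_prime_nonzero[OF a] by blast
  then consider "a1 \<noteq> 0" | "a2 \<noteq> 0" | "a3 \<noteq> 0" by blast
  then show ?thesis using key[of a1 a2 a3] key[of a2 a1 a3] key[of a3 a1 a2]
    by cases (simp_all add: insert_commute)
qed

lemma finite_span_homog: "\<exists>H. finite H \<and> {p :: ('n::finite, 'k::field) mpol. homog m p} \<subseteq> cs.span H"
  by (rule finite_span_bounded[OF finite_int_deg[of m]]) (use homog_keys in blast)

text \<open>The combinations x a + y b fill part of I in degree m, and by coprimality their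
  relations are multiples of (b, -a). The bound is the Hilbert function of a complete intersection
  of two forms of degree e.\<close>

lemma HF_le_coprime_pair:
  fixes I :: "('n::{finite, linorder}, 'k::field) mpol set"
  assumes I: "hideal I" and ab: "no_common_prime {a, b}" "a \<noteq> 0" "a \<in> I" "b \<in> I"
    "homog (int e) a" "homog (int e) b"
  shows "int (HF I m) \<le> int (ndim TYPE('n) (int m)) - 2 * int (ndim TYPE('n) (int m - int e)) +
    int (ndim TYPE('n) (int m - 2 * int e))"
proof -
  have iI: "is_ideal I" by (rule hideal_is_ideal[OF I])
  let ?R = "{p :: ('n, 'k) mpol. homog (int m - int e) p}"
  \<comment> \<open>Pairs (x, y) are padded by a zero to stay within triples.\<close>
  let ?V = "?R \<times> ?R \<times> {0 :: ('n, 'k) mpol}"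
  let ?g = "\<lambda>w. dot3 w (a, b, 0)"
  let ?Im = "{p \<in> I. homog (int m) p}"
  let ?K = "(\<lambda>z. scale3 z (b, - a, 0)) ` {z. homog (int m - 2 * int e) z}"
  let ?F = "{t :: 'n \<Rightarrow>\<^sub>0 nat. int (mon_deg t) = int m - int e}"
  have lin: "Vector_Spaces.linear cscale3 cscale ?g"
    by (rule linear31I) (auto simp: dot3_add cscale3_def cscale_def dot3_scale)
  have sR: "cs.subspace ?R" using subspace_homog[of UNIV] by simp
  have s0: "cs.subspace {0 :: ('n, 'k) mpol}" by (rule cs.subspace_single_0)
  have d0: "cs.dim {0 :: ('n, 'k) mpol} = 0"
    by (metis cs.dim_span cs.span_empty cs.dim_eq_card_independent cs.independent_empty card.empty)
  have kF: "keys p \<subseteq> ?F" if "p \<in> ?R \<union> ?R \<union> {0}" for p using that homog_keys[of _ p] by auto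
  have dV: "cs3.dim ?V = 2 * ndim TYPE('n) (int m - int e)"
    using dim_triples[OF finite_int_deg[of "int m - int e"] kF sR sR s0] d0 by (simp add: dim_homog)
  have sV: "cs3.subspace ?V"
    by (rule cs3.subspaceI) (auto simp: zero_prod_def intro: homog_add homog_cscale)
  have "\<exists>G. finite G \<and> ?V \<subseteq> cs3.span G"
    by (rule finite_span_triples[where F = ?F]) (use kF finite_int_deg in blast)+
  then obtain G where G: "finite G" "?V \<subseteq> cs3.span G" by blast
  have img: "?g ` ?V \<subseteq> ?Im"
  proof
    fix p assume "p \<in> ?g ` ?V"
    then obtain x y where xy: "homog (int m - int e) x" "homog (int m - int e) y" "p = x * a + y * b" by auto
    have "homog (int m) (x * a)" "homog (int m) (y * b)"
      using homog_mult[OF xy(1) ab(5)] homog_mult[OF xy(2) ab(6)] by simp_all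
    then show "p \<in> ?Im" using xy(3) ab iI
      by (auto intro: homog_add ring_mod.subspace_add[OF iI] ideal_mult[OF iI])
  qed
  obtain H where H: "finite H" "?Im \<subseteq> cs.span H"
    using finite_span_bounded[OF finite_int_deg[of "int m"], of ?Im] homog_keys by blast
  have le1: "cs.dim (?g ` ?V) \<le> cs.dim ?Im" by (rule cs.dim_mono_finite[OF img H(2,1)])
  have ker: "{w \<in> ?V. ?g w = 0} \<subseteq> ?K"
  proof
    fix w assume "w \<in> {w \<in> ?V. ?g w = 0}"
    then obtain x y where xy: "w = (x, y, 0)" "homog (int m - int e) x" "homog (int m - int e) y"
        "x * a + y * b = 0" by auto
    have yb: "y * b = - (x * a)" using xy(4) by (simp add: eq_neg_iff_add_eq_0 add.commute)
    have "a dvd y * u" if "u \<in> {a, b}" for u using that yb by auto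
    then have "a dvd y" using no_common_prime_dvd[OF ab(1,2)] by blast
    then obtain z where z: "y = a * z" by blast
    let ?z = "hcomp (int m - 2 * int e) (- z)"
    have y: "y = ?z * (- a)"
    proof -
      have "y = hcomp (int m - int e) ((- z) * (- a))"
        using hcomp_homog[OF xy(3), of "int m - int e"] z by (simp add: mult.commute)
      also have "\<dots> = hcomp (int m - int e - int e) (- z) * (- a)"
        by (rule hcomp_mult) (simp add: homog_uminus ab)
      finally show ?thesis by (simp add: algebra_simps)
    qed
    have "x * a = (?z * b) * a"
    proof -
      have "x * a = - (y * b)" using yb by simp
      also have "\<dots> = (?z * b) * a" by (subst y) (simp add: mult_ac)
      finally show ?thesis .
    qed
    then have "x = ?z * b" using ab(2) by simp
    then have "w = scale3 ?z (b, - a, 0)" using xy(1) y by simp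
    then show "w \<in> ?K" using homog_hcomp by blast
  qed
  have dK: "cs3.dim ?K = ndim TYPE('n) (int m - 2 * int e)"
  proof -
    have lin2: "Vector_Spaces.linear cscale cscale3 (\<lambda>z. scale3 z (b, - a, 0))"
      by (rule linear13I) (simp_all only: mod3.scale_left_distrib cscale3_def cscale_def scale3_mult)
    obtain H where H: "finite H" "{r :: ('n, 'k) mpol. homog (int m - 2 * int e) r} \<subseteq> cs.span H"
      using finite_span_homog by blast
    have "cs.subspace {r :: ('n, 'k) mpol. homog (int m - 2 * int e) r}" using subspace_homog[of UNIV] by simp
    from dim_inj_image3[OF lin2 this H(2,1)] show ?thesis using ab(2) dim_homog by (auto simp: zero_prod_def)
  qed
  have "?K \<subseteq> ?V"
  proof
    fix w assume "w \<in> ?K"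
    then obtain z where z: "homog (int m - 2 * int e) z" "w = (z * b, z * - a, z * 0)" by auto
    have "homog (int m - int e) (z * b)" "homog (int m - int e) (z * (- a))"
      using homog_mult[OF z(1) ab(6)] homog_mult[OF z(1) homog_uminus[OF ab(5)]] by simp_all
    then show "w \<in> ?V" using z(2) by simp
  qed
  then have "cs3.dim {w \<in> ?V. ?g w = 0} \<le> cs3.dim ?K"
    using cs3.dim_mono_finite[OF ker _ G(1)] G(2) by blast
  moreover have "cs3.dim ?V = cs3.dim {w \<in> ?V. ?g w = 0} + cs.dim (?g ` ?V)"
    by (rule rank_nullity31[OF lin sV G(2,1)])
  ultimately have "2 * ndim TYPE('n) (int m - int e) \<le> ndim TYPE('n) (int m - 2 * int e) + cs.dim ?Im"
    using dV dK le1 by simp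
  then show ?thesis using dim_hideal_add_HF[OF I, of m] by linarith
qed

section \<open>The multiplicity formula\<close>

lemma hideal_ideal_gen:
  assumes "\<And>g. g \<in> S \<Longrightarrow> \<exists>m. homog m g" shows "hideal (ideal_gen S)"
  by (rule homog_ideal_hideal) (use assms in \<open>auto simp: homog_ideal_def\<close>)

lemma mult_quot_eqI:
  assumes "hideal I" "\<And>m. m \<ge> N \<Longrightarrow> of_nat (HF I m) = poly P (of_nat m)" "P \<noteq> 0" "degree P = k"
  shows "mult_quot I = fact k * coeff P k"
  using hilb_poly_eqI[OF assms(1,2)] assms(3,4) by (simp add: mult_quot_def)

context syzygy_pair
begin

text \<open>Both rank formulas are applied to syzygies of degree m - d. The hypothesis keeps the
  subtraction in the degree m + e - 2 d of I from being truncated.\<close>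

lemma HF_relation:
  assumes "2 * d \<le> m"
  shows "int (HF (ideal_gen {f1, f2, f3}) m) + int (HF I (m + e - 2 * d)) =
    int (ndim TYPE('n) (int m)) - 3 * int (ndim TYPE('n) (int m - int d)) +
    int (ndim TYPE('n) (int m - int d - int e)) + int (ndim TYPE('n) (int (m + e - 2 * d)))"
proof -
  have J: "hideal (ideal_gen {f1, f2, f3})" by (rule hideal_ideal_gen) (use hf in auto)
  have k: "int m - int d + int e - int d = int (m + e - 2 * d)" using assms by simp
  have "3 * ndim TYPE('n) (int m - int d) = cs3.dim {w \<in> M. homog3 (int m - int d) w} +
      cs.dim {p \<in> ideal_gen {f1, f2, f3}. homog (int m) p}"
    using dim_syz_add_dim_J[of "int m - int d"] by simp
  moreover have "cs3.dim {w \<in> M. homog3 (int m - int d) w} = ndim TYPE('n) (int m - int d - int e) +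
      cs.dim {p \<in> I. homog (int (m + e - 2 * d)) p}"
    using dim_syz[of "int m - int d"] unfolding k .
  moreover note dim_hideal_add_HF[OF J, of m] dim_hideal_add_HF[OF I_hideal, of "m + e - 2 * d"]
  ultimately show ?thesis by linarith
qed

end

text \<open>With k + 3 variables, c is k! times the coefficient of degree k of the Hilbert
  polynomial of R/I. Using this coefficient in place of the multiplicity lets one formula cover I =
  R as well, where c is 0.\<close>

lemma multiplicity_formula:
  fixes f1 f2 f3 a1 a2 a3 :: "('n::{finite, linorder}, 'k::field_char_0) mpol"
  assumes "syzygy_pair f1 f2 f3 a1 a2 a3 d e" and n: "CARD('n) \<ge> 3"
    and hJ: "height (ideal_gen {f1, f2, f3}) = 2"
  shows "\<exists>c. 0 \<le> c \<and> c \<le> of_nat e ^ 2 \<and>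
    mult_quot (ideal_gen {f1, f2, f3}) = of_nat d ^ 2 - of_nat d * of_nat e + of_nat e ^ 2 - c \<and>
    (syzygy_pair.I f1 f2 f3 a1 a2 a3 \<noteq> UNIV \<longrightarrow> mult_quot (syzygy_pair.I f1 f2 f3 a1 a2 a3) = c)"
proof -
  interpret syzygy_pair f1 f2 f3 a1 a2 a3 d e by fact
  let ?J = "ideal_gen {f1, f2, f3}"
  obtain k where k: "CARD('n) = k + 3" using n by (metis le_add_diff_inverse2)
  have J: "hideal ?J" by (rule hideal_ideal_gen) (use hf in auto)
  obtain B :: "rat poly" where B: "degree B = k + 2" "coeff (pderiv (pderiv B)) k = 1 / fact k"
      "\<And>m. of_nat (ndim TYPE('n) (int m)) = poly B (of_nat m)"
    using ndim_poly[OF k] by (elim exE conjE) metis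
  have B': "of_int (int (ndim TYPE('n) (int m - int j))) = poly (pcompose B [:- of_nat j, 1:]) (of_nat m)"
    if "m \<ge> j" for m j
  proof -
    have "int m - int j = int (m - j)" using that by simp
    then show ?thesis using B(3)[of "m - j"] that by (simp add: poly_pcompose of_nat_diff)
  qed
  have B0: "coeff (pderiv (pderiv B)) j = 0" if "j > k" for j
    using B(1) that by (simp add: coeff_pderiv coeff_eq_0)
  obtain PI :: "rat poly" and NI where PI: "\<And>m. m \<ge> NI \<Longrightarrow> of_nat (HF I m) = poly PI (of_nat m)"
    using HF_eventually_poly[OF I_ideal] by auto
  obtain PJ :: "rat poly" and NJ where PJ: "\<And>m. m \<ge> NJ \<Longrightarrow> of_nat (HF ?J m) = poly PJ (of_nat m)"
    using HF_eventually_poly[OF hideal_is_ideal[OF J]] by auto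
  let ?d = "of_nat d :: rat" and ?e = "of_nat e :: rat"
  \<comment> \<open>The polynomial of a complete intersection of type (e, e): its Hilbert series has
    numerator 1 - 2 z^e + z^(2e). The last summand only pads it to the shape of
    \<open>shift_combination\<close>.\<close>
  define U where "U = smult 1 B + smult (- 2) (pcompose B [:- ?e, 1:]) +
      smult 1 (pcompose B [:- (2 * ?e), 1:]) + smult 0 (pcompose B [:0, 1:])"
  \<comment> \<open>The sum of the Hilbert polynomials of R/J and of R/I shifted by 2d - e; the
    matching numerator is 1 - 3 z^d + z^(d+e) + z^(2d-e).\<close>
  define T where "T = smult 1 B + smult (- 3) (pcompose B [:- ?d, 1:]) +
      smult 1 (pcompose B [:- (?d + ?e), 1:]) + smult 1 (pcompose B [:?e - 2 * ?d, 1:])"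
  have cU: "coeff U j = ?e ^ 2 * coeff (pderiv (pderiv B)) j" if "j \<ge> k" for j
    unfolding U_def by (subst shift_combination) (use B(1) that in \<open>auto simp: power2_eq_square\<close>)
  have cT: "coeff T j = (?d^2 - ?d * ?e + ?e^2) * coeff (pderiv (pderiv B)) j" if "j \<ge> k" for j
  proof -
    have "coeff T j = ((- 3) * (- ?d)^2 + 1 * (- (?d + ?e))^2 + 1 * (?e - 2 * ?d)^2) / 2 *
        coeff (pderiv (pderiv B)) j"
      unfolding T_def by (rule shift_combination) (use B(1) that in auto)
    also have "((- 3) * (- ?d)^2 + 1 * (- (?d + ?e))^2 + 1 * (?e - 2 * ?d)^2) / 2 = ?d^2 - ?d * ?e + ?e^2"
      by (simp add: power2_eq_square field_simps)
    finally show ?thesis .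
  qed
  obtain a b where ab: "no_common_prime {a, b}" "a \<noteq> 0" "a \<in> I" "b \<in> I" "homog (int e) a" "homog (int e) b"
    using ex_coprime_pair[OF ca I_ideal a_in_I ha] by blast
  have U: "0 \<le> poly PI (of_nat m) \<and> poly PI (of_nat m) \<le> poly U (of_nat m)" if m: "m \<ge> NI + 2 * e" for m
  proof -
    have "(of_int (int (HF I m)) :: rat) \<le> of_int (int (ndim TYPE('n) (int m)) -
        2 * int (ndim TYPE('n) (int m - int e)) + int (ndim TYPE('n) (int m - int (2 * e))))"
      using HF_le_coprime_pair[OF I_hideal ab, of m] by (subst of_int_le_iff) simp
    also have "\<dots> = poly U (of_nat m)"
      using B'[of e m] B'[of "2 * e" m] B(3)[of m] m by (simp add: U_def)
    finally have "(of_nat (HF I m) :: rat) \<le> poly U (of_nat m)" by simp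
    then show ?thesis using PI[of m] m by (metis add_leD1 of_nat_0_le_iff)
  qed
  then have evU: "\<forall>\<^sub>F m in sequentially. 0 \<le> poly PI (of_nat m) \<and> poly PI (of_nat m) \<le> poly U (of_nat m)"
    unfolding eventually_sequentially by blast
  have degU: "degree U \<le> k" by (rule degree_le) (use cU B0 in auto)
  have degPI: "degree PI \<le> degree U" by (rule eventually_le_degree_lead_coeff(1)[OF evU])
  then have degPI': "degree PI \<le> k" using degU by simp
  have PIk: "0 \<le> coeff PI k"
  proof -
    have "lead_coeff PI \<ge> 0"
      by (rule eventually_nonneg_lead_coeff) (rule eventually_mono[OF evU], simp)
    then show ?thesis using degPI' by (cases "degree PI = k") (auto simp: coeff_eq_0)
  qed
  have PIU: "coeff PI k \<le> coeff U k"
    using eventually_le_degree_lead_coeff(2)[OF evU] degU degPI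
    by (cases "degree U = k") (auto simp: coeff_eq_0)
  have "poly (PJ + pcompose PI [:?e - 2 * ?d, 1:]) (of_nat m) = poly T (of_nat m)"
    if m: "m \<ge> NI + NJ + 2 * d + e" for m
  proof -
    have mm: "of_nat (m + e - 2 * d) = (of_nat m + ?e - 2 * ?d :: rat)" using m by (simp add: of_nat_diff)
    have "of_int (int (HF ?J m) + int (HF I (m + e - 2 * d))) =
        (of_int (int (ndim TYPE('n) (int m)) - 3 * int (ndim TYPE('n) (int m - int d)) +
        int (ndim TYPE('n) (int m - int (d + e))) + int (ndim TYPE('n) (int (m + e - 2 * d)))) :: rat)"
      using HF_relation[of m] m by (simp add: diff_diff_eq)
    moreover have "(of_nat (HF I (m + e - 2 * d)) :: rat) = poly PI (of_nat m + ?e - 2 * ?d)"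
      using PI[of "m + e - 2 * d"] m unfolding mm by simp
    moreover have "(of_nat (ndim TYPE('n) (int (m + e - 2 * d))) :: rat) = poly B (of_nat m + ?e - 2 * ?d)"
      using B(3)[of "m + e - 2 * d"] unfolding mm .
    ultimately show ?thesis
      using PJ[of m] B'[of d m] B'[of "d + e" m] B(3)[of m] m
      by (simp add: T_def poly_pcompose algebra_simps)
  qed
  then have "PJ + pcompose PI [:?e - 2 * ?d, 1:] = T"
    by (intro rat_poly_eq_eventually) (auto simp: eventually_sequentially)
  then have PJ_eq: "PJ = T - pcompose PI [:?e - 2 * ?d, 1:]" by (simp add: eq_diff_eq)
  have cPJ: "coeff PJ j = coeff T j - coeff PI j" if "j \<ge> k" for j
    unfolding PJ_eq using coeff_pcompose_shift[of PI j] degPI' that by simp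
  \<comment> \<open>Height two of J forces degree at least k, so the coefficient at k is the leading
    one and gives the multiplicity.\<close>
  have PJ0: "PJ \<noteq> 0" "k \<le> degree PJ" using height_two_degree[OF k hideal_is_ideal[OF J] hJ PJ] by blast+
  have "degree PJ \<le> k"
    by (rule degree_le) (use cPJ cT B0 degPI' in \<open>auto simp: coeff_eq_0\<close>)
  then have degPJ: "degree PJ = k" using PJ0 by simp
  have fk: "fact k * (1 / fact k :: rat) = 1" by simp
  let ?c = "fact k * coeff PI k"
  have "mult_quot ?J = fact k * coeff PJ k"
    by (rule mult_quot_eqI[OF J PJ PJ0(1) degPJ])
  also have "coeff PJ k = (?d^2 - ?d * ?e + ?e^2) * (1 / fact k) - coeff PI k"
    by (simp only: cPJ[OF order_refl] cT[OF order_refl] B(2))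
  also have "fact k * ((?d^2 - ?d * ?e + ?e^2) * (1 / fact k) - coeff PI k) =
      ?d^2 - ?d * ?e + ?e^2 - ?c"
    by (simp add: right_diff_distrib)
  finally have 1: "mult_quot ?J = ?d^2 - ?d * ?e + ?e^2 - ?c" .
  have "?c \<le> fact k * coeff U k" using PIU by (intro mult_left_mono) auto
  also have "\<dots> = ?e ^ 2" using cU[of k] B(2) by simp
  finally have 2: "?c \<le> ?e ^ 2" .
  have 3: "mult_quot I = ?c" if "I \<noteq> UNIV"
  proof -
    have PI0: "PI \<noteq> 0" "k \<le> degree PI"
      using height_two_degree[OF k I_ideal I_proper_height(1)[OF that] PI] by blast+
    then have "degree PI = k" using degPI' by simp
    from mult_quot_eqI[OF I_hideal PI PI0(1) this] show ?thesis by simp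
  qed
  show ?thesis using 1 2 3 PIk by (intro exI[of _ ?c]) auto
qed

section \<open>Well-definedness of the Bourbaki degree, and the perfect case\<close>

section \<open>Minimal generators of the syzygy module\<close>

lemma homog3_nonneg: "homog3 m x \<Longrightarrow> x \<noteq> 0 \<Longrightarrow> 0 \<le> m"
  for x :: "('n::finite, 'k::field) poly3"
  by (cases x) (auto simp: zero_prod_def dest: homog_neg simp flip: not_less)

context syzygy_pair
begin

lemma \<nu>_in_M: "\<nu> \<in> M" by (rule syz)

text \<open>A maximal member among the ideals generated by finitely many forms of I must contain
  every form of I.\<close>

lemma I_finitely_generated:
  "\<exists>T. finite T \<and> T \<subseteq> I \<and> (\<forall>t\<in>T. \<exists>m. homog m t) \<and> ideal_gen T = I"
proof -
  let ?Q = "\<lambda>T. finite T \<and> T \<subseteq> I \<and> (\<forall>t\<in>T. \<exists>m. homog m t)"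
  have "?Q {}" by simp
  then have "ideal_gen {} \<in> {ideal_gen T | T. ?Q T}" by blast
  then have "\<exists>K\<in>{ideal_gen T | T. ?Q T}. \<forall>K'\<in>{ideal_gen T | T. ?Q T}. K \<subseteq> K' \<longrightarrow> K' = K"
    by (rule ideal_family_maximal) auto
  then obtain K where K: "K \<in> {ideal_gen T | T. ?Q T}" "\<forall>K'\<in>{ideal_gen T | T. ?Q T}. K \<subseteq> K' \<longrightarrow> K' = K"
    by (rule bexE)
  from K(1) obtain T where KT: "K = ideal_gen T" and T: "?Q T" by blast
  have max: "ideal_gen T' = ideal_gen T" if "?Q T'" "ideal_gen T \<subseteq> ideal_gen T'" for T'
  proof -
    have "ideal_gen T' \<in> {ideal_gen T | T. ?Q T}" using that(1) by blast
    then show ?thesis using K(2) that(2) unfolding KT by blast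
  qed
  have sub: "ideal_gen T \<subseteq> I" using T I_ideal by (intro ring_mod.span_minimal) auto
  have hom: "p \<in> ideal_gen T" if p: "p \<in> I" "homog m p" for p m
  proof -
    have "?Q (insert p T)" using T p by auto
    moreover have "ideal_gen T \<subseteq> ideal_gen (insert p T)" by (rule ring_mod.span_mono) blast
    ultimately have "ideal_gen (insert p T) = ideal_gen T" by (rule max)
    then show ?thesis using ring_mod.span_base[of p "insert p T"] by simp
  qed
  have "I \<subseteq> ideal_gen T"
  proof
    fix p assume p: "p \<in> I"
    show "p \<in> ideal_gen T"
    proof (rule ideal_hcomps)
      fix m
      have "hcomp m p \<in> I" using I_hideal p unfolding hideal_def by blast
      then show "hcomp m p \<in> ideal_gen T" using hom homog_hcomp by blast
    qed simp
  qed
  then show ?thesis using T sub by blast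
qed

text \<open>Homogeneous lifts of generators of I generate Syz(J) together with \<nu>, because \<nu>
  spans the kernel of the map to I.\<close>

lemma M_finite_generators:
  "\<exists>G. finite G \<and> \<nu> \<in> G \<and> (\<forall>x\<in>G. \<exists>m. homog3 m x) \<and> mod3.span G = M"
proof -
  obtain T where T: "finite T" "T \<subseteq> I" "\<And>t. t \<in> T \<Longrightarrow> \<exists>m. homog m t" "ideal_gen T = I"
    using I_finitely_generated by blast
  have "\<exists>w. w \<in> M \<and> (\<exists>m. homog3 m w) \<and> cross3 \<nu> w = scale3 t f" if t: "t \<in> T" for t
  proof -
    obtain w where w: "w \<in> M" "cross3 \<nu> w = scale3 t f" using I_E T(2) t by blast
    obtain m where m: "homog m t" using T(3)[OF t] by blast
    have "cross3 \<nu> (hcomp3 (m + int d - int e) w) = scale3 t f"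
      using cross3_hcomp[OF w(2), of m] hcomp_homog[OF m, of m] by simp
    then show ?thesis using M_hcomp3[OF w(1)] homog3_hcomp3 by blast
  qed
  then obtain W where W: "\<And>t. t \<in> T \<Longrightarrow> W t \<in> M" "\<And>t. t \<in> T \<Longrightarrow> \<exists>m. homog3 m (W t)"
      "\<And>t. t \<in> T \<Longrightarrow> cross3 \<nu> (W t) = scale3 t f" by metis
  let ?G = "insert \<nu> (W ` T)"
  have "mod3.span ?G \<subseteq> M"
    by (rule mod3.span_minimal[OF _ M_subspace]) (use W(1) \<nu>_in_M in blast)
  moreover have "M \<subseteq> mod3.span ?G"
  proof
    fix a assume a: "a \<in> M"
    have ex: "\<exists>b\<in>mod3.span (W ` T). cross3 \<nu> b = scale3 g f" if "g \<in> ideal_gen T" for g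
      using that
    proof (induction rule: ring_mod.span_induct_alt)
      case base
      then show ?case using mod3.span_zero by (intro bexI[of _ 0]) (simp_all add: zero_prod_def)
    next
      case (step c t y)
      then obtain b where b: "b \<in> mod3.span (W ` T)" "cross3 \<nu> b = scale3 y f" by blast
      have "scale3 c (W t) + b \<in> mod3.span (W ` T)"
        by (rule mod3.span_add[OF mod3.span_scale[OF mod3.span_base] b(1)]) (use step(1) in blast)
      moreover have "cross3 \<nu> (scale3 c (W t) + b) = scale3 (c * t + y) f"
        by (simp only: cross3_add cross3_scale W(3)[OF step(1)] b(2) scale3_mult mod3.scale_left_distrib)
      ultimately show ?case by blast
    qed
    have c: "cross3 \<nu> a = scale3 (h a) f" by (rule h_cross[OF a])
    then have "h a \<in> ideal_gen T" unfolding T(4) I_def by blast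
    then obtain b where b: "b \<in> mod3.span (W ` T)" "cross3 \<nu> b = scale3 (h a) f" using ex by blast
    have "cross3 \<nu> (a - b) = 0" by (simp only: cross3_diff b(2) c diff_self)
    then obtain r where r: "a - b = scale3 r \<nu>" using cross_eq_0_iff by blast
    have "b \<in> mod3.span ?G" using b(1) mod3.span_mono[of "W ` T" ?G] by blast
    moreover have "scale3 r \<nu> \<in> mod3.span ?G" by (intro mod3.span_scale mod3.span_base) simp
    ultimately have "scale3 r \<nu> + b \<in> mod3.span ?G" by (intro mod3.span_add)
    then show "a \<in> mod3.span ?G" by (simp only: r[symmetric] diff_add_cancel)
  qed
  moreover have "\<forall>x\<in>?G. \<exists>m. homog3 m x" using W(2) ha3 by blast
  ultimately show ?thesis using T(1) by (intro exI[of _ ?G]) auto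
qed

text \<open>In a homogeneous expression of \<nu> by H, the coefficient of x has degree e minus the
  degree of x. No nonzero syzygy has degree below e, so a coefficient that contributes is a nonzero
  constant and the expression can be solved for x.\<close>

lemma \<nu>_exchange:
  assumes min: "\<forall>m. \<forall>a\<in>M. a \<noteq> 0 \<longrightarrow> homog3 (int m) a \<longrightarrow> e \<le> m"
    and H: "finite H" "H \<subseteq> M" "\<And>x. x \<in> H \<Longrightarrow> \<exists>m. homog3 m x" "\<nu> \<in> mod3.span H"
  shows "\<exists>x\<in>H. x \<in> mod3.span (insert \<nu> (H - {x}))"
proof -
  obtain u where u: "\<nu> = (\<Sum>v\<in>H. scale3 (u v) v)" using H(4) unfolding mod3.span_finite[OF H(1)] by blast
  obtain \<delta> where \<delta>: "\<And>v. v \<in> H \<Longrightarrow> homog3 (\<delta> v) v" using H(3) by metis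
  let ?c = "\<lambda>v. hcomp (int e - \<delta> v) (u v)"
  have "\<nu> = hcomp3 (int e) \<nu>" using hcomp3_homog3[OF ha3, of "int e"] by simp
  also have "\<dots> = (\<Sum>v\<in>H. hcomp3 (int e) (scale3 (u v) v))" by (subst u) (rule hcomp3_sum)
  also have "\<dots> = (\<Sum>v\<in>H. scale3 (?c v) v)"
    by (intro sum.cong refl hcomp3_scale3 \<delta>)
  finally have \<nu>: "\<nu> = (\<Sum>v\<in>H. scale3 (?c v) v)" .
  have "\<exists>x\<in>H. scale3 (?c x) x \<noteq> 0"
  proof (rule ccontr)
    assume "\<not> ?thesis"
    then have "(\<Sum>v\<in>H. scale3 (?c v) v) = 0" by (intro sum.neutral) blast
    then show False using \<nu> \<nu>_neq_0 by metis
  qed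
  then obtain x where x: "x \<in> H" "scale3 (?c x) x \<noteq> 0" by blast
  then have x0: "x \<noteq> 0" "?c x \<noteq> 0" by (auto simp: scale3_def zero_prod_def)
  obtain m where m: "\<delta> x = int m" using homog3_nonneg[OF \<delta>[OF x(1)] x0(1)] nonneg_int_cases by metis
  have "e \<le> m" using min H(2) x(1) x0(1) \<delta>[OF x(1)] unfolding m by blast
  moreover have "int e - \<delta> x \<ge> 0"
    using homog_neg[OF homog_hcomp[of "int e - \<delta> x" "u x"]] x0(2) by force
  ultimately have "homog (int 0) (?c x)" using homog_hcomp[of "int e - \<delta> x" "u x"] m by simp
  then have "?c x dvd 1" using tdeg_homog[of 0 "?c x"] x0(2) mpol_dvd_1_iff by blast
  then obtain i where i: "1 = ?c x * i" by blast
  have split: "\<nu> = scale3 (?c x) x + (\<Sum>v\<in>H - {x}. scale3 (?c v) v)"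
    using \<nu> sum.remove[OF H(1) x(1), of "\<lambda>v. scale3 (?c v) v"] by metis
  let ?S = "mod3.span (insert \<nu> (H - {x}))"
  have "(\<Sum>v\<in>H - {x}. scale3 (?c v) v) \<in> ?S"
    by (intro mod3.span_sum mod3.span_scale mod3.span_base) simp
  moreover have "\<nu> \<in> ?S" by (intro mod3.span_base) simp
  ultimately have "\<nu> - (\<Sum>v\<in>H - {x}. scale3 (?c v) v) \<in> ?S" by (intro mod3.span_diff)
  moreover have "\<nu> - (\<Sum>v\<in>H - {x}. scale3 (?c v) v) = scale3 (?c x) x"
    by (rule diff_eq_eq[THEN iffD2]) (rule split)
  ultimately have "scale3 (?c x) x \<in> ?S" by (simp only:)
  then have "scale3 i (scale3 (?c x) x) \<in> ?S" by (rule mod3.span_scale)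
  moreover have "scale3 i (scale3 (?c x) x) = x"
    unfolding scale3_mult mult.commute[of i] i[symmetric] by (rule mod3.scale_one)
  ultimately have "x \<in> ?S" by (simp only:)
  then show ?thesis using x(1) by blast
qed

text \<open>Take a finite homogeneous generating set containing \<nu> of least cardinality. A proper
  subset that still generates cannot contain \<nu>, and exchanging one of its members for \<nu>
  produces a set containing \<nu> that is still too small.\<close>

lemma \<nu>_minimal_generator:
  assumes min: "\<forall>m. \<forall>a\<in>M. a \<noteq> 0 \<longrightarrow> homog3 (int m) a \<longrightarrow> e \<le> m"
  shows "minimal_generator M \<nu>"
proof -
  let ?Q = "\<lambda>G. finite G \<and> \<nu> \<in> G \<and> (\<forall>x\<in>G. \<exists>m. homog3 m x) \<and> mod3.span G = M"
  obtain G0 where "?Q G0" using M_finite_generators by blast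
  then obtain G where G: "?Q G" and least: "\<And>H. ?Q H \<Longrightarrow> card G \<le> card H"
    using ex_has_least_nat[of ?Q G0 card] by blast
  have "mod3.span H \<noteq> M" if HG: "H \<subset> G" for H
  proof
    assume sH: "mod3.span H = M"
    have H: "finite H" "H \<subseteq> M" "\<And>x. x \<in> H \<Longrightarrow> \<exists>m. homog3 m x"
      using HG G finite_subset mod3.span_superset[of H] sH by blast+
    have lt: "card H < card G" using G HG psubset_card_mono by blast
    show False
    proof (cases "\<nu> \<in> H")
      case True
      then have "?Q H" using H sH by blast
      then show False using least[of H] lt by simp
    next
      case False
      have "\<nu> \<in> mod3.span H" using sH \<nu>_in_M by simp
      then obtain x where x: "x \<in> H" "x \<in> mod3.span (insert \<nu> (H - {x}))"
        using \<nu>_exchange[OF min H] by blast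
      let ?H = "insert \<nu> (H - {x})"
      have "H \<subseteq> mod3.span ?H"
      proof
        fix y assume "y \<in> H"
        then show "y \<in> mod3.span ?H" using x(2) mod3.span_base[of y ?H] by (cases "y = x") auto
      qed
      then have "M \<subseteq> mod3.span ?H" using sH mod3.span_minimal[of H "mod3.span ?H"] by simp
      moreover have "mod3.span ?H \<subseteq> M"
        by (rule mod3.span_minimal[OF _ M_subspace]) (use H(2) \<nu>_in_M in blast)
      ultimately have "mod3.span ?H = M" by blast
      moreover have "\<forall>y\<in>?H. \<exists>m. homog3 m y" using H(3) ha3 by blast
      ultimately have "?Q ?H" using H(1) by blast
      then have "card G \<le> card ?H" by (rule least)
      moreover have "card ?H = Suc (card (H - {x}))"
        using False H(1) by (intro card_insert_disjoint) auto
      moreover have "Suc (card (H - {x})) = card H" by (rule card_Suc_Diff1[OF H(1) x(1)])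
      ultimately show False using lt by simp
    qed
  qed
  then have "minimally_generates scale3 G M" unfolding minimally_generates_def using G by blast
  then show ?thesis unfolding minimal_generator_def using G by blast
qed

section \<open>Uniqueness of the Bourbaki ideal\<close>

text \<open>The maps h and h' have the same kernel R\<nu>, and h(v) w - h(w) v lies in it, which
  gives \<open>h v * h' w = h w * h' v\<close>. Since h takes the coprime values a1, a2, a3, the
  ratio g of h' to h is a polynomial, and height two of I' = g I forces g to be a unit.\<close>

lemma bourbaki_ideal_unique:
  assumes iso: "quot_iso_shift M \<nu> I'" and hI': "height I' = 2" shows "I' = I"
proof -
  obtain h' where h': "\<And>a b. a \<in> M \<Longrightarrow> b \<in> M \<Longrightarrow> h' (a + b) = h' a + h' b"
      "\<And>r a. a \<in> M \<Longrightarrow> h' (scale3 r a) = r * h' a" "h' ` M = I'"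
      "{a \<in> M. h' a = 0} = mod3.span {\<nu>}"
    using iso unfolding quot_iso_shift_def by blast
  have comm: "h v * h' w = h w * h' v" if vw: "v \<in> M" "w \<in> M" for v w
  proof -
    let ?x = "scale3 (h v) w" and ?y = "scale3 (- h w) v"
    have xy: "?x \<in> M" "?y \<in> M" using vw mod3.subspace_scale[OF M_subspace] by blast+
    have "cross3 \<nu> (?x + ?y) = scale3 (h v * h w + - h w * h v) f"
      by (simp only: cross3_add cross3_scale h_cross[OF vw(1)] h_cross[OF vw(2)] scale3_mult mod3.scale_left_distrib)
    also have "\<dots> = 0" by (simp add: mult.commute zero_prod_def)
    finally obtain r where "?x + ?y = scale3 r \<nu>" using cross_eq_0_iff by blast
    then have "?x + ?y \<in> mod3.span {\<nu>}" unfolding mod3.span_singleton by blast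
    then have "h' (?x + ?y) = 0" using h'(4) by blast
    moreover have "h' (?x + ?y) = h v * h' w + - h w * h' v"
      by (simp only: h'(1)[OF xy] h'(2)[OF vw(1)] h'(2)[OF vw(2)])
    ultimately have "h v * h' w + - h w * h' v = 0" by (simp only:)
    then show ?thesis by simp
  qed
  have hM: "h ` M = I"
  proof (intro equalityI subsetI)
    fix g assume "g \<in> h ` M"
    then show "g \<in> I" unfolding I_def using h_cross by blast
  next
    fix g assume "g \<in> I"
    then obtain w where "w \<in> M" "cross3 \<nu> w = scale3 g f" using I_E by blast
    then show "g \<in> h ` M" using h_eqI by blast
  qed
  obtain a where a: "a \<in> {a1, a2, a3}" "a \<noteq> 0" using no_common_prime_nonzero[OF ca] by blast
  then have "a \<in> h ` M" using a_in_I hM by blast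
  then obtain w where w: "w \<in> M" "a = h w" by blast
  have "a dvd h' w * b" if b: "b \<in> {a1, a2, a3}" for b
  proof -
    have "b \<in> h ` M" using b a_in_I hM by blast
    then obtain v where v: "v \<in> M" "b = h v" by blast
    have "h' w * b = a * h' v" using comm[OF w(1) v(1)] unfolding w(2) v(2) by (simp only: mult.commute)
    then show ?thesis by simp
  qed
  then have "a dvd h' w" by (rule no_common_prime_dvd[OF ca a(2)])
  then obtain g where g: "h' w = a * g" by blast
  have h'g: "h' v = g * h v" if v: "v \<in> M" for v
  proof -
    have "a * h' v = h v * (a * g)" using comm[OF w(1) v] unfolding w(2)[symmetric] g .
    also have "\<dots> = a * (g * h v)" by (simp only: mult_ac)
    finally show ?thesis using a(2) by simp
  qed
  have I'g: "I' = (\<lambda>x. g * x) ` I" unfolding h'(3)[symmetric] hM[symmetric] image_image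
    by (rule image_cong) (use h'g in auto)
  have g_unit: "g dvd 1"
  proof (rule ccontr)
    assume "\<not> g dvd 1"
    have "\<exists>p. prime_elem p \<and> p dvd g"
    \<comment> \<open>For g = 0 any prime will do, since it divides 0.\<close>
    proof (cases "g = 0")
      case True
      then show ?thesis using ex_prime_elem[where 'n = 'n and 'k = 'k] by auto
    next
      case False
      then show ?thesis using ex_prime_factor \<open>\<not> g dvd 1\<close> by blast
    qed
    then obtain p where p: "prime_elem p" "p dvd g" by blast
    then have "I' \<subseteq> {x. p dvd x}" unfolding I'g by auto
    then show False using height_two_not_subset_principal[OF hI' p(1)] by blast
  qed
  then obtain i where i: "1 = g * i" by blast
  show ?thesis
  proof (intro equalityI subsetI)
    fix x assume "x \<in> I'"
    then show "x \<in> I" using I'g ideal_mult[OF I_ideal] by blast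
  next
    fix x assume "x \<in> I"
    then have "i * x \<in> I" by (rule ideal_mult[OF I_ideal])
    moreover have "x = g * (i * x)" by (metis i mult.assoc mult_1_left)
    ultimately show "x \<in> I'" using I'g by blast
  qed
qed

end

section \<open>Perfect ideals\<close>

lemma mult_mat_vec_index:
  "i < nr \<Longrightarrow> v \<in> carrier_vec nc \<Longrightarrow> (mat nr nc g *\<^sub>v v) $ i = (\<Sum>j<nc. g (i, j) * v $ j)"
  by (auto simp: scalar_prod_def lessThan_atLeast0)

lemma sum_lessThan_2: "(\<Sum>j<2::nat. g j) = g 0 + (g 1 :: 'a::comm_monoid_add)"
  by (simp add: numeral_2_eq_2)

lemma sum_lessThan_3: "(\<Sum>j<3::nat. g j) = g 0 + g 1 + (g 2 :: 'a::comm_monoid_add)"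
  by (simp add: eval_nat_numeral)

lemma less_3_cases: "i < (3::nat) \<longleftrightarrow> i = 0 \<or> i = 1 \<or> i = 2" by auto

text \<open>In a resolution of length at most one the map onto J is injective. Two of its entries
  would satisfy the Koszul relation, so J has at most one generator, and a proper principal ideal
  lies in a prime of height at most one.\<close>

lemma proj_dim_quot_ge_2:
  fixes J :: "('n::{finite, linorder}, 'k::field) mpol set"
  assumes h: "height J = 2" shows "2 \<le> proj_dim_quot J"
  unfolding proj_dim_quot_def
proof (rule Inf_greatest)
  fix x assume "x \<in> {enat p |p. \<exists>s \<phi>. graded_free_res J p s \<phi>}"
  then obtain p s \<phi> where x: "x = enat p" and res: "graded_free_res J p s \<phi>" by blast
  have "2 \<le> p"
  proof (rule ccontr)
    assume "\<not> 2 \<le> p"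
    then have s2: "s (Suc (Suc 0)) = []" using res unfolding graded_free_res_def by simp
    let ?n = "length (s (Suc 0))"
    have c0: "\<phi> 0 \<in> carrier_mat 1 ?n"
      using res unfolding graded_free_res_def graded_map_def by (metis One_nat_def length_Cons list.size(3))
    have c1: "\<phi> (Suc 0) \<in> carrier_mat ?n 0"
      using res s2 unfolding graded_free_res_def graded_map_def by (metis list.size(3))
    have "mat_ker (\<phi> 0) = mat_image (\<phi> (Suc 0))" using res unfolding graded_free_res_def by blast
    moreover have "mat_image (\<phi> (Suc 0)) \<subseteq> {0\<^sub>v ?n}"
    proof
      fix v assume "v \<in> mat_image (\<phi> (Suc 0))"
      then obtain u where u: "u \<in> carrier_vec 0" "v = \<phi> (Suc 0) *\<^sub>v u" using c1 by (auto simp: mat_image_def)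
      have "v = 0\<^sub>v ?n" unfolding u(2) using c1 u(1) by (intro eq_vecI) (auto simp: scalar_prod_def)
      then show "v \<in> {0\<^sub>v ?n}" by simp
    qed
    ultimately have sub: "mat_ker (\<phi> 0) \<subseteq> {0\<^sub>v ?n}" by simp
    have ker: "v = 0\<^sub>v ?n" if "v \<in> carrier_vec ?n" "\<phi> 0 *\<^sub>v v = 0\<^sub>v 1" for v
    proof -
      have "v \<in> mat_ker (\<phi> 0)" using that c0 by (simp add: mat_ker_def)
      then show ?thesis using sub by blast
    qed
    let ?a = "\<lambda>j. \<phi> 0 $$ (0, j)"
    have app: "(\<phi> 0 *\<^sub>v v) $ 0 = (\<Sum>j<?n. ?a j * v $ j)" if "v \<in> carrier_vec ?n" for v
      using that c0 by (auto simp: scalar_prod_def lessThan_atLeast0)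
    have ker': "v = 0\<^sub>v ?n" if "v \<in> carrier_vec ?n" "(\<Sum>j<?n. ?a j * v $ j) = 0" for v
    proof (rule ker[OF that(1)])
      show "\<phi> 0 *\<^sub>v v = 0\<^sub>v 1" using app[OF that(1)] that(2) c0 by (intro eq_vecI) auto
    qed
    have J: "J = {\<Sum>j<?n. ?a j * v $ j | v. v \<in> carrier_vec ?n}"
    proof -
      have "J = (\<lambda>v. v $ 0) ` mat_image (\<phi> 0)" using res unfolding graded_free_res_def by blast
      also have "mat_image (\<phi> 0) = (\<lambda>v. \<phi> 0 *\<^sub>v v) ` carrier_vec ?n" using c0 by (simp add: mat_image_def)
      also have "(\<lambda>v. v $ 0) ` (\<lambda>v. \<phi> 0 *\<^sub>v v) ` carrier_vec ?n =
          (\<lambda>v. \<Sum>j<?n. ?a j * v $ j) ` carrier_vec ?n"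
        unfolding image_image by (rule image_cong[OF refl app])
      finally show ?thesis by (simp only: Setcompr_eq_image)
    qed
    have n1: "?n \<le> 1"
    proof (rule ccontr)
      assume "\<not> ?n \<le> 1"
      then have n: "0 < ?n" "1 < ?n" by auto
      have two: "(\<Sum>j<?n. ?a j * (vec ?n (\<lambda>j. if j = 0 then y else if j = 1 then z else 0)) $ j) = ?a 0 * y + ?a 1 * z" for y z
      proof -
        have "(\<Sum>j<?n. ?a j * (vec ?n (\<lambda>j. if j = 0 then y else if j = 1 then z else 0)) $ j) =
            (\<Sum>j<?n. (if j = 0 then ?a 0 * y else 0) + (if j = 1 then ?a 1 * z else 0))"
          by (intro sum.cong) auto
        also have "\<dots> = ?a 0 * y + ?a 1 * z" unfolding sum.distrib using n by simp
        finally show ?thesis .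
      qed
      have z: "y = 0 \<and> z = 0" if "?a 0 * y + ?a 1 * z = 0" for y z
      proof -
        let ?v = "vec ?n (\<lambda>j. if j = 0 then y else if j = 1 then z else 0)"
        have "?v = 0\<^sub>v ?n" by (rule ker') (use two that in auto)
        then have "?v $ 0 = 0 \<and> ?v $ 1 = 0" using n by simp
        then show ?thesis using n by simp
      qed
      \<comment> \<open>The Koszul relation forces the first entry to vanish, after which (1, 0)
        becomes a nonzero kernel vector.\<close>
      have "?a 0 = 0" using z[of "?a 1" "- ?a 0"] by (simp add: mult.commute)
      then show False using z[of 1 0] by simp
    qed
    have "\<exists>a. J = {a * r | r. True}"
    proof (cases "?n = 0")
      case True
      then have "J = {0}" unfolding J by (auto intro: exI[of _ "0\<^sub>v 0"])
      then show ?thesis by (intro exI[of _ 0]) auto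
    next
      case False
      then have n: "?n = 1" using n1 by linarith
      have "J = {?a 0 * r | r. True}"
      proof (intro equalityI subsetI)
        fix q assume "q \<in> {?a 0 * r | r. True}"
        then obtain r where r: "q = ?a 0 * r" by blast
        have "q = (\<Sum>j<?n. ?a j * (vec 1 (\<lambda>_. r)) $ j)" unfolding n r by simp
        then show "q \<in> J" unfolding J n by (intro CollectI exI[of _ "vec 1 (\<lambda>_. r)"]) auto
      qed (auto simp: J n)
      then show ?thesis by blast
    qed
    then obtain a where a: "J = {a * r | r. True}" by blast
    obtain P where P: "is_prime_ideal P" "J \<subseteq> P" using height_two_witness[OF h] by blast
    have "a \<in> J" unfolding a by (intro CollectI exI[of _ 1]) simp
    then have "\<not> a dvd 1" using P unit_in_ideal[OF prime_ideal_is_ideal[OF P(1)], of a] by (auto simp: is_prime_ideal_def)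
    then have "\<exists>p. prime_elem p \<and> p dvd a"
      using ex_prime_factor[of a] ex_prime_elem[where 'n = 'n and 'k = 'k] by (cases "a = 0") auto
    then obtain p where p: "prime_elem p" "p dvd a" by blast
    then have "J \<subseteq> {x. p dvd x}" unfolding a by auto
    then show False using height_two_not_subset_principal[OF h p(1)] by blast
  qed
  then show "2 \<le> x" using x by (simp add: numeral_eq_enat)
qed

context syzygy_pair
begin

text \<open>From 1 in I comes a second syzygy w with \<nu> \<times> w = f, the Hilbert-Burch form of
  the generators. Then \<nu> and w are a basis of Syz(J), and the resulting resolution has length
  two, the height of J.\<close>

lemma perfect_if_I_UNIV:
  assumes "I = UNIV" and hJ: "height (ideal_gen {f1, f2, f3}) = 2"
  shows "perfect_ideal (ideal_gen {f1, f2, f3})"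
proof -
  let ?J = "ideal_gen {f1, f2, f3}"
  have "1 \<in> I" using assms by simp
  then obtain w' where w': "w' \<in> M" "cross3 \<nu> w' = scale3 1 f" using I_E by blast
  \<comment> \<open>The component in degree d - e, where \<nu> \<times> w has the degree d of
    f.\<close>
  define w where "w = hcomp3 (int d - int e) w'"
  have "hcomp 0 (1 :: ('n, 'k) mpol) = 1" using hcomp_homog[of 0 "1 :: ('n, 'k) mpol" 0] by (simp add: homog_def)
  then have wf: "cross3 \<nu> w = f"
    using cross3_hcomp[OF w'(2), of 0] by (simp add: w_def mod3.scale_one del: cross3_simp scale3_simp)
  have wM: "w \<in> M" and wh: "homog3 (int d - int e) w"
    unfolding w_def using M_hcomp3[OF w'(1)] homog3_hcomp3 by blast+
  obtain w1 w2 w3 where w: "w = (w1, w2, w3)" by (metis prod_cases3)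
  have M_gen: "\<exists>r s. a = scale3 r \<nu> + scale3 s w" if a: "a \<in> M" for a
  proof -
    have "cross3 \<nu> (a - scale3 (h a) w) = 0" by (simp only: cross3_diff cross3_scale wf h_cross[OF a] diff_self)
    then obtain r where "a - scale3 (h a) w = scale3 r \<nu>" using cross_eq_0_iff by blast
    then have "a = scale3 r \<nu> + scale3 (h a) w" by (rule diff_eq_eq[THEN iffD1])
    then show ?thesis by blast
  qed
  have M_comb: "scale3 r \<nu> + scale3 s w \<in> M" for r s
    using mod3.subspace_add[OF M_subspace mod3.subspace_scale[OF M_subspace \<nu>_in_M] mod3.subspace_scale[OF M_subspace wM]] .
  have M_free: "r = 0 \<and> s = 0" if z: "scale3 r \<nu> + scale3 s w = 0" for r s
  proof -
    have "scale3 s f = cross3 \<nu> (scale3 r \<nu> + scale3 s w)"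
      by (simp only: cross3_add cross3_scale[of _ s] cross3_self wf add_0_left)
    then have "scale3 s f = scale3 0 f" unfolding z by (simp add: zero_prod_def)
    then have s: "s = 0" by (rule scale3_cancel_right[OF f_neq_0])
    then have "scale3 r \<nu> = scale3 0 \<nu>" using z by (simp add: w zero_prod_def)
    then show ?thesis using s scale3_cancel_right[OF \<nu>_neq_0] by blast
  qed
  define g0 where "g0 = (\<lambda>(i :: nat, j :: nat). if j = 0 then f1 else if j = 1 then f2 else f3)"
  define g1 where "g1 = (\<lambda>(i :: nat, j :: nat). if j = 0 then (if i = 0 then a1 else if i = 1 then a2 else a3)
    else (if i = 0 then w1 else if i = 1 then w2 else w3))"
  \<comment> \<open>The middle module is generated in degree d, so its relations \<nu> and w sit in
    degrees d + e and d + (d - e).\<close>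
  define s :: "nat \<Rightarrow> int list" where "s = (\<lambda>i. if i = 0 then [0] else if i = 1 then [int d, int d, int d]
    else if i = 2 then [int d + int e, 2 * int d - int e] else [])"
  \<comment> \<open>Past the resolution the matrices have no columns, but their number of rows must
    still match \<open>s i\<close>, which has length 2 at i = 2.\<close>
  define \<phi> where "\<phi> = (\<lambda>i. if i = 0 then mat 1 3 g0 else if i = 1 then mat 3 2 g1
    else mat (length (s i)) 0 (\<lambda>_. 0 :: ('n, 'k) mpol))"
  have \<phi>0: "(mat 1 3 g0 *\<^sub>v v) $ 0 = dot3 (v $ 0, v $ 1, v $ 2) f" if "v \<in> carrier_vec 3" for v
    using mult_mat_vec_index[of 0 1 v 3 g0] that by (simp add: sum_lessThan_3 g0_def mult.commute)
  have \<phi>1: "((mat 3 2 g1 *\<^sub>v v) $ 0, (mat 3 2 g1 *\<^sub>v v) $ 1, (mat 3 2 g1 *\<^sub>v v) $ 2) =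
      scale3 (v $ 0) \<nu> + scale3 (v $ 1) w" if "v \<in> carrier_vec 2" for v
    using mult_mat_vec_index[of 0 3 v 2 g1] mult_mat_vec_index[of 1 3 v 2 g1] mult_mat_vec_index[of 2 3 v 2 g1] that
    by (simp add: sum_lessThan_2 g1_def w mult.commute)
  have vec3_eqI: "u = v" if "u \<in> carrier_vec 3" "v \<in> carrier_vec 3" "(u $ 0, u $ 1, u $ 2) = (v $ 0, v $ 1, v $ 2)"
    for u v :: "('n, 'k) mpol vec"
    using that by (intro eq_vecI) (auto simp: less_3_cases)
  have img0: "(\<lambda>v. v $ 0) ` mat_image (mat 1 3 g0) = ?J"
  proof (intro equalityI subsetI)
    fix p assume "p \<in> (\<lambda>v. v $ 0) ` mat_image (mat 1 3 g0)"
    then obtain v where "v \<in> carrier_vec 3" "p = (mat 1 3 g0 *\<^sub>v v) $ 0" by (auto simp: mat_image_def)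
    then have "p = dot3 (v $ 0, v $ 1, v $ 2) f" using \<phi>0 by blast
    then show "p \<in> ?J" unfolding ideal_gen_f by blast
  next
    fix p assume "p \<in> ?J"
    then obtain c where c: "p = dot3 c f" unfolding ideal_gen_f by blast
    obtain c1 c2 c3 where c': "c = (c1, c2, c3)" by (metis prod_cases3)
    let ?v = "vec 3 (\<lambda>i. if i = 0 then c1 else if i = 1 then c2 else c3)"
    have "p = (mat 1 3 g0 *\<^sub>v ?v) $ 0" using \<phi>0[of ?v] by (simp add: c c')
    moreover have "mat 1 3 g0 *\<^sub>v ?v \<in> mat_image (mat 1 3 g0)"
      unfolding mat_image_def by (rule imageI) simp
    ultimately show "p \<in> (\<lambda>v. v $ 0) ` mat_image (mat 1 3 g0)" by (rule image_eqI)
  qed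
  have ker0: "mat_ker (mat 1 3 g0) = mat_image (mat 3 2 g1)"
  proof (intro equalityI subsetI)
    fix v assume v: "v \<in> mat_ker (mat 1 3 g0)"
    then have v3: "v \<in> carrier_vec 3" and "mat 1 3 g0 *\<^sub>v v = 0\<^sub>v 1" by (auto simp: mat_ker_def)
    then have "dot3 (v $ 0, v $ 1, v $ 2) f = 0" using \<phi>0[OF v3] by simp
    then have "(v $ 0, v $ 1, v $ 2) \<in> M" unfolding Syz_iff .
    then obtain r t where rt: "(v $ 0, v $ 1, v $ 2) = scale3 r \<nu> + scale3 t w" using M_gen by blast
    let ?u = "vec 2 (\<lambda>i. if i = 0 then r else t)"
    have "v = mat 3 2 g1 *\<^sub>v ?u"
    proof (rule vec3_eqI[OF v3])
      show "mat 3 2 g1 *\<^sub>v ?u \<in> carrier_vec 3" by (auto intro: carrier_vecI)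
      show "(v $ 0, v $ 1, v $ 2) = ((mat 3 2 g1 *\<^sub>v ?u) $ 0, (mat 3 2 g1 *\<^sub>v ?u) $ 1, (mat 3 2 g1 *\<^sub>v ?u) $ 2)"
        using \<phi>1[of ?u] rt by simp
    qed
    then show "v \<in> mat_image (mat 3 2 g1)" unfolding mat_image_def by auto
  next
    fix v assume "v \<in> mat_image (mat 3 2 g1)"
    then obtain u where u: "u \<in> carrier_vec 2" "v = mat 3 2 g1 *\<^sub>v u" by (auto simp: mat_image_def)
    have v3: "v \<in> carrier_vec 3" unfolding u(2) by (auto intro: carrier_vecI)
    have "(v $ 0, v $ 1, v $ 2) \<in> M" using \<phi>1[OF u(1)] M_comb unfolding u(2) by (simp only:)
    then have "dot3 (v $ 0, v $ 1, v $ 2) f = 0" unfolding Syz_iff .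
    then have "(mat 1 3 g0 *\<^sub>v v) $ 0 = 0" using \<phi>0[OF v3] by (simp only:)
    then have "mat 1 3 g0 *\<^sub>v v = 0\<^sub>v 1" by (intro eq_vecI) auto
    then show "v \<in> mat_ker (mat 1 3 g0)" using v3 by (simp add: mat_ker_def)
  qed
  have zero_cols: "mat_image (mat n 0 g) = {0\<^sub>v n}" for n and g :: "nat \<times> nat \<Rightarrow> ('n, 'k) mpol"
  proof -
    have "mat n 0 g *\<^sub>v v = 0\<^sub>v n" if "v \<in> carrier_vec 0" for v
      using that by (intro eq_vecI) (auto simp: scalar_prod_def)
    moreover have "carrier_vec 0 \<noteq> ({} :: ('n, 'k) mpol vec set)" using zero_carrier_vec by blast
    ultimately show ?thesis unfolding mat_image_def by auto
  qed
  have ker1: "mat_ker (mat 3 2 g1) = {0\<^sub>v 2}"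
  proof (intro equalityI subsetI)
    fix v assume "v \<in> mat_ker (mat 3 2 g1)"
    then have v: "v \<in> carrier_vec 2" "mat 3 2 g1 *\<^sub>v v = 0\<^sub>v 3" by (auto simp: mat_ker_def)
    then have "scale3 (v $ 0) \<nu> + scale3 (v $ 1) w = 0" using \<phi>1[OF v(1)] by (simp add: zero_prod_def)
    then have "v $ 0 = 0 \<and> v $ 1 = 0" by (rule M_free)
    then have "v = 0\<^sub>v 2" using v(1) by (intro eq_vecI) (auto simp: less_2_cases_iff)
    then show "v \<in> {0\<^sub>v 2}" by simp
  next
    fix v assume "v \<in> {0\<^sub>v 2 :: ('n, 'k) mpol vec}"
    then show "v \<in> mat_ker (mat 3 2 g1)" unfolding mat_ker_def by (auto intro!: eq_vecI simp: scalar_prod_def)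
  qed
  have ker2: "mat_ker (mat n 0 g) = {0\<^sub>v 0}" for n and g :: "nat \<times> nat \<Rightarrow> ('n, 'k) mpol"
  proof -
    have "v = 0\<^sub>v 0" if "v \<in> carrier_vec 0" for v :: "('n, 'k) mpol vec" using that by (intro eq_vecI) auto
    moreover have "mat n 0 g *\<^sub>v 0\<^sub>v 0 = 0\<^sub>v n" by (intro eq_vecI) (auto simp: scalar_prod_def)
    ultimately show ?thesis unfolding mat_ker_def by auto
  qed
  have "graded_free_res ?J 2 s \<phi>"
    unfolding graded_free_res_def
  proof (intro conjI allI)
    show "s 0 = [0]" by (simp add: s_def)
    show "2 < i \<longrightarrow> s i = []" for i by (simp add: s_def)
    show "graded_map (s i) (s (Suc i)) (\<phi> i)" for i
    proof -
      have wh': "homog (int d - int e) w1" "homog (int d - int e) w2" "homog (int d - int e) w3" using wh w by auto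
      consider "i = 0" | "i = 1" | "i > 1" by linarith
      then show ?thesis
      proof cases
        case 1
        then show ?thesis using hf by (auto simp: graded_map_def s_def \<phi>_def g0_def less_Suc_eq)
      next
        case 2
        have e: "int d + int e - int d = int e" "2 * int d - int e - int d = int d - int e" by simp_all
        show ?thesis using 2 ha wh' e
          by (auto simp: graded_map_def s_def \<phi>_def g1_def less_Suc_eq)
      next
        case 3
        then show ?thesis by (auto simp: graded_map_def s_def \<phi>_def)
      qed
    qed
    show "(\<lambda>v. v $ 0) ` mat_image (\<phi> 0) = ?J" using img0 by (simp add: \<phi>_def)
    show "mat_ker (\<phi> i) = mat_image (\<phi> (Suc i))" for i
    proof -
      consider "i = 0" | "i = 1" | "i > 1" by linarith
      then show ?thesis
      proof cases
        case 1
        then show ?thesis using ker0 by (simp add: \<phi>_def)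
      next
        case 2
        then show ?thesis using ker1 zero_cols[of 2] by (simp add: \<phi>_def s_def numeral_2_eq_2)
      next
        case 3
        then show ?thesis using ker2 zero_cols by (simp add: \<phi>_def s_def)
      qed
    qed
  qed
  then have "proj_dim_quot ?J \<le> enat 2" unfolding proj_dim_quot_def by (intro Inf_lower) blast
  then show ?thesis
    using proj_dim_quot_ge_2[OF hJ] hJ by (simp add: perfect_ideal_def numeral_eq_enat)
qed

end

section \<open>The Bourbaki degree\<close>

text \<open>Dividing out a common prime leaves a syzygy of smaller degree. The quotient is not known
  to be homogeneous, so a nonzero component of it is used; its degree is below e because p has
  positive degree.\<close>

lemma syz_min_no_common_prime:
  fixes f1 f2 f3 a1 a2 a3 :: "('n::{finite, linorder}, 'k::field) mpol"
  assumes hf: "homog3 (int d) (f1, f2, f3)"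
    and a: "(a1, a2, a3) \<in> Syz f1 f2 f3" "(a1, a2, a3) \<noteq> 0" "homog3 (int e) (a1, a2, a3)"
    and min: "\<forall>m. \<forall>a\<in>Syz f1 f2 f3. a \<noteq> 0 \<longrightarrow> homog3 (int m) a \<longrightarrow> e \<le> m"
  shows "no_common_prime {a1, a2, a3}"
  unfolding no_common_prime_def
proof (intro allI impI, rule ccontr)
  fix p :: "('n, 'k) mpol"
  assume p: "prime_elem p" and n: "\<not> (\<exists>a\<in>{a1, a2, a3}. \<not> p dvd a)"
  then obtain c1 c2 c3 where c: "a1 = p * c1" "a2 = p * c2" "a3 = p * c3" by (auto simp: dvd_def)
  have p0: "p \<noteq> 0" "tdeg p \<ge> 1" using p mpol_dvd_1_iff[of p] by (auto simp: prime_elem_def)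
  let ?c = "(c1, c2, c3)"
  have a_eq: "(a1, a2, a3) = scale3 p ?c" by (simp add: c)
  then have "p * dot3 ?c (f1, f2, f3) = 0" using a(1) unfolding Syz_iff by (simp only: dot3_scale)
  then have dot: "dot3 ?c (f1, f2, f3) = 0" using p0 by simp
  have "?c \<noteq> 0" using a(2) a_eq by (auto simp: zero_prod_def)
  then obtain m where m: "hcomp3 m ?c \<noteq> 0"
    using hcomp3_eqI[of ?c 0] by (auto simp: zero_prod_def)
  then obtain k where k: "m = int k" using homog3_nonneg[OF homog3_hcomp3 m] nonneg_int_cases by metis
  have "dot3 (hcomp3 m ?c) (f1, f2, f3) = 0"
    using hcomp_dot3[OF hf, of "m + int d" ?c] dot by (simp del: dot3_simp hcomp3_simp)
  then have "hcomp3 m ?c \<in> Syz f1 f2 f3" unfolding Syz_iff .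
  then have ek: "e \<le> k" using min m homog3_hcomp3[of m ?c] unfolding k by blast
  have less: "k < e" if "hcomp m x \<noteq> 0" "homog (int e) (p * x)" for x
  proof -
    have x0: "x \<noteq> 0" using that by auto
    have "keys (hcomp m x) \<noteq> {}" using that(1) by simp
    then obtain t where t: "t \<in> keys (hcomp m x)" by blast
    then have "t \<in> keys x" "int (mon_deg t) = m" by (auto simp: hcomp_def keys_restrict)
    then have "k \<le> tdeg x" using mon_deg_le_tdeg[of t x] k by simp
    moreover have "tdeg (p * x) = e" using tdeg_homog[OF that(2)] p0 x0 by simp
    ultimately show ?thesis using tdeg_mult[OF p0(1) x0] p0(2) by simp
  qed
  have "hcomp m c1 \<noteq> 0 \<or> hcomp m c2 \<noteq> 0 \<or> hcomp m c3 \<noteq> 0" using m by (auto simp: zero_prod_def)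
  then have "k < e" using less a(3) c by auto
  then show False using ek by simp
qed

theorem theorem2p1:
  fixes f1 f2 f3 :: "('n::{finite, linorder}, 'k::{alg_closed_field, field_char_0}) mpol"
    and d e :: nat
  assumes "CARD('n) \<ge> 3"
    and "homog (int d) f1" and "homog (int d) f2" and "homog (int d) f3"
    and "card {f1, f2, f3} = 3"
    and "minimally_generates (*) {f1, f2, f3} (ideal_gen {f1, f2, f3})"
    and "height (ideal_gen {f1, f2, f3}) = 2"
    and "e = indeg (Syz f1 f2 f3)"
  shows "Bour f1 f2 f3 \<le> of_nat e ^ 2 \<and>
         of_nat d * (of_nat d - of_nat e) \<le> mult_quot (ideal_gen {f1, f2, f3}) \<and>
         mult_quot (ideal_gen {f1, f2, f3}) \<le> of_nat d ^ 2 - of_nat d * of_nat e + of_nat e ^ 2"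
proof -
  let ?M = "Syz f1 f2 f3" and ?J = "ideal_gen {f1, f2, f3}"
  let ?E = "\<lambda>e. \<exists>a\<in>?M. a \<noteq> 0 \<and> homog3 (int e) a"
  have cf: "no_common_prime {f1, f2, f3}" by (rule height_two_no_common_prime[OF assms(7)])
  have hf3: "homog3 (int d) (f1, f2, f3)" using assms by simp
  \<comment> \<open>A Koszul syzygy in degree d shows that the least degree defining e is
    attained.\<close>
  have "?E d"
  proof (cases "f1 = 0 \<and> f2 = 0")
    case True
    then have "f3 \<noteq> 0" using no_common_prime_nonzero[OF cf] by auto
    then show ?thesis using assms True
      by (intro bexI[of _ "(f3, 0, - f1)"]) (auto simp: Syz_iff zero_prod_def mult.commute homog_uminus)
  next
    case False
    then show ?thesis using assms
      by (intro bexI[of _ "(f2, - f1, 0)"]) (auto simp: Syz_iff zero_prod_def mult.commute homog_uminus)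
  qed
  then have Ee: "?E e" unfolding assms(8) indeg_def by (rule LeastI)
  have min: "\<forall>m. \<forall>a\<in>?M. a \<noteq> 0 \<longrightarrow> homog3 (int m) a \<longrightarrow> e \<le> m"
    unfolding assms(8) indeg_def by (auto intro: Least_le)
  have pair: "syzygy_pair f1 f2 f3 a1 a2 a3 d e"
    if "(a1, a2, a3) \<in> ?M" "(a1, a2, a3) \<noteq> 0" "homog3 (int e) (a1, a2, a3)" for a1 a2 a3
    using that syz_min_no_common_prime[OF hf3 that min] assms cf by unfold_locales auto
  obtain a where a: "a \<in> ?M" "a \<noteq> 0" "homog3 (int e) a" using Ee by blast
  obtain a1 a2 a3 where a': "a = (a1, a2, a3)" by (metis prod_cases3)
  interpret syzygy_pair f1 f2 f3 a1 a2 a3 d e by (rule pair) (use a a' in auto)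
  \<comment> \<open>An expression in d, e and J alone, hence the same number for every choice of
    \<nu>.\<close>
  let ?c = "of_nat d ^ 2 - of_nat d * of_nat e + of_nat e ^ 2 - mult_quot ?J"
  have formula: "0 \<le> ?c \<and> ?c \<le> of_nat e ^ 2 \<and>
      (syzygy_pair.I f1 f2 f3 b1 b2 b3 \<noteq> UNIV \<longrightarrow> mult_quot (syzygy_pair.I f1 f2 f3 b1 b2 b3) = ?c)"
    if "syzygy_pair f1 f2 f3 b1 b2 b3 d e" for b1 b2 b3
    using multiplicity_formula[OF that assms(1,7)] by auto
  note c = formula[OF syzygy_pair_axioms]
  have "Bour f1 f2 f3 \<le> of_nat e ^ 2"
  proof (cases "perfect_ideal ?J \<and> height ?J = 2")
    case True
    then show ?thesis by (simp add: Bour_def)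
  next
    case False
    then have np: "\<not> perfect_ideal ?J" using assms(7) by simp
    have "(THE b. \<exists>v K. minimal_generator ?M v \<and> homog3 (int (indeg ?M)) v \<and>
        bourbaki_ideal f1 f2 f3 v K \<and> b = mult_quot K) = ?c"
    proof (rule the_equality)
      have I: "I \<noteq> UNIV" using perfect_if_I_UNIV assms(7) np by blast
      have "minimal_generator ?M (a1, a2, a3)" by (rule \<nu>_minimal_generator[OF min])
      moreover have "bourbaki_ideal f1 f2 f3 (a1, a2, a3) I"
        unfolding bourbaki_ideal_def
        using hideal_homog_ideal[OF I_hideal] I_proper_height[OF I] quot_iso_I by blast
      ultimately show "\<exists>v K. minimal_generator ?M v \<and> homog3 (int (indeg ?M)) v \<and>
          bourbaki_ideal f1 f2 f3 v K \<and> ?c = mult_quot K"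
        using c I ha3 unfolding assms(8) by metis
    next
      fix b assume "\<exists>v K. minimal_generator ?M v \<and> homog3 (int (indeg ?M)) v \<and>
          bourbaki_ideal f1 f2 f3 v K \<and> b = mult_quot K"
      then obtain v K where v: "minimal_generator ?M v" "homog3 (int e) v" "bourbaki_ideal f1 f2 f3 v K"
          "b = mult_quot K" unfolding assms(8) by blast
      obtain G where G: "v \<in> G" "mod3.span G = ?M" "\<And>H. H \<subset> G \<Longrightarrow> mod3.span H \<noteq> ?M"
        using v(1) unfolding minimal_generator_def minimally_generates_def by blast
      have vM: "v \<in> ?M" using G mod3.span_base by blast
      \<comment> \<open>A zero generator could be dropped, against minimality of G. Being nonzero of
        degree e, v then has coprime entries and gives a second instance of the
        construction.\<close>
      have v0: "v \<noteq> 0"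
      proof
        assume "v = 0"
        have "G \<subseteq> mod3.span (G - {v})"
        proof
          fix x assume "x \<in> G"
          then show "x \<in> mod3.span (G - {v})"
            using \<open>v = 0\<close> by (cases "x = v") (auto intro: mod3.span_zero mod3.span_base)
        qed
        then have "mod3.span G \<subseteq> mod3.span (G - {v})" by (intro mod3.span_minimal) auto
        moreover have "mod3.span (G - {v}) \<subseteq> mod3.span G" by (rule mod3.span_mono) blast
        ultimately show False using G(2) G(3)[of "G - {v}"] G(1) by blast
      qed
      obtain b1 b2 b3 where b: "v = (b1, b2, b3)" by (metis prod_cases3)
      interpret v: syzygy_pair f1 f2 f3 b1 b2 b3 d e by (rule pair) (use vM v0 v(2) b in auto)
      have "K = v.I"
        by (rule v.bourbaki_ideal_unique) (use v(3) b in \<open>auto simp: bourbaki_ideal_def\<close>)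
      moreover have "v.I \<noteq> UNIV" using v.perfect_if_I_UNIV assms(7) np by blast
      ultimately show "b = ?c" using formula[OF v.syzygy_pair_axioms] v(4) by simp
    qed
    moreover have "Bour f1 f2 f3 = (THE b. \<exists>v K. minimal_generator ?M v \<and> homog3 (int (indeg ?M)) v \<and>
        bourbaki_ideal f1 f2 f3 v K \<and> b = mult_quot K)"
      unfolding Bour_def Let_def by (rule if_not_P[OF False])
    ultimately have "Bour f1 f2 f3 = ?c" by (simp only:)
    then show ?thesis using c by simp
  qed
  \<comment> \<open>The lower bound on the multiplicity is \<open>?c \<le> of_nat e ^ 2\<close>, the
    upper bound is \<open>0 \<le> ?c\<close>.\<close>
  then show ?thesis using c by (simp add: power2_eq_square algebra_simps)
qed

end
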